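(* Let $M$ be a compact smooth $n$-manifold and $E\to M$ a smooth vector bundle of rank $r$. Let $\Lambda=\{(U_\alpha,\varphi_\alpha,\rho_\alpha,\psi_\alpha)\}_{1\le\alpha\le N}$ be an augmented total trivialization atlas for $E$. Let $e\in\mathbb{R}$, $q\in(1,\infty)$ and $\eta\in C^\infty(M)$. If $e$ is a noninteger less than $-1$, assume further that the total trivialization atlas of $\Lambda$ is GGL. Then the linear map $$m_\eta:W^{e,q}(M,E;\Lambda)\to W^{e,q}(M,E;\Lambda),\qquad u\mapsto\eta u$$ is well defined and bounded.
   Context: Manifolds are smooth, Hausdorff and second countable; $E_U=\pi^{-1}(U)$ for a bundle $\pi:E\to M$. Trivializations. A total trivialization triple $(U,\varphi,\rho)$ for $E$ consists of a smooth chart $(U,\varphi)$ of $M$ and a smooth map $\rho=(\rho^1,\dots,\rho^r):E_U\to\mathbb{R}^r$ that is a linear isomorphism on each fibre and such that $(\pi,\rho):E_U\to U\times\mathbb{R}^r$ is a diffeomorphism. An augmented total trivialization atlas is a finite collection $\{(U_\alpha,\varphi_\alpha,\rho_\alpha,\psi_\alpha)\}_{1\le\alpha\le N}$ of such triples, whose charts form a smooth atlas of $M$, together with a smooth nonnegative partition of unity $\{\psi_\alpha\}$ with $\mathrm{supp}\,\psi_\alpha\subseteq U_\alpha$. The total trivialization atlas is GGL (generalized geometrically Lipschitz) if each $\varphi_\alpha(U_\alpha)$ is either $\mathbb{R}^n$ or a nonempty bounded open set with Lipschitz boundary. Euclidean spaces. Let $\Omega\subseteq\mathbb{R}^n$ be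 nonempty open, $1<p<\infty$. For $k\in\mathbb{N}_0$, $\|u\|_{W^{k,p}(\Omega)}=\sum_{|\nu|\le k}\|\partial^\nu u\|_{L^p(\Omega)}$; for $s=k+\theta$, $\theta\in(0,1)$, $\|u\|_{W^{s,p}(\Omega)}=\|u\|_{W^{k,p}(\Omega)}+\sum_{|\nu|=k}\big(\iint_{\Omega\times\Omega}\frac{|\partial^\nu u(x)-\partial^\nu u(y)|^p}{|x-y|^{n+\theta p}}dx\,dy\big)^{1/p}$; $W^{s,p}(\Omega)$ is the set of $u\in L^p(\Omega)$ with finite norm. For $s\ge0$, $W^{s,p}_0(\Omega)$ is the closure of $C_c^\infty(\Omega)$ in $W^{s,p}(\Omega)$. For $s<0$, $W^{s,p}(\Omega)=(W_0^{-s,p'}(\Omega))^*$, $1/p+1/p'=1$, viewed as a subspace of $D'(\Omega)$ by restriction to $C_c^\infty(\Omega)$. Distributions. Let $\mathcal{D}$ be the density bundle of $M$ and $E^\vee=\mathrm{Hom}(E,\mathcal{D})$. $D'(M,E)$ is the topological dual of $D(M,E^\vee)=C^\infty_c(M,E^\vee)$ with its usual test-function topology; $\eta u$ is defined by $\langle\eta u,\zeta\rangle=\langle u,\eta\zeta\rangle$. For $u\in D'(M,E)$, the local representation $H_\alpha(u)\in D'(\varphi_\alpha(U_\alpha))^r$ has components $[H_\alpha(u)]^l(\xi)=\langle u,g_{l,\xi}\rangle$, where $g_{l,\xi}$ is the section of $E^\vee$ supported in $U_\alpha$ with $g_{l,\xi}(x)(a)=\xi(\varphi_\alpha(x))\,\rho_\alpha^l(a)\,|dx^1\wedge\cdots\wedge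 dx^n|_x$ for $a\in E_x$, $\varphi_\alpha=(x^i)$. If $u$ is the regular distribution $\zeta\mapsto\int_M\zeta(f)$ given by a section $f$, then $[H_\alpha(u)]^l=\rho_\alpha^l\circ f\circ\varphi_\alpha^{-1}$. Sobolev spaces. $W^{e,q}(M,E;\Lambda)=\{u\in D'(M,E):\|u\|_{W^{e,q}(M,E;\Lambda)}:=\sum_{\alpha=1}^N\sum_{l=1}^r\|[H_\alpha(\psi_\alpha u)]^l\|_{W^{e,q}(\varphi_\alpha(U_\alpha))}<\infty\}$. *)

theory Defs
  imports "HOL-Analysis.Analysis"
begin

section \<open>Smooth maps between Euclidean spaces\<close>

text \<open>\<open>Ck_on k f S\<close> says that \<open>f\<close> is of class \<open>C\<^sup>k\<close> on the (open) set \<open>S\<close>.\<close>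

primrec Ck_on :: "nat \<Rightarrow> ('a::real_normed_vector \<Rightarrow> 'b::real_normed_vector) \<Rightarrow> 'a set \<Rightarrow> bool" where
  "Ck_on 0 f S \<longleftrightarrow> continuous_on S f"
| "Ck_on (Suc k) f S \<longleftrightarrow> (\<forall>x\<in>S. f differentiable (at x)) \<and>
     (\<forall>v. Ck_on k (\<lambda>x. frechet_derivative f (at x) v) S)"

definition smooth_on :: "'a::real_normed_vector set \<Rightarrow> ('a \<Rightarrow> 'b::real_normed_vector) \<Rightarrow> bool" where
  "smooth_on S f \<longleftrightarrow> (\<forall>k. Ck_on k f S)"

section \<open>Smooth manifolds\<close>

text \<open>
  A manifold is a type of class \<open>t2_space\<close> and \<open>second_countable_topology\<close> together with a
  smooth atlas.  A chart \<open>(U, \<phi>)\<close> is a total function \<open>\<phi>\<close> of which only the values on \<open>U\<close>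
  are meaningful; its inverse is \<open>inv_into U \<phi>\<close>.
\<close>

type_synonym ('m, 'a) chart = "'m set \<times> ('m \<Rightarrow> 'a)"

definition is_chart :: "('m::topological_space, 'a::euclidean_space) chart \<Rightarrow> bool" where
  "is_chart c \<longleftrightarrow> (case c of (U, \<phi>) \<Rightarrow>
     open U \<and> open (\<phi> ` U) \<and> homeomorphism U (\<phi> ` U) \<phi> (inv_into U \<phi>))"

definition smoothly_compatible ::
  "('m, 'a::euclidean_space) chart \<Rightarrow> ('m, 'a) chart \<Rightarrow> bool" where
  "smoothly_compatible c d \<longleftrightarrow> (case (c, d) of ((U, \<phi>), (V, \<psi>)) \<Rightarrow>
     smooth_on (\<phi> ` (U \<inter> V)) (\<psi> \<circ> inv_into U \<phi>) \<and>
     smooth_on (\<psi> ` (U \<inter> V)) (\<phi> \<circ> inv_into V \<psi>))"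

text \<open>The smooth charts of the manifold, i.e. the maximal atlas generated by \<open>A\<close>.\<close>

definition smooth_charts ::
  "('m::topological_space, 'a::euclidean_space) chart set \<Rightarrow> ('m, 'a) chart set" where
  "smooth_charts A = {c. is_chart c \<and> (\<forall>d\<in>A. smoothly_compatible c d)}"

definition smooth_atlas :: "('m::topological_space, 'a::euclidean_space) chart set \<Rightarrow> bool" where
  "smooth_atlas A \<longleftrightarrow> (\<Union>c\<in>A. fst c) = UNIV \<and> A \<subseteq> smooth_charts A"

definition euclidean_atlas :: "('a::euclidean_space, 'a) chart set" where
  "euclidean_atlas = {(UNIV, id)}"

definition prod_atlas ::
  "('m, 'a) chart set \<Rightarrow> ('k, 'b) chart set \<Rightarrow> ('m \<times> 'k, 'a \<times> 'b) chart set" where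
  "prod_atlas A B = {(U \<times> V, map_prod \<phi> \<psi>) | U V \<phi> \<psi>. (U, \<phi>) \<in> A \<and> (V, \<psi>) \<in> B}"

text \<open>Meaningful for open \<open>S\<close>: the condition \<open>U \<subseteq> S\<close> is then no restriction.\<close>

definition smooth_map_on ::
  "('m::topological_space, 'a::euclidean_space) chart set \<Rightarrow> 'm set \<Rightarrow>
   ('k::topological_space, 'b::euclidean_space) chart set \<Rightarrow> ('m \<Rightarrow> 'k) \<Rightarrow> bool" where
  "smooth_map_on A S B f \<longleftrightarrow>
     (\<forall>x\<in>S. \<exists>U \<phi> V \<psi>. (U, \<phi>) \<in> smooth_charts A \<and> (V, \<psi>) \<in> smooth_charts B \<and>
        x \<in> U \<and> U \<subseteq> S \<and> f ` U \<subseteq> V \<and> smooth_on (\<phi> ` U) (\<psi> \<circ> f \<circ> inv_into U \<phi>))"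

definition diffeomorphism_on ::
  "('m::topological_space, 'a::euclidean_space) chart set \<Rightarrow> 'm set \<Rightarrow>
   ('k::topological_space, 'b::euclidean_space) chart set \<Rightarrow> 'k set \<Rightarrow> ('m \<Rightarrow> 'k) \<Rightarrow> bool" where
  "diffeomorphism_on A S B T f \<longleftrightarrow> bij_betw f S T \<and>
     smooth_map_on A S B f \<and> smooth_map_on B T A (inv_into S f)"

definition smooth_function ::
  "('m::topological_space, 'a::euclidean_space) chart set \<Rightarrow> ('m \<Rightarrow> real) \<Rightarrow> bool" where
  "smooth_function A f \<longleftrightarrow> smooth_map_on A UNIV euclidean_atlas f"

section \<open>Smooth vector bundles\<close>

text \<open>
  \<open>'m\<close> is the base and \<open>'e\<close> the total space, modelled on \<open>'a\<close> and \<open>'a \<times> 'f\<close>, where \<open>'f\<close> is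
  the typical fibre.  The fibrewise operations are total functions on \<open>'e\<close>; \<open>fadd\<close> is
  meaningful only for two points of the same fibre.
\<close>

record ('m, 'e, 'a, 'f) vector_bundle =
  base_atlas :: "('m, 'a) chart set"
  total_atlas :: "('e, 'a \<times> 'f) chart set"
  bproj :: "'e \<Rightarrow> 'm"
  fadd :: "'e \<Rightarrow> 'e \<Rightarrow> 'e"
  fscale :: "real \<Rightarrow> 'e \<Rightarrow> 'e"

definition is_real_vector_space ::
  "'e set \<Rightarrow> ('e \<Rightarrow> 'e \<Rightarrow> 'e) \<Rightarrow> (real \<Rightarrow> 'e \<Rightarrow> 'e) \<Rightarrow> bool" where
  "is_real_vector_space V add scl \<longleftrightarrow>
     (\<forall>a\<in>V. \<forall>b\<in>V. add a b \<in> V \<and> add a b = add b a) \<and>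
     (\<forall>a\<in>V. \<forall>b\<in>V. \<forall>c\<in>V. add (add a b) c = add a (add b c)) \<and>
     (\<exists>z\<in>V. (\<forall>a\<in>V. add z a = a) \<and> (\<forall>a\<in>V. \<exists>b\<in>V. add a b = z)) \<and>
     (\<forall>s. \<forall>a\<in>V. scl s a \<in> V) \<and>
     (\<forall>a\<in>V. scl 1 a = a) \<and>
     (\<forall>s t. \<forall>a\<in>V. scl s (scl t a) = scl (s * t) a) \<and>
     (\<forall>s. \<forall>a\<in>V. \<forall>b\<in>V. scl s (add a b) = add (scl s a) (scl s b)) \<and>
     (\<forall>s t. \<forall>a\<in>V. scl (s + t) a = add (scl s a) (scl t a))"

definition fibre :: "('m, 'e, 'a, 'f) vector_bundle \<Rightarrow> 'm \<Rightarrow> 'e set" where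
  "fibre E x = bproj E -` {x}"

definition fibrewise_linear_iso ::
  "('m, 'e, 'a, 'f::real_vector) vector_bundle \<Rightarrow> 'm set \<Rightarrow> ('e \<Rightarrow> 'f) \<Rightarrow> bool" where
  "fibrewise_linear_iso E U \<rho> \<longleftrightarrow>
     (\<forall>x\<in>U. bij_betw \<rho> (fibre E x) UNIV \<and>
        (\<forall>a\<in>fibre E x. \<forall>b\<in>fibre E x. \<rho> (fadd E a b) = \<rho> a + \<rho> b) \<and>
        (\<forall>s. \<forall>a\<in>fibre E x. \<rho> (fscale E s a) = s *\<^sub>R \<rho> a))"

definition local_trivialization ::
  "('m::topological_space, 'e::topological_space, 'a::euclidean_space, 'f::euclidean_space)
     vector_bundle \<Rightarrow> 'm set \<Rightarrow> ('e \<Rightarrow> 'f) \<Rightarrow> bool" where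
  "local_trivialization E U \<rho> \<longleftrightarrow> open U \<and>
     smooth_map_on (total_atlas E) (bproj E -` U) euclidean_atlas \<rho> \<and>
     fibrewise_linear_iso E U \<rho> \<and>
     diffeomorphism_on (total_atlas E) (bproj E -` U)
       (prod_atlas (base_atlas E) euclidean_atlas) (U \<times> UNIV) (\<lambda>a. (bproj E a, \<rho> a))"

definition smooth_vector_bundle ::
  "('m::{t2_space, second_countable_topology}, 'e::{t2_space, second_countable_topology},
    'a::euclidean_space, 'f::euclidean_space) vector_bundle \<Rightarrow> bool" where
  "smooth_vector_bundle E \<longleftrightarrow>
     smooth_atlas (base_atlas E) \<and> smooth_atlas (total_atlas E) \<and>
     surj (bproj E) \<and> smooth_map_on (total_atlas E) UNIV (base_atlas E) (bproj E) \<and>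
     (\<forall>x. is_real_vector_space (fibre E x) (fadd E) (fscale E)) \<and>
     (\<forall>x. \<exists>U \<rho>. x \<in> U \<and> local_trivialization E U \<rho>)"

definition total_triv_triple ::
  "('m::topological_space, 'e::topological_space, 'a::euclidean_space, 'f::euclidean_space)
     vector_bundle \<Rightarrow> 'm set \<Rightarrow> ('m \<Rightarrow> 'a) \<Rightarrow> ('e \<Rightarrow> 'f) \<Rightarrow> bool" where
  "total_triv_triple E U \<phi> \<rho> \<longleftrightarrow>
     (U, \<phi>) \<in> smooth_charts (base_atlas E) \<and> local_trivialization E U \<rho>"

record ('m, 'e, 'a, 'f) triv_piece =
  dom_of :: "'m set"
  coord_of :: "'m \<Rightarrow> 'a"
  triv_of :: "'e \<Rightarrow> 'f"
  weight_of :: "'m \<Rightarrow> real"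

definition augmented_total_triv_atlas ::
  "('m::topological_space, 'e::topological_space, 'a::euclidean_space, 'f::euclidean_space)
     vector_bundle \<Rightarrow> nat \<Rightarrow> (nat \<Rightarrow> ('m, 'e, 'a, 'f) triv_piece) \<Rightarrow> bool" where
  "augmented_total_triv_atlas E N \<Lambda> \<longleftrightarrow>
     (\<forall>\<alpha>\<in>{1..N}. total_triv_triple E (dom_of (\<Lambda> \<alpha>)) (coord_of (\<Lambda> \<alpha>)) (triv_of (\<Lambda> \<alpha>))) \<and>
     smooth_atlas ((\<lambda>\<alpha>. (dom_of (\<Lambda> \<alpha>), coord_of (\<Lambda> \<alpha>))) ` {1..N}) \<and>
     (\<forall>\<alpha>\<in>{1..N}. smooth_function (base_atlas E) (weight_of (\<Lambda> \<alpha>)) \<and>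
        (\<forall>x. 0 \<le> weight_of (\<Lambda> \<alpha>) x) \<and>
        closure {x. weight_of (\<Lambda> \<alpha>) x \<noteq> 0} \<subseteq> dom_of (\<Lambda> \<alpha>)) \<and>
     (\<forall>x. (\<Sum>\<alpha>=1..N. weight_of (\<Lambda> \<alpha>) x) = 1)"

text \<open>
  Near each boundary point the set lies strictly above the graph of a Lipschitz function, after
  a rotation of the axes.  The unit vector \<open>w\<close> is the rotated last axis, and the hyperplane
  orthogonal to \<open>w\<close> plays the role of \<open>\<real>\<^sup>n\<^sup>-\<^sup>1\<close>.
\<close>

definition lipschitz_boundary :: "'a::euclidean_space set \<Rightarrow> bool" where
  "lipschitz_boundary \<Omega> \<longleftrightarrow>
     (\<forall>x\<in>frontier \<Omega>. \<exists>r>0. \<exists>w \<gamma> L. norm w = 1 \<and>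
        L-lipschitz_on {z. z \<bullet> w = 0} (\<gamma> :: 'a \<Rightarrow> real) \<and>
        \<Omega> \<inter> ball x r = {y \<in> ball x r. y \<bullet> w > \<gamma> (y - (y \<bullet> w) *\<^sub>R w)})"

definition GGL :: "nat \<Rightarrow> (nat \<Rightarrow> ('m, 'e, 'a::euclidean_space, 'f) triv_piece) \<Rightarrow> bool" where
  "GGL N \<Lambda> \<longleftrightarrow> (\<forall>\<alpha>\<in>{1..N}. let \<Omega> = coord_of (\<Lambda> \<alpha>) ` dom_of (\<Lambda> \<alpha>) in
     \<Omega> = UNIV \<or> (\<Omega> \<noteq> {} \<and> bounded \<Omega> \<and> open \<Omega> \<and> lipschitz_boundary \<Omega>))"

section \<open>Sobolev spaces on open subsets of Euclidean space\<close>

subsection \<open>Test functions and weak derivatives\<close>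

definition partial_deriv :: "'n \<Rightarrow> (real ^ 'n::finite \<Rightarrow> real) \<Rightarrow> real ^ 'n \<Rightarrow> real" where
  "partial_deriv i f = (\<lambda>x. frechet_derivative f (at x) (axis i 1))"

text \<open>
  The index type carries no order, so the partial derivatives are taken along some fixed
  enumeration of it; for smooth functions the order is immaterial.
\<close>

definition multi_deriv :: "('n \<Rightarrow> nat) \<Rightarrow> (real ^ 'n::finite \<Rightarrow> real) \<Rightarrow> real ^ 'n \<Rightarrow> real" where
  "multi_deriv \<nu> f =
     foldr (\<lambda>i. partial_deriv i ^^ \<nu> i) (SOME xs. distinct xs \<and> set xs = UNIV) f"

abbreviation multi_order :: "('n::finite \<Rightarrow> nat) \<Rightarrow> nat" where
  "multi_order \<nu> \<equiv> sum \<nu> UNIV"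

text \<open>Elements of \<open>C\<^sub>c\<^sup>\<infinity>(\<Omega>)\<close> are extended by zero to the whole space.\<close>

definition test_functions :: "'a::euclidean_space set \<Rightarrow> ('a \<Rightarrow> real) set" where
  "test_functions \<Omega> = {\<xi>. smooth_on UNIV \<xi> \<and>
     compact (closure {x. \<xi> x \<noteq> 0}) \<and> closure {x. \<xi> x \<noteq> 0} \<subseteq> \<Omega>}"

definition locally_integrable_on :: "'a::euclidean_space set \<Rightarrow> ('a \<Rightarrow> real) \<Rightarrow> bool" where
  "locally_integrable_on \<Omega> v \<longleftrightarrow> (\<forall>K. compact K \<and> K \<subseteq> \<Omega> \<longrightarrow> v absolutely_integrable_on K)"

definition weak_derivs ::
  "(real ^ 'n::finite) set \<Rightarrow> ('n \<Rightarrow> nat) \<Rightarrow> (real ^ 'n \<Rightarrow> real) \<Rightarrow> (real ^ 'n \<Rightarrow> real) set" where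
  "weak_derivs \<Omega> \<nu> u = {v. locally_integrable_on \<Omega> v \<and>
     (\<forall>\<xi>\<in>test_functions \<Omega>.
        (LINT x|lebesgue_on \<Omega>. u x * multi_deriv \<nu> \<xi> x) =
        (- 1) ^ multi_order \<nu> * (LINT x|lebesgue_on \<Omega>. v x * \<xi> x))}"

subsection \<open>Nonnegative order\<close>

definition ennreal_root :: "real \<Rightarrow> ennreal \<Rightarrow> ennreal" where
  "ennreal_root p t = (if t = \<infinity> then \<infinity> else ennreal (enn2real t powr (1 / p)))"

definition Lp_norm :: "real \<Rightarrow> 'a::euclidean_space set \<Rightarrow> ('a \<Rightarrow> real) \<Rightarrow> ennreal" where
  "Lp_norm p \<Omega> v = ennreal_root p (\<integral>\<^sup>+ x. ennreal (\<bar>v x\<bar> powr p) \<partial>lebesgue_on \<Omega>)"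

definition Lp_space :: "real \<Rightarrow> 'a::euclidean_space set \<Rightarrow> ('a \<Rightarrow> real) set" where
  "Lp_space p \<Omega> = {v \<in> borel_measurable (lebesgue_on \<Omega>). Lp_norm p \<Omega> v < \<infinity>}"

definition gagliardo_seminorm ::
  "real \<Rightarrow> real \<Rightarrow> (real ^ 'n::finite) set \<Rightarrow> (real ^ 'n \<Rightarrow> real) \<Rightarrow> ennreal" where
  "gagliardo_seminorm \<theta> p \<Omega> v = ennreal_root p
     (\<integral>\<^sup>+ z. ennreal (\<bar>v (fst z) - v (snd z)\<bar> powr p /
               norm (fst z - snd z) powr (real CARD('n) + \<theta> * p)) \<partial>lebesgue_on (\<Omega> \<times> \<Omega>))"

text \<open>
  Weak derivatives are unique up to null sets, so each infimum is over a set of representatives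
  on which the norm is constant; it is infinite if the weak derivative is not a function.
\<close>

definition sobolev_norm_fun ::
  "real \<Rightarrow> real \<Rightarrow> (real ^ 'n::finite) set \<Rightarrow> (real ^ 'n \<Rightarrow> real) \<Rightarrow> ennreal" where
  "sobolev_norm_fun s p \<Omega> u =
     (\<Sum>\<nu> | multi_order \<nu> \<le> nat \<lfloor>s\<rfloor>. INF v\<in>weak_derivs \<Omega> \<nu> u. Lp_norm p \<Omega> v) +
     (if s \<in> \<int> then 0
      else \<Sum>\<nu> | multi_order \<nu> = nat \<lfloor>s\<rfloor>.
             INF v\<in>weak_derivs \<Omega> \<nu> u. gagliardo_seminorm (frac s) p \<Omega> v)"

definition sobolev_space_fun ::
  "real \<Rightarrow> real \<Rightarrow> (real ^ 'n::finite) set \<Rightarrow> (real ^ 'n \<Rightarrow> real) set" where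
  "sobolev_space_fun s p \<Omega> = {u \<in> Lp_space p \<Omega>. sobolev_norm_fun s p \<Omega> u < \<infinity>}"

definition sobolev_space0_fun ::
  "real \<Rightarrow> real \<Rightarrow> (real ^ 'n::finite) set \<Rightarrow> (real ^ 'n \<Rightarrow> real) set" where
  "sobolev_space0_fun s p \<Omega> = {u \<in> sobolev_space_fun s p \<Omega>.
     \<forall>\<epsilon>>0. \<exists>\<xi>\<in>test_functions \<Omega>. sobolev_norm_fun s p \<Omega> (\<lambda>x. u x - \<xi> x) < ennreal \<epsilon>}"

subsection \<open>Duals, and the norm of a distribution\<close>

definition dual_norm0 ::
  "real \<Rightarrow> real \<Rightarrow> (real ^ 'n::finite) set \<Rightarrow> ((real ^ 'n \<Rightarrow> real) \<Rightarrow> real) \<Rightarrow> ennreal" where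
  "dual_norm0 s p \<Omega> F =
     (SUP w\<in>{w \<in> sobolev_space0_fun s p \<Omega>. sobolev_norm_fun s p \<Omega> w \<le> 1}. ennreal \<bar>F w\<bar>)"

text \<open>
  Functionals are total functions, of which only the values on the space in question matter.
  A bounded \<open>F\<close> takes equal values on functions that agree almost everywhere.
\<close>

definition dual_space0 ::
  "real \<Rightarrow> real \<Rightarrow> (real ^ 'n::finite) set \<Rightarrow> ((real ^ 'n \<Rightarrow> real) \<Rightarrow> real) set" where
  "dual_space0 s p \<Omega> = {F.
     (\<forall>v\<in>sobolev_space0_fun s p \<Omega>. \<forall>w\<in>sobolev_space0_fun s p \<Omega>.
        F (\<lambda>x. v x + w x) = F v + F w) \<and>
     (\<forall>c. \<forall>w\<in>sobolev_space0_fun s p \<Omega>. F (\<lambda>x. c * w x) = c * F w) \<and>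
     (\<exists>C\<ge>0. \<forall>w\<in>sobolev_space0_fun s p \<Omega>. ennreal \<bar>F w\<bar> \<le> ennreal C * sobolev_norm_fun s p \<Omega> w)}"

text \<open>
  The norm of a distribution \<open>T\<close> on \<open>\<Omega>\<close>, infinite if \<open>T\<close> does not belong to the space.
  For \<open>s \<ge> 0\<close> the infimum is over the functions that represent \<open>T\<close> (all equal almost everywhere),
  for \<open>s < 0\<close> over the functionals that extend \<open>T\<close> (all equal, by density of the
  test functions); so in both cases the value is that of any one of them.
\<close>

definition sobolev_norm ::
  "real \<Rightarrow> real \<Rightarrow> (real ^ 'n::finite) set \<Rightarrow> ((real ^ 'n \<Rightarrow> real) \<Rightarrow> real) \<Rightarrow> ennreal" where
  "sobolev_norm s p \<Omega> T =
     (if 0 \<le> s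
      then INF u\<in>{u \<in> Lp_space p \<Omega>. \<forall>\<xi>\<in>test_functions \<Omega>. T \<xi> = (LINT x|lebesgue_on \<Omega>. u x * \<xi> x)}.
             sobolev_norm_fun s p \<Omega> u
      else INF F\<in>{F \<in> dual_space0 (- s) (p / (p - 1)) \<Omega>. \<forall>\<xi>\<in>test_functions \<Omega>. T \<xi> = F \<xi>}.
             dual_norm0 (- s) (p / (p - 1)) \<Omega> F)"

section \<open>Tangent vectors and densities\<close>

text \<open>
  A tangent vector at \<open>x\<close> is given by its coordinate vectors in all smooth charts around \<open>x\<close>,
  related by the differentials of the transition maps; charts not around \<open>x\<close> get value \<open>0\<close>.
\<close>

type_synonym ('m, 'a) tangent = "('m, 'a) chart \<Rightarrow> 'a"

definition charts_at ::
  "('m::topological_space, 'a::euclidean_space) chart set \<Rightarrow> 'm \<Rightarrow> ('m, 'a) chart set" where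
  "charts_at A x = {c \<in> smooth_charts A. x \<in> fst c}"

definition transition_differential ::
  "('m, 'a::euclidean_space) chart \<Rightarrow> ('m, 'a) chart \<Rightarrow> 'm \<Rightarrow> 'a \<Rightarrow> 'a" where
  "transition_differential c d x =
     frechet_derivative (snd d \<circ> inv_into (fst c) (snd c)) (at (snd c x))"

definition tangent_space ::
  "('m::topological_space, 'a::euclidean_space) chart set \<Rightarrow> 'm \<Rightarrow> ('m, 'a) tangent set" where
  "tangent_space A x = {v.
     (\<forall>c\<in>charts_at A x. \<forall>d\<in>charts_at A x. v d = transition_differential c d x (v c)) \<and>
     (\<forall>c. c \<notin> charts_at A x \<longrightarrow> v c = 0)}"

text \<open>The coordinate vector \<open>\<partial>/\<partial>x\<^sup>i\<close> at \<open>x\<close> of the chart \<open>c\<close>.\<close>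

definition coord_vector ::
  "('m::topological_space, real ^ 'n::finite) chart set \<Rightarrow> ('m, real ^ 'n) chart \<Rightarrow> 'm \<Rightarrow> 'n \<Rightarrow>
   ('m, real ^ 'n) tangent" where
  "coord_vector A c x i =
     (\<lambda>d. if d \<in> charts_at A x then transition_differential c d x (axis i 1) else 0)"

text \<open>
  A density at \<open>x\<close> is a function \<open>\<mu>\<close> of \<open>n\<close> tangent vectors with
  \<open>\<mu>(T v\<^sub>1, \<dots>, T v\<^sub>n) = \<bar>det T\<bar> \<mu>(v\<^sub>1, \<dots>, v\<^sub>n)\<close> for linear \<open>T\<close>.  Below, \<open>T\<close> is replaced by the matrix
  \<open>B\<close> of coefficients with \<open>T v\<^sub>i = (\<Sum>j. B\<^sub>i\<^sub>j v\<^sub>j)\<close>; for linearly dependent \<open>v\<^sub>i\<close> both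
  conditions force the value \<open>0\<close>.
\<close>

type_synonym ('m, 'a, 'n) density = "('n \<Rightarrow> ('m, 'a) tangent) \<Rightarrow> real"

definition density_space ::
  "('m::topological_space, real ^ 'n::finite) chart set \<Rightarrow> 'm \<Rightarrow>
   ('m, real ^ 'n, 'n) density set" where
  "density_space A x = {\<mu>.
     (\<forall>V. (\<forall>i. V i \<in> tangent_space A x) \<longrightarrow>
        (\<forall>B :: real ^ 'n ^ 'n.
           \<mu> (\<lambda>i c. \<Sum>j\<in>UNIV. (B $ i $ j) *\<^sub>R V j c) = \<bar>det B\<bar> * \<mu> V)) \<and>
     (\<forall>V. \<not> (\<forall>i. V i \<in> tangent_space A x) \<longrightarrow> \<mu> V = 0)}"

text \<open>The density \<open>\<bar>dx\<^sup>1 \<and> \<dots> \<and> dx\<^sup>n\<bar>\<close> at \<open>x\<close> of the chart \<open>c\<close>.\<close>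

definition coord_density ::
  "('m::topological_space, real ^ 'n::finite) chart set \<Rightarrow> ('m, real ^ 'n) chart \<Rightarrow> 'm \<Rightarrow>
   ('m, real ^ 'n, 'n) density" where
  "coord_density A c x =
     (\<lambda>V. if \<forall>i. V i \<in> tangent_space A x then \<bar>det (\<chi> i j. V i c $ j)\<bar> else 0)"

section \<open>Distributional sections\<close>

text \<open>
  A section of \<open>Hom(E, D)\<close>, with \<open>D\<close> the density bundle, is represented by the function \<open>\<zeta>\<close> on the
  total space of \<open>E\<close> that maps \<open>a\<close> in the fibre over \<open>x\<close> to the density \<open>\<zeta>\<^sub>x(a)\<close> at \<open>x\<close>.
\<close>

type_synonym ('m, 'e, 'a, 'n) dual_section = "'e \<Rightarrow> ('m, 'a, 'n) density"

definition dual_sections ::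
  "('m::topological_space, 'e, real ^ 'n::finite, 'f) vector_bundle \<Rightarrow>
   ('m, 'e, real ^ 'n, 'n) dual_section set" where
  "dual_sections E = {\<zeta>.
     (\<forall>a. \<zeta> a \<in> density_space (base_atlas E) (bproj E a)) \<and>
     (\<forall>a b. bproj E a = bproj E b \<longrightarrow> \<zeta> (fadd E a b) = (\<lambda>V. \<zeta> a V + \<zeta> b V)) \<and>
     (\<forall>s a. \<zeta> (fscale E s a) = (\<lambda>V. s * \<zeta> a V))}"

text \<open>
  The components of \<open>\<zeta>\<close>, in coordinates, with respect to the frame of \<open>E\<close> given by \<open>\<rho>\<close>
  and the density \<open>\<bar>dx\<^sup>1 \<and> \<dots> \<and> dx\<^sup>n\<bar>\<close> (which takes the value \<open>1\<close> on the coordinate vectors).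
\<close>

definition frame ::
  "('m, 'e, 'a, real ^ 'r::finite) vector_bundle \<Rightarrow> ('e \<Rightarrow> real ^ 'r) \<Rightarrow> 'r \<Rightarrow> 'm \<Rightarrow> 'e" where
  "frame E \<rho> l x = (THE a. bproj E a = x \<and> \<rho> a = axis l 1)"

definition dual_component ::
  "('m::topological_space, 'e, real ^ 'n::finite, real ^ 'r::finite) vector_bundle \<Rightarrow> 'm set \<Rightarrow>
   ('m \<Rightarrow> real ^ 'n) \<Rightarrow> ('e \<Rightarrow> real ^ 'r) \<Rightarrow> 'r \<Rightarrow>
   ('m, 'e, real ^ 'n, 'n) dual_section \<Rightarrow> real ^ 'n \<Rightarrow> real" where
  "dual_component E U \<phi> \<rho> l \<zeta> =
     (\<lambda>y. let x = inv_into U \<phi> y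
          in \<zeta> (frame E \<rho> l x) (coord_vector (base_atlas E) (U, \<phi>) x))"

text \<open>
  The test space \<open>D(M, E\<^sup>\<or>)\<close> for a compact base \<open>M\<close>: all supports are compact, and the usual
  topology is the one given by the seminorms
  \<open>\<zeta> \<mapsto> sup\<^sub>K \<bar>\<partial>\<^sup>\<nu> \<zeta>\<^sub>l\<bar>\<close> for the components \<open>\<zeta>\<^sub>l\<close> of \<open>\<zeta>\<close> in all total trivialization triples and
  compact \<open>K \<subseteq> \<phi>(U)\<close>.  The subbasic sets are the open balls of these seminorms.
\<close>

definition test_sections ::
  "('m::topological_space, 'e::topological_space, real ^ 'n::finite, real ^ 'r::finite)
     vector_bundle \<Rightarrow> ('m, 'e, real ^ 'n, 'n) dual_section set" where
  "test_sections E = {\<zeta> \<in> dual_sections E.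
     \<forall>U \<phi> \<rho> l. total_triv_triple E U \<phi> \<rho> \<longrightarrow> smooth_on (\<phi> ` U) (dual_component E U \<phi> \<rho> l \<zeta>)}"

definition test_topology ::
  "('m::topological_space, 'e::topological_space, real ^ 'n::finite, real ^ 'r::finite)
     vector_bundle \<Rightarrow> ('m, 'e, real ^ 'n, 'n) dual_section topology" where
  "test_topology E = topology_generated_by
     {{\<zeta> \<in> test_sections E. \<forall>y\<in>K.
         \<bar>multi_deriv \<nu> (\<lambda>y. dual_component E U \<phi> \<rho> l \<zeta> y - dual_component E U \<phi> \<rho> l \<zeta>0 y) y\<bar> < \<epsilon>}
      | \<zeta>0 U \<phi> \<rho> l K \<nu> \<epsilon>. \<zeta>0 \<in> test_sections E \<and> total_triv_triple E U \<phi> \<rho> \<and>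
          compact K \<and> K \<subseteq> \<phi> ` U \<and> 0 < \<epsilon>}"

text \<open>The space \<open>D'(M, E)\<close>; only the values of its elements on \<open>test_sections E\<close> matter.\<close>

definition distributions ::
  "('m::topological_space, 'e::topological_space, real ^ 'n::finite, real ^ 'r::finite)
     vector_bundle \<Rightarrow> (('m, 'e, real ^ 'n, 'n) dual_section \<Rightarrow> real) set" where
  "distributions E = {u.
     (\<forall>\<zeta>\<in>test_sections E. \<forall>\<zeta>'\<in>test_sections E. u (\<lambda>a V. \<zeta> a V + \<zeta>' a V) = u \<zeta> + u \<zeta>') \<and>
     (\<forall>c. \<forall>\<zeta>\<in>test_sections E. u (\<lambda>a V. c * \<zeta> a V) = c * u \<zeta>) \<and>
     continuous_map (test_topology E) euclideanreal u}"

definition mult_distribution ::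
  "('m, 'e, 'a, 'f) vector_bundle \<Rightarrow> ('m \<Rightarrow> real) \<Rightarrow>
   (('m, 'e, 'a, 'n) dual_section \<Rightarrow> real) \<Rightarrow> ('m, 'e, 'a, 'n) dual_section \<Rightarrow> real" where
  "mult_distribution E \<eta> u = (\<lambda>\<zeta>. u (\<lambda>a V. \<eta> (bproj E a) * \<zeta> a V))"

section \<open>Sobolev spaces of sections\<close>

definition local_test_section ::
  "('m::topological_space, 'e, real ^ 'n::finite, real ^ 'r::finite) vector_bundle \<Rightarrow>
   ('m, 'e, real ^ 'n, real ^ 'r) triv_piece \<Rightarrow> 'r \<Rightarrow> (real ^ 'n \<Rightarrow> real) \<Rightarrow>
   ('m, 'e, real ^ 'n, 'n) dual_section" where
  "local_test_section E P l \<xi> =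
     (\<lambda>a V. let x = bproj E a in
        if x \<in> dom_of P
        then \<xi> (coord_of P x) * (triv_of P a $ l) *
             coord_density (base_atlas E) (dom_of P, coord_of P) x V
        else 0)"

definition local_rep ::
  "('m::topological_space, 'e, real ^ 'n::finite, real ^ 'r::finite) vector_bundle \<Rightarrow>
   ('m, 'e, real ^ 'n, real ^ 'r) triv_piece \<Rightarrow>
   (('m, 'e, real ^ 'n, 'n) dual_section \<Rightarrow> real) \<Rightarrow> 'r \<Rightarrow> (real ^ 'n \<Rightarrow> real) \<Rightarrow> real" where
  "local_rep E P u l = (\<lambda>\<xi>. u (local_test_section E P l \<xi>))"

definition sobolev_norm_bundle ::
  "('m::topological_space, 'e, real ^ 'n::finite, real ^ 'r::finite) vector_bundle \<Rightarrow> nat \<Rightarrow>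
   (nat \<Rightarrow> ('m, 'e, real ^ 'n, real ^ 'r) triv_piece) \<Rightarrow> real \<Rightarrow> real \<Rightarrow>
   (('m, 'e, real ^ 'n, 'n) dual_section \<Rightarrow> real) \<Rightarrow> ennreal" where
  "sobolev_norm_bundle E N \<Lambda> e q u =
     (\<Sum>\<alpha>=1..N. \<Sum>l\<in>UNIV. sobolev_norm e q (coord_of (\<Lambda> \<alpha>) ` dom_of (\<Lambda> \<alpha>))
        (local_rep E (\<Lambda> \<alpha>) (mult_distribution E (weight_of (\<Lambda> \<alpha>)) u) l))"

definition sobolev_space_bundle ::
  "('m::topological_space, 'e::topological_space, real ^ 'n::finite, real ^ 'r::finite)
     vector_bundle \<Rightarrow> nat \<Rightarrow>
   (nat \<Rightarrow> ('m, 'e, real ^ 'n, real ^ 'r) triv_piece) \<Rightarrow> real \<Rightarrow> real \<Rightarrow>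
   (('m, 'e, real ^ 'n, 'n) dual_section \<Rightarrow> real) set" where
  "sobolev_space_bundle E N \<Lambda> e q =
     {u \<in> distributions E. sobolev_norm_bundle E N \<Lambda> e q u < \<infinity>}"

end

theory Submission
  imports Defs "HOL-Library.Sublist" "HOL-Real_Asymp.Real_Asymp"
begin

text \<open>
  Let \<open>\<psi>\<close> be a weight of the atlas, with chart \<open>(U, \<phi>)\<close> and \<open>\<Omega> = \<phi>(U)\<close>.  The support of \<open>\<psi>\<close> is
  closed in a compact manifold, so its image in \<open>\<Omega>\<close> is compact, and some \<open>\<theta> \<in> C\<^sub>c\<^sup>\<infinity>(\<Omega>)\<close> agrees there
  with \<open>\<eta>\<close> read in the chart (\<open>coordinate_multiplier\<close>).  The local representation of \<open>\<psi> \<eta> u\<close> is then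
  \<open>\<theta>\<close> times that of \<open>\<psi> u\<close> (\<open>local_rep_mult\<close>).  So the estimate reduces to one on \<open>\<real>\<^sup>n\<close>:
  multiplication by a test function of an open set \<open>\<Omega>\<close> is bounded on \<open>W\<^sup>e\<^sup>,\<^sup>q(\<Omega>)\<close>
  (\<open>sobolev_norm_mult_test_function\<close>).

  For negative \<open>e\<close> this follows by transposition from the case of positive order: the map \<open>w \<mapsto> \<theta> w\<close>
  is bounded on \<open>W\<^sup>-\<^sup>e\<^sup>,\<^sup>q\<^sup>'\<close> and preserves the test functions, hence also their closure.

  Let then \<open>e = k + \<sigma>\<close> with \<open>k \<in> \<nat>\<close> and \<open>0 \<le> \<sigma> < 1\<close>, and write \<open>p\<close> for the exponent.  By the Leibniz rule \<open>\<partial>\<^sup>\<nu>(\<theta> u)\<close> is \<open>\<theta> \<partial>\<^sup>\<nu>u\<close> plus terms \<open>\<theta>' \<partial>\<^sup>\<mu>u\<close> with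
  \<open>\<bar>\<mu>\<bar> < \<bar>\<nu>\<bar>\<close>, where \<open>\<theta>'\<close> is again a test function (\<open>weak_derivs_mult_test_function\<close>).  The
  \<open>L\<^sup>p\<close> norms are bounded term by term.  For \<open>\<sigma> > 0\<close> and the Gagliardo seminorms of the derivatives of order
  \<open>k\<close>, the two kinds of terms need different arguments.
  \<^item> In \<open>\<theta> v\<close> with \<open>v = \<partial>\<^sup>\<nu>u\<close> one writes
    \<open>\<theta>(x) v(x) - \<theta>(y) v(y) = \<theta>(x) (v(x) - v(y)) + (\<theta>(x) - \<theta>(y)) v(y)\<close>.  The first summand is controlled by the
    seminorm of \<open>v\<close>, the second by its \<open>L\<^sup>p\<close> norm, because \<open>\<bar>\<theta>(x) - \<theta>(y)\<bar>\<close> is at most a multiple of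
    \<open>min(1, \<bar>x - y\<bar>)\<close> and the kernel with this factor is integrable
    (\<open>gagliardo_integral_mult_test_function\<close>).
  \<^item> A function \<open>g = \<theta>' \<partial>\<^sup>\<mu>u\<close> with \<open>\<bar>\<mu>\<bar> < k\<close> has compact support in \<open>\<Omega>\<close> and weak first
    derivatives in \<open>L\<^sup>p\<close>, so its extension by zero lies in \<open>W\<^sup>1\<^sup>,\<^sup>p(\<real>\<^sup>n)\<close>.  There \<open>g(x + h) - g(x)\<close> is almost
    everywhere the integral of the derivative along the segment, whence
    \<open>\<parallel>g(\<sqdot> + h) - g\<parallel> = O(min(1, \<bar>h\<bar>))\<close> in \<open>L\<^sup>p\<close>, and the seminorm is bounded by integration
    against the same kernel (\<open>gagliardo_integral_le_weak_derivative\<close>).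

  The Sobolev norms of nonnegative order are sums of infima over the versions of each weak derivative.  Two
  versions agree almost everywhere, by the fundamental lemma of the calculus of variations, so all the
  infima are values at one family of weak derivatives (\<open>sobolev_norm_fun_family\<close>).

  Finally \<open>\<eta> u\<close> is again a distribution because multiplication by \<open>\<eta>\<close> is continuous on the test
  sections, by the Leibniz rule on compact sets (\<open>continuous_map_mult_section\<close>).
\<close>

section \<open>Calculus of smooth functions\<close>

lemma has_derivative_cong_open:
  assumes "open S" "x \<in> S" "\<And>y. y \<in> S \<Longrightarrow> f y = g y"
  shows "(f has_derivative f') (at x) \<longleftrightarrow> (g has_derivative f') (at x)"
  using assms has_derivative_transform_within_open[of f f' x UNIV S g]
    has_derivative_transform_within_open[of g f' x UNIV S f] by auto

lemma frechet_derivative_cong_open: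
  assumes "open S" "x \<in> S" "\<And>y. y \<in> S \<Longrightarrow> f y = g y"
  shows "frechet_derivative f (at x) = frechet_derivative g (at x)"
  unfolding frechet_derivative_def using has_derivative_cong_open[OF assms] by simp

lemma differentiable_cong_open:
  assumes "open S" "x \<in> S" "\<And>y. y \<in> S \<Longrightarrow> f y = g y"
  shows "f differentiable (at x) \<longleftrightarrow> g differentiable (at x)"
  unfolding differentiable_def using has_derivative_cong_open[OF assms] by simp

lemma Ck_on_cong:
  assumes "open S" "\<And>y. y \<in> S \<Longrightarrow> f y = g y"
  shows "Ck_on k f S \<longleftrightarrow> Ck_on k g S"
  using assms(2)
proof (induction k arbitrary: f g)
  case 0
  then show ?case by (auto intro: continuous_on_eq)
next
  case (Suc k)
  have "Ck_on k (\<lambda>x. frechet_derivative f (at x) v) S \<longleftrightarrow>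
        Ck_on k (\<lambda>x. frechet_derivative g (at x) v) S" for v
    by (rule Suc.IH) (simp add: frechet_derivative_cong_open[OF assms(1) _ Suc.prems])
  then show ?case
    using differentiable_cong_open[OF assms(1) _ Suc.prems] by simp
qed

lemma Ck_on_subset: "Ck_on k f S \<Longrightarrow> T \<subseteq> S \<Longrightarrow> Ck_on k f T"
  by (induction k arbitrary: f) (auto intro: continuous_on_subset)

lemma Ck_on_SucD: "Ck_on (Suc k) f S \<Longrightarrow> Ck_on k f S"
proof (induction k arbitrary: f)
  case 0
  then show ?case
    by (simp add: continuous_at_imp_continuous_on differentiable_imp_continuous_within)
qed auto

lemma Ck_on_local:
  assumes "\<And>x. x \<in> S \<Longrightarrow> \<exists>T. open T \<and> x \<in> T \<and> Ck_on k f T"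
  shows "Ck_on k f S"
  using assms
proof (induction k arbitrary: f)
  case 0
  have "isCont f x" if "x \<in> S" for x
    using 0[OF that] by (auto simp: continuous_on_eq_continuous_at)
  then show ?case by (simp add: continuous_at_imp_continuous_on)
next
  case (Suc k)
  have "f differentiable at x" if "x \<in> S" for x
    using Suc.prems[OF that] by auto
  moreover have "Ck_on k (\<lambda>x. frechet_derivative f (at x) v) S" for v
    by (rule Suc.IH) (use Suc.prems in fastforce)
  ultimately show ?case by simp
qed

lemma Ck_on_const: "Ck_on k (\<lambda>x. c) S"
  by (induction k arbitrary: c) auto

lemma Ck_on_bounded_linear:
  assumes "bounded_linear h" shows "Ck_on k h S"
proof (cases k)
  case 0
  then show ?thesis using assms by (simp add: linear_continuous_on)
next
  case (Suc m)
  have "(h has_derivative h) (at x)" for x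
    using assms by (rule bounded_linear_imp_has_derivative)
  then have "frechet_derivative h (at x) = h" "h differentiable at x" for x
    by (metis frechet_derivative_at, auto simp: differentiable_def)
  then show ?thesis using Suc by (simp add: Ck_on_const)
qed

lemma Ck_on_bounded_linear_compose:
  assumes "bounded_linear h" "open S" "Ck_on k f S"
  shows "Ck_on k (\<lambda>x. h (f x)) S"
  using assms(3)
proof (induction k arbitrary: f)
  case 0
  then show ?case
    by (simp add: bounded_linear.continuous_on[OF assms(1)])
next
  case (Suc k)
  have d: "((\<lambda>x. h (f x)) has_derivative (\<lambda>v. h (frechet_derivative f (at x) v))) (at x)"
    if "x \<in> S" for x
    using Suc.prems that
    by (intro bounded_linear.has_derivative[OF assms(1)]) (auto simp: frechet_derivative_works[symmetric])
  have "Ck_on k (\<lambda>x. frechet_derivative (\<lambda>x. h (f x)) (at x) v) S" for v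
  proof (subst Ck_on_cong[OF assms(2)])
    show "frechet_derivative (\<lambda>x. h (f x)) (at y) v = h (frechet_derivative f (at y) v)"
      if "y \<in> S" for y
      using frechet_derivative_at[OF d[OF that]] by metis
  qed (use Suc in auto)
  then show ?case using d by (auto simp: differentiable_def)
qed

lemma Ck_on_add:
  assumes "open S" "Ck_on k f S" "Ck_on k g S"
  shows "Ck_on k (\<lambda>x. f x + g x) S"
  using assms(2,3)
proof (induction k arbitrary: f g)
  case 0
  then show ?case by (auto intro: continuous_intros)
next
  case (Suc k)
  have d: "((\<lambda>x. f x + g x) has_derivative
      (\<lambda>v. frechet_derivative f (at x) v + frechet_derivative g (at x) v)) (at x)"
    if "x \<in> S" for x
    using Suc.prems that
    by (intro has_derivative_add) (auto simp: frechet_derivative_works[symmetric])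
  have "Ck_on k (\<lambda>x. frechet_derivative (\<lambda>x. f x + g x) (at x) v) S" for v
  proof (subst Ck_on_cong[OF assms(1)])
    show "frechet_derivative (\<lambda>x. f x + g x) (at y) v =
        frechet_derivative f (at y) v + frechet_derivative g (at y) v"
      if "y \<in> S" for y
      using frechet_derivative_at[OF d[OF that]] by metis
  qed (use Suc in auto)
  then show ?case using d by (auto simp: differentiable_def)
qed

lemma Ck_on_sum:
  assumes "open S" "\<And>i. i \<in> I \<Longrightarrow> Ck_on k (f i) S"
  shows "Ck_on k (\<lambda>x. \<Sum>i\<in>I. f i x) S"
  using assms(2)
  by (induction I rule: infinite_finite_induct) (auto intro: Ck_on_add[OF assms(1)] simp: Ck_on_const)

lemma (in bounded_bilinear) Ck_on:
  assumes "open S" "Ck_on k f S" "Ck_on k g S"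
  shows "Ck_on k (\<lambda>x. prod (f x) (g x)) S"
  using assms(2,3)
proof (induction k arbitrary: f g)
  case 0
  then show ?case by (auto intro: continuous_on)
next
  case (Suc k)
  have d: "((\<lambda>x. prod (f x) (g x)) has_derivative
      (\<lambda>v. prod (f x) (frechet_derivative g (at x) v) + prod (frechet_derivative f (at x) v) (g x))) (at x)"
    if "x \<in> S" for x
    using Suc.prems that
    by (intro FDERIV) (auto simp: frechet_derivative_works[symmetric])
  have "Ck_on k (\<lambda>x. frechet_derivative (\<lambda>x. prod (f x) (g x)) (at x) v) S" for v
  proof (subst Ck_on_cong[OF assms(1)])
    show "frechet_derivative (\<lambda>x. prod (f x) (g x)) (at y) v =
        prod (f y) (frechet_derivative g (at y) v) + prod (frechet_derivative f (at y) v) (g y)"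
      if "y \<in> S" for y
      using frechet_derivative_at[OF d[OF that]] by metis
    show "Ck_on k (\<lambda>y. prod (f y) (frechet_derivative g (at y) v) + prod (frechet_derivative f (at y) v) (g y)) S"
      using Suc.prems Suc.prems[THEN Ck_on_SucD] by (intro Ck_on_add[OF assms(1)] Suc.IH) simp_all
  qed
  then show ?case using d by (auto simp: differentiable_def)
qed

text \<open>
  In the chain rule the inner derivative is expanded in an orthonormal basis, so that the outer
  derivative is only taken in fixed directions, as \<open>Ck_on\<close> requires.
\<close>

lemma Ck_on_compose:
  fixes f :: "'a::real_normed_vector \<Rightarrow> 'b::euclidean_space"
    and g :: "'b \<Rightarrow> 'c::real_normed_vector"
  assumes S: "open S" and T: "open T" and fST: "f ` S \<subseteq> T"
    and "Ck_on k f S" "Ck_on k g T"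
  shows "Ck_on k (\<lambda>x. g (f x)) S"
  using assms(4,5)
proof (induction k arbitrary: g)
  case 0
  then show ?case using fST continuous_on_compose2 by (metis Ck_on.simps(1))
next
  case (Suc k)
  let ?f' = "\<lambda>x. frechet_derivative f (at x)" and ?g' = "\<lambda>x. frechet_derivative g (at x)"
  have fk: "Ck_on k f S" by (rule Ck_on_SucD) (rule Suc.prems)
  have d: "((\<lambda>x. g (f x)) has_derivative (\<lambda>v. ?g' (f x) (?f' x v))) (at x)" if "x \<in> S" for x
    using Suc.prems that fST
    by (intro has_derivative_compose[of f _ _ _ g]) (auto simp: frechet_derivative_works[symmetric])
  have e: "frechet_derivative (\<lambda>x. g (f x)) (at x) v = (\<Sum>b\<in>Basis. (?f' x v \<bullet> b) *\<^sub>R ?g' (f x) b)"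
    if "x \<in> S" for x v
  proof -
    have "g differentiable at (f x)" using Suc.prems(2) that fST by auto
    then interpret bounded_linear "?g' (f x)"
      by (simp add: frechet_derivative_works has_derivative_bounded_linear)
    have "frechet_derivative (\<lambda>x. g (f x)) (at x) v = ?g' (f x) (?f' x v)"
      using frechet_derivative_at[OF d[OF that]] by metis
    also have "\<dots> = ?g' (f x) (\<Sum>b\<in>Basis. (?f' x v \<bullet> b) *\<^sub>R b)"
      by (simp add: euclidean_representation)
    finally show ?thesis by (simp add: sum scale)
  qed
  have "Ck_on k (\<lambda>x. frechet_derivative (\<lambda>x. g (f x)) (at x) v) S" for v
  proof (subst Ck_on_cong[OF S e])
    show "Ck_on k (\<lambda>x. \<Sum>b\<in>Basis. (?f' x v \<bullet> b) *\<^sub>R ?g' (f x) b) S"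
    proof (intro Ck_on_sum[OF S] bounded_bilinear.Ck_on[OF bounded_bilinear_scaleR S])
      fix b :: 'b
      show "Ck_on k (\<lambda>x. ?f' x v \<bullet> b) S"
        using Suc.prems by (intro Ck_on_bounded_linear_compose[OF bounded_linear_inner_left S]) auto
      show "Ck_on k (\<lambda>x. ?g' (f x) b) S"
        using Suc.prems(2) by (intro Suc.IH fk) auto
    qed
  qed auto
  then show ?case using d by (auto simp: differentiable_def)
qed

lemma Ck_on_inverse: "Ck_on k (inverse :: real \<Rightarrow> real) (- {0})"
proof (induction k)
  case 0
  show ?case by (auto intro!: continuous_intros)
next
  case (Suc k)
  have d: "((inverse :: real \<Rightarrow> real) has_derivative (\<lambda>v. - (inverse x * v * inverse x))) (at x)"
    if "x \<in> - {0}" for x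
    using that by (intro has_derivative_inverse') auto
  have "Ck_on k (\<lambda>x. frechet_derivative inverse (at x) v) (- {0::real})" for v :: real
  proof (subst Ck_on_cong[where g = "\<lambda>x. (- v) * (inverse x * inverse x)"])
    show "frechet_derivative inverse (at y) v = (- v) * (inverse y * inverse y)"
      if "y \<in> - {0}" for y :: real
      unfolding frechet_derivative_at[OF d[OF that], symmetric] by simp
    show "Ck_on k (\<lambda>x. (- v) * (inverse x * inverse x)) (- {0})"
      by (intro bounded_bilinear.Ck_on[OF bounded_bilinear_mult] Ck_on_const Suc) auto
  qed auto
  then show ?case using d by (auto simp: differentiable_def)
qed

lemma smooth_on_cong:
  "open S \<Longrightarrow> (\<And>y. y \<in> S \<Longrightarrow> f y = g y) \<Longrightarrow> smooth_on S f \<longleftrightarrow> smooth_on S g"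
  unfolding smooth_on_def using Ck_on_cong by blast

lemma smooth_on_subset: "smooth_on S f \<Longrightarrow> T \<subseteq> S \<Longrightarrow> smooth_on T f"
  unfolding smooth_on_def using Ck_on_subset by blast

lemma smooth_on_local:
  "(\<And>x. x \<in> S \<Longrightarrow> \<exists>T. open T \<and> x \<in> T \<and> smooth_on T f) \<Longrightarrow> smooth_on S f"
  unfolding smooth_on_def using Ck_on_local by metis

lemma smooth_on_const: "smooth_on S (\<lambda>x. c)"
  by (simp add: smooth_on_def Ck_on_const)

lemma smooth_on_bounded_linear: "bounded_linear h \<Longrightarrow> smooth_on S h"
  by (simp add: smooth_on_def Ck_on_bounded_linear)

lemma smooth_on_add: "open S \<Longrightarrow> smooth_on S f \<Longrightarrow> smooth_on S g \<Longrightarrow> smooth_on S (\<lambda>x. f x + g x)"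
  by (simp add: smooth_on_def Ck_on_add)

lemma smooth_on_sum:
  "open S \<Longrightarrow> (\<And>i. i \<in> I \<Longrightarrow> smooth_on S (f i)) \<Longrightarrow> smooth_on S (\<lambda>x. \<Sum>i\<in>I. f i x)"
  by (simp add: smooth_on_def Ck_on_sum)

lemma smooth_on_mult:
  fixes f g :: "'a::real_normed_vector \<Rightarrow> real"
  shows "open S \<Longrightarrow> smooth_on S f \<Longrightarrow> smooth_on S g \<Longrightarrow> smooth_on S (\<lambda>x. f x * g x)"
  by (simp add: smooth_on_def bounded_bilinear.Ck_on[OF bounded_bilinear_mult])

lemma smooth_on_prod:
  fixes f :: "'i \<Rightarrow> 'a::real_normed_vector \<Rightarrow> real"
  assumes "open S" "\<And>i. i \<in> I \<Longrightarrow> smooth_on S (f i)"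
  shows "smooth_on S (\<lambda>x. \<Prod>i\<in>I. f i x)"
  using assms(2)
  by (induction I rule: infinite_finite_induct)
    (auto intro: smooth_on_mult[OF assms(1)] simp: smooth_on_const)

lemma smooth_on_compose:
  fixes f :: "'a::real_normed_vector \<Rightarrow> 'b::euclidean_space"
  assumes "open S" "open T" "f ` S \<subseteq> T" "smooth_on S f" "smooth_on T g"
  shows "smooth_on S (\<lambda>x. g (f x))"
  using assms by (auto simp: smooth_on_def intro: Ck_on_compose)

lemma smooth_on_divide:
  fixes f g :: "'a::real_normed_vector \<Rightarrow> real"
  assumes "open S" "smooth_on S f" "smooth_on S g" "\<And>x. x \<in> S \<Longrightarrow> g x \<noteq> 0"
  shows "smooth_on S (\<lambda>x. f x / g x)"
  unfolding divide_inverse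
proof (intro smooth_on_mult smooth_on_compose[of S "- {0}" g inverse])
  show "smooth_on (- {0::real}) inverse"
    by (simp add: smooth_on_def Ck_on_inverse)
qed (use assms in auto)

lemma smooth_on_differentiable: "smooth_on S f \<Longrightarrow> x \<in> S \<Longrightarrow> f differentiable at x"
  using Ck_on.simps(2) unfolding smooth_on_def by metis

lemma smooth_on_frechet_derivative:
  "smooth_on S f \<Longrightarrow> smooth_on S (\<lambda>x. frechet_derivative f (at x) v)"
  using Ck_on.simps(2) unfolding smooth_on_def by metis

lemma smooth_on_imp_continuous_on: "smooth_on S f \<Longrightarrow> continuous_on S f"
  using Ck_on.simps(1) unfolding smooth_on_def by metis

section \<open>A smooth step function\<close>

text \<open>
  The classical flat function is the member \<open>m = 0\<close> of this family, which is closed under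
  differentiation up to linear combinations.
\<close>

definition flat :: "nat \<Rightarrow> real \<Rightarrow> real" where
  "flat m t = (if t \<le> 0 then 0 else exp (- (1 / t)) / t ^ m)"

lemma flat_has_derivative:
  "(flat m has_real_derivative flat (m + 2) t - real m * flat (m + 1) t) (at t)"
proof (cases "t = 0")
  case False
  show ?thesis
  proof (cases "t < 0")
    case True
    have "((\<lambda>_. 0 :: real) has_real_derivative 0) (at t)" by simp
    then have "(flat m has_real_derivative 0) (at t)"
      by (rule has_field_derivative_transform_within_open[of _ _ _ "{..<0}"])
        (use True in \<open>auto simp: flat_def\<close>)
    then show ?thesis using True by (simp add: flat_def)
  next
    case f: False
    with False have t: "t > 0" by simp
    have "((\<lambda>t. exp (- (1 / t)) / t ^ m) has_real_derivative
        exp (- (1 / t)) / t ^ (m + 2) - real m * (exp (- (1 / t)) / t ^ (m + 1))) (at t)"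
      by (cases m) (rule derivative_eq_intros refl | use t in \<open>simp add: field_simps power2_eq_square\<close>)+
    then have "(flat m has_real_derivative
        exp (- (1 / t)) / t ^ (m + 2) - real m * (exp (- (1 / t)) / t ^ (m + 1))) (at t)"
      by (rule has_field_derivative_transform_within_open[of _ _ _ "{0<..}"])
        (use t in \<open>auto simp: flat_def\<close>)
    then show ?thesis using t by (simp add: flat_def)
  qed
next
  case True
  \<comment> \<open>at the origin the difference quotient is the next member of the family\<close>
  have "((\<lambda>h. flat m h / h) \<longlongrightarrow> 0) (at 0)"
  proof (rule filterlim_split_at_real)
    show "((\<lambda>h. flat m h / h) \<longlongrightarrow> 0) (at_left 0)"
      by (rule tendsto_eventually) (auto simp: flat_def eventually_at_left_field intro!: exI[of _ "-1"])
    have "((\<lambda>h. exp (- (1 / h)) / h ^ m / h) \<longlongrightarrow> 0) (at_right (0::real))"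
      by real_asymp
    then show "((\<lambda>h. flat m h / h) \<longlongrightarrow> 0) (at_right 0)"
      by (rule Lim_transform_eventually)
        (auto simp: flat_def eventually_at_right_field intro!: exI[of _ 1])
  qed
  then show ?thesis using True
    by (simp add: has_field_derivative_iff) (simp add: flat_def)
qed

lemma Ck_on_flat: "Ck_on k (flat m) UNIV"
proof (induction k arbitrary: m)
  case 0
  show ?case
    by (simp add: continuous_at_imp_continuous_on DERIV_isCont[OF flat_has_derivative])
next
  case (Suc k)
  have d: "(flat m has_derivative (*) (flat (m + 2) t - real m * flat (m + 1) t)) (at t)" for t
    using flat_has_derivative by (simp add: has_field_derivative_def)
  have "Ck_on k (\<lambda>t. frechet_derivative (flat m) (at t) v) UNIV" for v
    unfolding frechet_derivative_at[OF d, symmetric] diff_conv_add_uminus minus_mult_left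
    by (intro Ck_on_add bounded_bilinear.Ck_on[OF bounded_bilinear_mult] Ck_on_const Suc) auto
  then show ?case using d by (auto simp: differentiable_def)
qed

text \<open>
  The standard smooth transition from \<open>0\<close> to \<open>1\<close> on the unit interval.
\<close>

definition smooth_step :: "real \<Rightarrow> real" where
  "smooth_step t = flat 0 t / (flat 0 t + flat 0 (1 - t))"

lemma smooth_step_denominator: "flat 0 t + flat 0 (1 - t) > 0"
  by (cases "t \<le> 0") (auto simp: flat_def intro: add_pos_nonneg)

lemma smooth_step_smooth: "smooth_on UNIV smooth_step"
  unfolding smooth_step_def
proof (intro smooth_on_divide smooth_on_add)
  have f: "smooth_on UNIV (flat 0)" by (simp add: smooth_on_def Ck_on_flat)
  show "smooth_on UNIV (flat 0)" by (fact f)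
  have "smooth_on UNIV (\<lambda>t::real. 1 + (-1) * t)"
    by (intro smooth_on_add smooth_on_const smooth_on_bounded_linear bounded_linear_mult_right) auto
  then show "smooth_on UNIV (\<lambda>t. flat 0 (1 - t))"
    by (intro smooth_on_compose[OF _ _ _ _ f]) auto
  show "flat 0 t + flat 0 (1 - t) \<noteq> 0" for t
    using smooth_step_denominator[of t] by simp
qed (use Ck_on_flat in \<open>auto simp: smooth_on_def\<close>)

lemma smooth_step_eq_0: "t \<le> 0 \<Longrightarrow> smooth_step t = 0"
  and smooth_step_eq_1: "t \<ge> 1 \<Longrightarrow> smooth_step t = 1"
  by (auto simp: smooth_step_def flat_def)

lemma smooth_step_bounds: "0 \<le> smooth_step t" "smooth_step t \<le> 1"
  using smooth_step_denominator[of t] by (auto simp: smooth_step_def flat_def)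

section \<open>Test functions\<close>

lemma test_functionsI:
  assumes "smooth_on UNIV f" "{x. f x \<noteq> 0} \<subseteq> K" "compact K" "K \<subseteq> \<Omega>"
  shows "f \<in> test_functions \<Omega>"
proof -
  have "closure {x. f x \<noteq> 0} \<subseteq> K"
    using assms(2,3) by (meson closure_minimal compact_imp_closed)
  moreover have "compact (closure {x. f x \<noteq> 0})"
    using assms(2,3) by (metis bounded_subset compact_closure compact_imp_bounded)
  ultimately show ?thesis
    using assms unfolding test_functions_def by auto
qed

lemma test_functionsD:
  assumes "f \<in> test_functions \<Omega>"
  shows "smooth_on UNIV f" "compact (closure {x. f x \<noteq> 0})" "closure {x. f x \<noteq> 0} \<subseteq> \<Omega>"
  using assms by (auto simp: test_functions_def)

lemma test_functions_eq_0: "f \<in> test_functions \<Omega> \<Longrightarrow> x \<notin> \<Omega> \<Longrightarrow> f x = 0"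
  using closure_subset[of "{x. f x \<noteq> 0}"] by (auto simp: test_functions_def)

lemma test_functions_mult:
  assumes "f \<in> test_functions \<Omega>" "smooth_on UNIV g"
  shows "(\<lambda>x. f x * g x) \<in> test_functions \<Omega>"
proof (rule test_functionsI)
  show "{x. f x * g x \<noteq> 0} \<subseteq> closure {x. f x \<noteq> 0}"
    using closure_subset[of "{x. f x \<noteq> 0}"] by auto
qed (use assms test_functionsD[OF assms(1)] in \<open>auto intro: smooth_on_mult\<close>)

lemma test_functions_mult':
  assumes "smooth_on UNIV f" "g \<in> test_functions \<Omega>"
  shows "(\<lambda>x. f x * g x) \<in> test_functions \<Omega>"
  using test_functions_mult[OF assms(2,1)] by (simp add: mult.commute)

lemma test_functions_cmult: "f \<in> test_functions \<Omega> \<Longrightarrow> (\<lambda>x. c * f x) \<in> test_functions \<Omega>"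
  by (rule test_functions_mult') (simp add: smooth_on_const)

lemma test_functions_directional_deriv:
  assumes "f \<in> test_functions \<Omega>"
  shows "(\<lambda>x. frechet_derivative f (at x) v) \<in> test_functions \<Omega>"
proof (rule test_functionsI)
  show "smooth_on UNIV (\<lambda>x. frechet_derivative f (at x) v)"
    by (rule smooth_on_frechet_derivative) (rule test_functionsD[OF assms])
  show "{x. frechet_derivative f (at x) v \<noteq> 0} \<subseteq> closure {x. f x \<noteq> 0}"
  proof (rule ccontr)
    assume "\<not> ?thesis"
    then obtain x where x: "frechet_derivative f (at x) v \<noteq> 0" "x \<in> - closure {x. f x \<noteq> 0}" by blast
    have 0: "f y = 0" if "y \<in> - closure {x. f x \<noteq> 0}" for y
      using that closure_subset[of "{x. f x \<noteq> 0}"] by blast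
    have "frechet_derivative f (at x) = frechet_derivative (\<lambda>_. 0) (at x)"
      by (rule frechet_derivative_cong_open[OF open_Compl[OF closed_closure] x(2) 0])
    then show False using x(1) by simp
  qed
qed (use test_functionsD[OF assms] in auto)

lemma test_functions_partial_deriv:
  "f \<in> test_functions \<Omega> \<Longrightarrow> partial_deriv i f \<in> test_functions \<Omega>"
  unfolding partial_deriv_def by (rule test_functions_directional_deriv)

lemma test_functions_continuous_on: "f \<in> test_functions \<Omega> \<Longrightarrow> continuous_on S f"
  using test_functionsD(1) smooth_on_imp_continuous_on continuous_on_subset by blast

lemma test_functions_bounded:
  assumes "f \<in> test_functions \<Omega>"
  obtains M where "M \<ge> 0" "\<And>x. \<bar>f x\<bar> \<le> M"
proof -
  let ?K = "closure {x. f x \<noteq> 0}"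
  have "compact (f ` ?K)"
    by (intro compact_continuous_image test_functions_continuous_on[OF assms] test_functionsD[OF assms])
  then obtain M where M: "\<And>y. y \<in> f ` ?K \<Longrightarrow> norm y \<le> M"
    using bounded_iff compact_imp_bounded by metis
  have "\<bar>f x\<bar> \<le> max M 0" for x
  proof (cases "f x = 0")
    case False
    then have "x \<in> ?K" using closure_subset[of "{x. f x \<noteq> 0}"] by blast
    then show ?thesis using M[of "f x"] by simp
  qed simp
  then show ?thesis using that[of "max M 0"] by simp
qed

section \<open>Directional and iterated partial derivatives\<close>

lemma smooth_on_partial_deriv: "smooth_on S f \<Longrightarrow> smooth_on S (partial_deriv i f)"
  unfolding partial_deriv_def by (rule smooth_on_frechet_derivative)

lemma frechet_derivative_eq_sum_partial_deriv:
  fixes f :: "real ^ 'n::finite \<Rightarrow> real"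
  assumes "f differentiable at x"
  shows "frechet_derivative f (at x) v = (\<Sum>i\<in>UNIV. v $ i * partial_deriv i f x)"
proof -
  interpret bounded_linear "frechet_derivative f (at x)"
    using assms by (simp add: frechet_derivative_works has_derivative_bounded_linear)
  have "frechet_derivative f (at x) v =
      frechet_derivative f (at x) (\<Sum>i\<in>UNIV. (v $ i) *\<^sub>R axis i 1)"
    using basis_expansion[of v] by (simp add: scalar_mult_eq_scaleR)
  then show ?thesis by (simp add: sum scale partial_deriv_def)
qed

lemma line_has_derivative:
  fixes f :: "'a::real_normed_vector \<Rightarrow> real"
  assumes "f differentiable at (x + s *\<^sub>R u)"
  shows "((\<lambda>s. f (x + s *\<^sub>R u)) has_real_derivative frechet_derivative f (at (x + s *\<^sub>R u)) u) (at s)"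
proof -
  let ?D = "frechet_derivative f (at (x + s *\<^sub>R u))"
  interpret bounded_linear ?D
    using assms by (simp add: frechet_derivative_works has_derivative_bounded_linear)
  have "((\<lambda>s. x + s *\<^sub>R u) has_derivative (\<lambda>h. h *\<^sub>R u)) (at s)"
    by (auto intro!: derivative_eq_intros)
  then have "((\<lambda>s. f (x + s *\<^sub>R u)) has_derivative (\<lambda>h. ?D (h *\<^sub>R u))) (at s)"
    using assms by (intro has_derivative_compose[of "\<lambda>s. x + s *\<^sub>R u" _ _ _ f])
      (auto simp: frechet_derivative_works)
  then show ?thesis
    by (simp add: has_field_derivative_def scale mult_commute_abs)
qed

lemma test_functions_lipschitz:
  fixes f :: "real ^ 'n::finite \<Rightarrow> real"
  assumes "f \<in> test_functions \<Omega>"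
  obtains L where "L \<ge> 0" "\<And>x y. \<bar>f x - f y\<bar> \<le> L * norm (x - y)"
proof -
  have "\<forall>i. \<exists>M\<ge>0. \<forall>x. \<bar>partial_deriv i f x\<bar> \<le> M"
    using test_functions_bounded[OF test_functions_partial_deriv[OF assms]] by metis
  then obtain M where M: "\<And>i. M i \<ge> 0" "\<And>i x. \<bar>partial_deriv i f x\<bar> \<le> M i" by metis
  have d: "f differentiable at x" for x
    using smooth_on_differentiable[OF test_functionsD(1)[OF assms]] by auto
  have "\<bar>f x - f y\<bar> \<le> (\<Sum>i\<in>UNIV. M i) * norm (x - y)" for x y
  proof -
    obtain t where t: "f (y + 1 *\<^sub>R (x - y)) - f (y + 0 *\<^sub>R (x - y)) =
        (1 - 0) * frechet_derivative f (at (y + t *\<^sub>R (x - y))) (x - y)"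
      using MVT2[of 0 1 "\<lambda>s. f (y + s *\<^sub>R (x - y))", OF _ line_has_derivative[OF d]] by auto
    then have "\<bar>f x - f y\<bar> = \<bar>\<Sum>i\<in>UNIV. (x - y) $ i * partial_deriv i f (y + t *\<^sub>R (x - y))\<bar>"
      by (simp add: frechet_derivative_eq_sum_partial_deriv[OF d])
    also have "\<dots> \<le> (\<Sum>i\<in>UNIV. norm (x - y) * M i)"
      by (rule order_trans[OF sum_abs], rule sum_mono, unfold abs_mult, rule mult_mono)
        (use M component_le_norm_cart[of "x - y"] in auto)
    finally show ?thesis by (simp add: sum_distrib_right mult.commute)
  qed
  then show ?thesis using that[of "\<Sum>i\<in>UNIV. M i"] M(1) by (simp add: sum_nonneg)
qed

text \<open>
  Twofold application of the mean value theorem to the second difference, which is symmetric in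
  the two directions.
\<close>

lemma second_difference_mean_value:
  fixes f :: "'a::real_normed_vector \<Rightarrow> real"
  assumes f: "smooth_on UNIV f" and h: "h > 0"
  obtains s t where "0 \<le> s" "s \<le> h" "0 \<le> t" "t \<le> h"
    "f (x + h *\<^sub>R u + h *\<^sub>R v) - f (x + h *\<^sub>R u) - f (x + h *\<^sub>R v) + f x =
     h * h * frechet_derivative (\<lambda>y. frechet_derivative f (at y) u) (at (x + s *\<^sub>R u + t *\<^sub>R v)) v"
proof -
  let ?F = "\<lambda>y. frechet_derivative f (at y) u"
  have df: "f differentiable at y" and dF: "?F differentiable at y" for y
    by (rule smooth_on_differentiable[OF f] smooth_on_differentiable[OF smooth_on_frechet_derivative[OF f]], simp)+
  have "((\<lambda>s. f ((x + h *\<^sub>R v) + s *\<^sub>R u) - f (x + s *\<^sub>R u)) has_real_derivative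
      ?F ((x + h *\<^sub>R v) + s *\<^sub>R u) - ?F (x + s *\<^sub>R u)) (at s)" for s
    by (intro DERIV_diff line_has_derivative df)
  then obtain s where s: "0 < s" "s < h"
    "(f ((x + h *\<^sub>R v) + h *\<^sub>R u) - f (x + h *\<^sub>R u)) - (f ((x + h *\<^sub>R v) + 0 *\<^sub>R u) - f (x + 0 *\<^sub>R u)) =
      (h - 0) * (?F ((x + h *\<^sub>R v) + s *\<^sub>R u) - ?F (x + s *\<^sub>R u))"
    using MVT2[OF h, of "\<lambda>s. f ((x + h *\<^sub>R v) + s *\<^sub>R u) - f (x + s *\<^sub>R u)"
        "\<lambda>s. ?F ((x + h *\<^sub>R v) + s *\<^sub>R u) - ?F (x + s *\<^sub>R u)"] by blast
  obtain t where t: "0 < t" "t < h"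
    "?F ((x + s *\<^sub>R u) + h *\<^sub>R v) - ?F ((x + s *\<^sub>R u) + 0 *\<^sub>R v) =
      (h - 0) * frechet_derivative ?F (at ((x + s *\<^sub>R u) + t *\<^sub>R v)) v"
    using MVT2[OF h, of "\<lambda>t. ?F ((x + s *\<^sub>R u) + t *\<^sub>R v)", OF line_has_derivative[OF dF]] by blast
  show ?thesis
    using s t by (intro that[of s t]) (simp_all add: add_ac)
qed

text \<open>
  The second difference is symmetric in \<open>u\<close> and \<open>v\<close>.  Divided by \<open>h\<^sup>2\<close> it is a value of either mixed
  derivative near \<open>x\<close>, so continuity at \<open>x\<close> gives equality in the limit.
\<close>

lemma frechet_derivative_commute:
  fixes f :: "'a::real_normed_vector \<Rightarrow> real"
  assumes f: "smooth_on UNIV f"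
  shows "frechet_derivative (\<lambda>y. frechet_derivative f (at y) u) (at x) v =
         frechet_derivative (\<lambda>y. frechet_derivative f (at y) v) (at x) u"
proof -
  let ?D = "\<lambda>u v y. frechet_derivative (\<lambda>y. frechet_derivative f (at y) u) (at y) v"
  have cont: "isCont (?D u v) x" for u v
    using smooth_on_imp_continuous_on[OF smooth_on_frechet_derivative[OF smooth_on_frechet_derivative[OF f]]]
    by (auto simp: continuous_on_eq_continuous_at)
  have "\<bar>?D u v x - ?D v u x\<bar> \<le> \<epsilon> + \<epsilon>" if "\<epsilon> > 0" for \<epsilon>
  proof -
    obtain d1 where d1: "d1 > 0" "\<And>y. dist y x < d1 \<Longrightarrow> dist (?D u v y) (?D u v x) < \<epsilon>"
      using cont \<open>\<epsilon> > 0\<close> unfolding continuous_at_eps_delta by metis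
    obtain d2 where d2: "d2 > 0" "\<And>y. dist y x < d2 \<Longrightarrow> dist (?D v u y) (?D v u x) < \<epsilon>"
      using cont \<open>\<epsilon> > 0\<close> unfolding continuous_at_eps_delta by metis
    define h where "h = min d1 d2 / (norm u + norm v + 1)"
    have h: "h > 0" using d1 d2 by (auto simp: h_def intro!: divide_pos_pos add_nonneg_pos)
    have hb: "h * (norm u + norm v) < min d1 d2"
    proof -
      have "h * (norm u + norm v) < h * (norm u + norm v + 1)" using h by simp
      also have "\<dots> = min d1 d2"
        using add_nonneg_pos[of "norm u + norm v" 1] by (simp add: h_def)
      finally show ?thesis .
    qed
    have close: "norm (s *\<^sub>R a + t *\<^sub>R b) \<le> h * (norm a + norm b)"
      if "0 \<le> s" "s \<le> h" "0 \<le> t" "t \<le> h" for s t and a b :: 'a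
      using that by (intro norm_triangle_le) (auto simp: ring_distribs intro!: add_mono mult_right_mono)
    obtain s t where st: "0 \<le> s" "s \<le> h" "0 \<le> t" "t \<le> h"
      "f (x + h *\<^sub>R u + h *\<^sub>R v) - f (x + h *\<^sub>R u) - f (x + h *\<^sub>R v) + f x =
       h * h * ?D u v (x + s *\<^sub>R u + t *\<^sub>R v)"
      using second_difference_mean_value[OF f h] by metis
    obtain s' t' where st': "0 \<le> s'" "s' \<le> h" "0 \<le> t'" "t' \<le> h"
      "f (x + h *\<^sub>R v + h *\<^sub>R u) - f (x + h *\<^sub>R v) - f (x + h *\<^sub>R u) + f x =
       h * h * ?D v u (x + s' *\<^sub>R v + t' *\<^sub>R u)"
      using second_difference_mean_value[OF f h] by metis
    have eq: "?D u v (x + s *\<^sub>R u + t *\<^sub>R v) = ?D v u (x + s' *\<^sub>R v + t' *\<^sub>R u)"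
    proof -
      have "h * h * ?D u v (x + s *\<^sub>R u + t *\<^sub>R v) = h * h * ?D v u (x + s' *\<^sub>R v + t' *\<^sub>R u)"
        unfolding st(5)[symmetric] st'(5)[symmetric] by (simp add: add_ac)
      then show ?thesis using h by simp
    qed
    have "\<bar>?D u v (x + s *\<^sub>R u + t *\<^sub>R v) - ?D u v x\<bar> < \<epsilon>"
      using d1(2)[of "x + s *\<^sub>R u + t *\<^sub>R v"] close[of s t u v] st hb
      by (simp add: dist_norm add.assoc)
    moreover have "\<bar>?D v u (x + s' *\<^sub>R v + t' *\<^sub>R u) - ?D v u x\<bar> < \<epsilon>"
      using d2(2)[of "x + s' *\<^sub>R v + t' *\<^sub>R u"] close[of s' t' v u] st' hb
      by (simp add: dist_norm add.assoc add.commute[of "norm u"])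
    ultimately show ?thesis using eq by linarith
  qed
  then have "\<bar>?D u v x - ?D v u x\<bar> \<le> \<epsilon>" if "\<epsilon> > 0" for \<epsilon>
    using that by (metis field_sum_of_halves half_gt_zero)
  then show ?thesis
    using field_le_epsilon[of "\<bar>?D u v x - ?D v u x\<bar>" 0] by simp
qed

text \<open>
  Differentiation along a list of indices.  A list keeps the order of differentiation, so the Leibniz
  rules below are inductions on lists in which no partial derivatives are interchanged; multi-indices
  correspond to the lists \<open>multi_list \<nu>\<close>.
\<close>

definition partials :: "'n list \<Rightarrow> (real ^ 'n::finite \<Rightarrow> real) \<Rightarrow> real ^ 'n \<Rightarrow> real" where
  "partials L f = foldr partial_deriv L f"

lemma partials_simps [simp]:
  "partials [] f = f" "partials (i # L) f = partial_deriv i (partials L f)"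
  "partials (L @ L') f = partials L (partials L' f)"
  by (simp_all add: partials_def)

text \<open>
  The enumeration that \<open>multi_deriv\<close> chooses.
\<close>

definition fixed_enum :: "'n::finite list" where
  "fixed_enum = (SOME xs. distinct xs \<and> set xs = UNIV)"

lemma fixed_enum: "distinct (fixed_enum :: 'n::finite list)" "set (fixed_enum :: 'n list) = UNIV"
  using someI_ex[OF finite_distinct_list[OF finite, of "UNIV :: 'n set"]]
  by (auto simp: fixed_enum_def conj_commute)

definition multi_list :: "('n::finite \<Rightarrow> nat) \<Rightarrow> 'n list" where
  "multi_list \<nu> = concat (map (\<lambda>i. replicate (\<nu> i) i) fixed_enum)"

lemma multi_deriv_eq_partials: "multi_deriv \<nu> f = partials (multi_list \<nu>) f"
proof -
  have rep: "partials (replicate k i) g = (partial_deriv i ^^ k) g" for k i and g :: "real ^ 'n::finite \<Rightarrow> real"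
    by (induction k) auto
  have "foldr (\<lambda>i. partial_deriv i ^^ \<nu> i) xs f = partials (concat (map (\<lambda>i. replicate (\<nu> i) i) xs)) f" for xs
    by (induction xs) (auto simp: rep)
  then show ?thesis by (simp add: multi_deriv_def multi_list_def fixed_enum_def)
qed

lemma count_multi_list: "count (mset (multi_list \<nu>)) i = \<nu> i"
proof -
  have "count (mset (concat (map (\<lambda>i. replicate (\<nu> i) i) xs))) i = (if i \<in> set xs then \<nu> i else 0)"
    if "distinct xs" for xs
    using that by (induction xs) (auto simp: count_eq_zero_iff)
  from this[OF fixed_enum(1)] show ?thesis by (simp add: multi_list_def fixed_enum)
qed

lemma length_multi_list: "length (multi_list \<nu>) = multi_order \<nu>"
proof -
  have "length (multi_list \<nu>) = (\<Sum>i\<leftarrow>fixed_enum. \<nu> i)"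
    by (simp add: multi_list_def length_concat comp_def)
  also have "\<dots> = multi_order \<nu>"
    using sum_list_distinct_conv_sum_set[OF fixed_enum(1)] by (simp add: fixed_enum)
  finally show ?thesis .
qed

text \<open>
  The Leibniz rules produce derivatives along subsequences.  In a list sorted into blocks these are
  again given by multi-indices.
\<close>

lemma subseq_multi_list:
  assumes "subseq B (multi_list \<nu>)"
  obtains \<mu> where "B = multi_list \<mu>" "\<And>i. \<mu> i \<le> \<nu> i"
proof -
  have rep: "\<exists>j\<le>k. B = replicate j i" if "subseq B (replicate k i)" for B k and i :: 'a
    using that
  proof (induction k arbitrary: B)
    case (Suc k)
    then show ?case
    proof (cases "B")
      case (Cons b B')
      show ?thesis
      proof (cases "b = i")
        case True
        then obtain j where "j \<le> k" "B' = replicate j i" using Suc Cons by auto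
        then show ?thesis using True Cons by (intro exI[of _ "Suc j"]) simp
      next
        case False
        then show ?thesis using Suc Cons by (auto dest: Suc.IH intro: le_SucI)
      qed
    qed auto
  qed auto
  have "\<exists>\<mu>. B = concat (map (\<lambda>i. replicate (\<mu> i) i) xs) \<and> (\<forall>i. \<mu> i \<le> \<nu> i)"
    if "distinct xs" "subseq B (concat (map (\<lambda>i. replicate (\<nu> i) i) xs))" for xs B
    using that
  proof (induction xs arbitrary: B)
    case Nil
    then show ?case by (auto intro: exI[of _ "\<lambda>_. 0"])
  next
    case (Cons x xs)
    from Cons.prems obtain B1 B2 where B: "B = B1 @ B2" "subseq B1 (replicate (\<nu> x) x)"
      "subseq B2 (concat (map (\<lambda>i. replicate (\<nu> i) i) xs))"
      by (auto elim: subseq_appendE)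
    obtain j where j: "j \<le> \<nu> x" "B1 = replicate j x" using rep[OF B(2)] by auto
    obtain \<mu> where \<mu>: "B2 = concat (map (\<lambda>i. replicate (\<mu> i) i) xs)" "\<forall>i. \<mu> i \<le> \<nu> i"
      using Cons.IH[OF _ B(3)] Cons.prems by auto
    have "concat (map (\<lambda>i. replicate ((\<mu>(x := j)) i) i) xs) = B2"
      unfolding \<mu>(1) using Cons.prems(1) by (intro arg_cong[of _ _ concat] map_cong) auto
    then show ?case using B(1) j \<mu>(2) by (intro exI[of _ "\<mu>(x := j)"]) auto
  qed
  from this[OF fixed_enum(1)] assms show ?thesis
    using that unfolding multi_list_def by blast
qed

lemma smooth_on_partials: "smooth_on S f \<Longrightarrow> smooth_on S (partials L f)"
  by (induction L) (auto intro: smooth_on_partial_deriv)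

lemma test_functions_partials: "f \<in> test_functions \<Omega> \<Longrightarrow> partials L f \<in> test_functions \<Omega>"
  by (induction L) (auto intro: test_functions_partial_deriv)

lemma partial_deriv_cong_open:
  "open S \<Longrightarrow> x \<in> S \<Longrightarrow> (\<And>y. y \<in> S \<Longrightarrow> f y = g y) \<Longrightarrow> partial_deriv i f x = partial_deriv i g x"
  unfolding partial_deriv_def using frechet_derivative_cong_open by metis

lemma partials_cong_open:
  "open S \<Longrightarrow> x \<in> S \<Longrightarrow> (\<And>y. y \<in> S \<Longrightarrow> f y = g y) \<Longrightarrow> partials L f x = partials L g x"
  by (induction L arbitrary: x) (auto intro: partial_deriv_cong_open)

lemma partial_deriv_mult:
  assumes "f differentiable at x" "g differentiable at x"
  shows "partial_deriv i (\<lambda>y. f y * g y) x = partial_deriv i f x * g x + f x * partial_deriv i g x"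
proof -
  have "((\<lambda>y. f y * g y) has_derivative
     (\<lambda>v. f x * frechet_derivative g (at x) v + frechet_derivative f (at x) v * g x)) (at x)"
    using assms by (intro has_derivative_mult) (auto simp: frechet_derivative_works)
  from frechet_derivative_at[OF this] show ?thesis
    by (metis (mono_tags, lifting) partial_deriv_def add.commute)
qed

lemma partial_deriv_add:
  assumes "f differentiable at x" "g differentiable at x"
  shows "partial_deriv i (\<lambda>y. f y + g y) x = partial_deriv i f x + partial_deriv i g x"
proof -
  have "((\<lambda>y. f y + g y) has_derivative
     (\<lambda>v. frechet_derivative f (at x) v + frechet_derivative g (at x) v)) (at x)"
    using assms by (intro has_derivative_add) (auto simp: frechet_derivative_works)
  from frechet_derivative_at[OF this] show ?thesis
    by (metis (mono_tags, lifting) partial_deriv_def)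
qed

lemma partial_deriv_sum_list:
  assumes "\<And>j. j \<in> set J \<Longrightarrow> f j differentiable at x"
  shows "partial_deriv i (\<lambda>y. \<Sum>j\<leftarrow>J. f j y) x = (\<Sum>j\<leftarrow>J. partial_deriv i (f j) x)"
proof -
  have "(\<lambda>y. \<Sum>j\<leftarrow>J. f j y) differentiable at x \<and> ?thesis" using assms
  proof (induction J)
    case Nil
    then show ?case by (simp add: partial_deriv_def)
  next
    case (Cons j J)
    then show ?case
      using partial_deriv_add[of "f j" x "\<lambda>y. \<Sum>j\<leftarrow>J. f j y" i] by (auto intro: differentiable_add)
  qed
  then show ?thesis ..
qed

lemma partial_deriv_commute:
  "smooth_on UNIV f \<Longrightarrow> partial_deriv i (partial_deriv j f) = partial_deriv j (partial_deriv i f)"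
  unfolding partial_deriv_def using frechet_derivative_commute by blast

lemma partials_partial_deriv:
  "smooth_on UNIV f \<Longrightarrow> partials L (partial_deriv i f) = partial_deriv i (partials L f)"
  by (induction L) (auto simp: partial_deriv_commute smooth_on_partials)

lemma partials_mset:
  assumes "smooth_on UNIV f" "mset L = mset L'"
  shows "partials L f = partials L' f"
  using assms(2)
proof (induction L arbitrary: L')
  case (Cons i L)
  then have "i \<in> set L'" by (metis list.set_intros(1) mset_eq_setD)
  then obtain X Y where L': "L' = X @ i # Y" by (auto simp: in_set_conv_decomp)
  have "partials L f = partials (X @ Y) f" using Cons by (intro Cons.IH) (simp add: L')
  then show ?case
    using partials_partial_deriv[OF smooth_on_partials[OF assms(1)], of X i Y] by (simp add: L')
qed simp

text \<open>
  Schwarz's theorem enters here only: a weak derivative of order \<open>\<mu> + e\<^sub>i\<close> is an \<open>i\<close>-th weak derivative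
  of one of order \<open>\<mu>\<close>.
\<close>

lemma multi_deriv_partial_deriv:
  assumes "smooth_on UNIV f"
  shows "multi_deriv \<nu> (partial_deriv i f) = multi_deriv (\<nu>(i := Suc (\<nu> i))) f"
proof -
  have "mset (multi_list \<nu> @ [i]) = mset (multi_list (\<nu>(i := Suc (\<nu> i))))"
    by (rule multiset_eqI) (simp add: count_multi_list)
  from partials_mset[OF assms this] show ?thesis by (simp add: multi_deriv_eq_partials)
qed

text \<open>All ways to distribute the entries of a list over two lists, in order.\<close>

fun splits :: "'a list \<Rightarrow> ('a list \<times> 'a list) list" where
  "splits [] = [([], [])]"
| "splits (i # L) = map (map_prod ((#) i) id) (splits L) @ map (map_prod id ((#) i)) (splits L)"

lemma splits_subseq: "(A, B) \<in> set (splits L) \<Longrightarrow> subseq A L \<and> subseq B L"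
  by (induction L arbitrary: A B) (auto intro: list_emb_Cons)

lemma partials_mult:
  assumes S: "open S" and f: "smooth_on S f" and g: "smooth_on S g" and x: "x \<in> S"
  shows "partials L (\<lambda>y. f y * g y) x = (\<Sum>(A, B)\<leftarrow>splits L. partials A f x * partials B g x)"
  using x
proof (induction L arbitrary: x)
  case (Cons i L)
  have d: "partials L f differentiable at x" "partials L g differentiable at x" for L
    by (rule smooth_on_differentiable[OF smooth_on_partials Cons.prems], fact)+
  have "partials (i # L) (\<lambda>y. f y * g y) x =
      partial_deriv i (\<lambda>x. \<Sum>p\<leftarrow>splits L. partials (fst p) f x * partials (snd p) g x) x"
    using Cons.IH by (auto intro!: partial_deriv_cong_open[OF S Cons.prems] simp: case_prod_unfold)
  also have "\<dots> = (\<Sum>p\<leftarrow>splits L. partials (i # fst p) f x * partials (snd p) g x +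
       partials (fst p) f x * partials (i # snd p) g x)"
    by (subst partial_deriv_sum_list) (auto simp: partial_deriv_mult d intro!: derivative_intros)
  finally show ?case
    by (simp add: sum_list_addf case_prod_unfold comp_def)
qed simp

text \<open>
  The Leibniz rule in adjoint form.  It moves a smooth factor inside the derivatives, which are
  afterwards applied to test functions only; it is what differentiates a product with a function
  that has weak derivatives.
\<close>

lemma mult_partials:
  fixes \<theta> :: "real ^ 'n::finite \<Rightarrow> real"
  assumes "\<theta> \<in> test_functions \<Omega>"
  obtains J where
    "\<And>\<theta>' B. (\<theta>', B) \<in> set J \<Longrightarrow> \<theta>' \<in> test_functions \<Omega> \<and> subseq B L \<and> length B < length L"
    "\<And>\<xi> x. smooth_on UNIV \<xi> \<Longrightarrow> \<theta> x * partials L \<xi> x =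
       partials L (\<lambda>y. \<theta> y * \<xi> y) x + (\<Sum>(\<theta>', B)\<leftarrow>J. partials B (\<lambda>y. \<theta>' y * \<xi> y) x)"
proof -
  have "\<exists>J. (\<forall>(\<theta>', B)\<in>set J. \<theta>' \<in> test_functions \<Omega> \<and> subseq B L \<and> length B < length L) \<and>
    (\<forall>\<xi> x. smooth_on UNIV \<xi> \<longrightarrow> \<theta> x * partials L \<xi> x =
       partials L (\<lambda>y. \<theta> y * \<xi> y) x + (\<Sum>(\<theta>', B)\<leftarrow>J. partials B (\<lambda>y. \<theta>' y * \<xi> y) x))"
    using assms
  proof (induction L arbitrary: \<theta>)
    case Nil
    then show ?case by (intro exI[of _ "[]"]) simp
  next
    case (Cons i L)
    let ?\<theta>i = "\<lambda>x. - 1 * partial_deriv i \<theta> x"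
    have \<theta>i: "?\<theta>i \<in> test_functions \<Omega>"
      by (intro test_functions_cmult test_functions_partial_deriv Cons)
    obtain J where J: "\<forall>(\<theta>', B)\<in>set J. \<theta>' \<in> test_functions \<Omega> \<and> subseq B L \<and> length B < length L"
      and Jeq: "\<forall>\<xi> x. smooth_on UNIV \<xi> \<longrightarrow> \<theta> x * partials L \<xi> x =
        partials L (\<lambda>y. \<theta> y * \<xi> y) x + (\<Sum>(\<theta>', B)\<leftarrow>J. partials B (\<lambda>y. \<theta>' y * \<xi> y) x)"
      using Cons.IH[OF Cons.prems] by (elim exE conjE)
    obtain J' where J': "\<forall>(\<theta>', B)\<in>set J'. \<theta>' \<in> test_functions \<Omega> \<and> subseq B L \<and> length B < length L"
      and J'eq: "\<forall>\<xi> x. smooth_on UNIV \<xi> \<longrightarrow> ?\<theta>i x * partials L \<xi> x =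
        partials L (\<lambda>y. ?\<theta>i y * \<xi> y) x + (\<Sum>(\<theta>', B)\<leftarrow>J'. partials B (\<lambda>y. \<theta>' y * \<xi> y) x)"
      using Cons.IH[OF \<theta>i] by (elim exE conjE)
    let ?J = "map (map_prod id ((#) i)) J @ (?\<theta>i, L) # J'"
    have "\<theta> x * partials (i # L) \<xi> x =
       partials (i # L) (\<lambda>y. \<theta> y * \<xi> y) x + (\<Sum>(\<theta>', B)\<leftarrow>?J. partials B (\<lambda>y. \<theta>' y * \<xi> y) x)"
      if \<xi>: "smooth_on UNIV \<xi>" for \<xi> x
    proof -
      have d: "partials B (\<lambda>y. \<theta>' y * \<xi> y) differentiable at x" if "\<theta>' \<in> test_functions \<Omega>" for \<theta>' B
        using smooth_on_differentiable[OF smooth_on_partials[OF smooth_on_mult[OF _ test_functionsD(1)[OF that] \<xi>]]]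
        by auto
      have "partial_deriv i (\<lambda>x. \<theta> x * partials L \<xi> x) x =
        partial_deriv i \<theta> x * partials L \<xi> x + \<theta> x * partial_deriv i (partials L \<xi>) x"
        by (rule partial_deriv_mult[OF smooth_on_differentiable smooth_on_differentiable])
          (use test_functionsD(1)[OF Cons.prems] smooth_on_partials[OF \<xi>] in auto)
      then have "\<theta> x * partials (i # L) \<xi> x =
        partial_deriv i (\<lambda>x. \<theta> x * partials L \<xi> x) x + ?\<theta>i x * partials L \<xi> x" by simp
      also have "(\<lambda>x. \<theta> x * partials L \<xi> x) = (\<lambda>x. partials L (\<lambda>y. \<theta> y * \<xi> y) x +
          (\<Sum>p\<leftarrow>J. partials (snd p) (\<lambda>y. fst p y * \<xi> y) x))"
        using Jeq \<xi> by (auto simp: case_prod_unfold)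
      also have "partial_deriv i \<dots> x = partials (i # L) (\<lambda>y. \<theta> y * \<xi> y) x +
          (\<Sum>p\<leftarrow>J. partials (i # snd p) (\<lambda>y. fst p y * \<xi> y) x)"
      proof -
        have dJ: "partials (snd p) (\<lambda>y. fst p y * \<xi> y) differentiable at x" if "p \<in> set J" for p
          using bspec[OF J that] by (intro d) (simp add: case_prod_unfold)
        have "(\<lambda>x. \<Sum>p\<leftarrow>J'. partials (snd p) (\<lambda>y. fst p y * \<xi> y) x) differentiable at x"
          if "set J' \<subseteq> set J" for J'
          using that by (induction J') (auto intro!: differentiable_add dJ)
        from this[OF order_refl] show ?thesis
          by (simp add: partial_deriv_add d Cons.prems partial_deriv_sum_list dJ)
      qed
      finally show ?thesis
        using J'eq[rule_format, OF \<xi>, of x] by (simp add: case_prod_unfold comp_def)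
    qed
    moreover have "\<forall>(\<theta>', B)\<in>set ?J. \<theta>' \<in> test_functions \<Omega> \<and> subseq B (i # L) \<and> length B < length (i # L)"
      using J J' \<theta>i by (auto simp: case_prod_unfold intro: list_emb_Cons)
    ultimately show ?case by (intro exI[of _ ?J] conjI allI impI)
  qed
  then obtain J where J: "\<forall>(\<theta>', B)\<in>set J. \<theta>' \<in> test_functions \<Omega> \<and> subseq B L \<and> length B < length L"
    and eq: "\<forall>\<xi> x. smooth_on UNIV \<xi> \<longrightarrow> \<theta> x * partials L \<xi> x =
       partials L (\<lambda>y. \<theta> y * \<xi> y) x + (\<Sum>(\<theta>', B)\<leftarrow>J. partials B (\<lambda>y. \<theta>' y * \<xi> y) x)"
    by (elim exE conjE)
  show ?thesis
  proof (rule that)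
    show "\<theta>' \<in> test_functions \<Omega> \<and> subseq B L \<and> length B < length L" if "(\<theta>', B) \<in> set J" for \<theta>' B
      using bspec[OF J that] by simp
  qed (use eq in simp)
qed

section \<open>Bump functions\<close>

definition box_bump :: "'a::euclidean_space \<Rightarrow> 'a \<Rightarrow> 'a \<Rightarrow> real" where
  "box_bump a b x = (\<Prod>i\<in>Basis. flat 0 ((x - a) \<bullet> i) * flat 0 ((b - x) \<bullet> i))"

lemma flat_nonneg: "flat m t \<ge> 0" and flat_pos_iff: "flat m t > 0 \<longleftrightarrow> t > 0"
  by (auto simp: flat_def)

lemma box_bump_nonneg: "box_bump a b x \<ge> 0"
  unfolding box_bump_def by (intro prod_nonneg mult_nonneg_nonneg flat_nonneg) 

lemma box_bump_pos_iff: "box_bump a b x > 0 \<longleftrightarrow> x \<in> box a b"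
proof
  assume "box_bump a b x > 0"
  then have "box_bump a b x \<noteq> 0" by simp
  then have "\<forall>i\<in>Basis. flat 0 ((x - a) \<bullet> i) * flat 0 ((b - x) \<bullet> i) \<noteq> 0"
    unfolding box_bump_def prod_zero_iff[OF finite_Basis] by blast
  then have "flat 0 ((x - a) \<bullet> i) > 0 \<and> flat 0 ((b - x) \<bullet> i) > 0" if "i \<in> Basis" for i
    using that by (simp add: less_le flat_nonneg)
  then show "x \<in> box a b" by (simp add: flat_pos_iff mem_box inner_diff_left)
next
  assume "x \<in> box a b"
  then show "box_bump a b x > 0" unfolding box_bump_def
    by (intro prod_pos mult_pos_pos) (auto simp: flat_pos_iff mem_box inner_diff_left)
qed

lemma smooth_box_bump: "smooth_on UNIV (box_bump a b)"
  unfolding box_bump_def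
proof (intro smooth_on_prod smooth_on_mult)
  have f: "smooth_on UNIV (flat 0)" by (simp add: smooth_on_def Ck_on_flat)
  fix i :: 'a
  have i: "smooth_on UNIV (\<lambda>x::'a. c * (x \<bullet> i) + d)" for c d
    by (intro smooth_on_add smooth_on_mult smooth_on_const smooth_on_bounded_linear bounded_linear_inner_left) auto
  have "smooth_on UNIV (\<lambda>x. flat 0 (c * (x \<bullet> i) + d))" for c d
    by (intro smooth_on_compose[OF _ _ _ i f]) auto
  from this[of 1 "- (a \<bullet> i)"] this[of "- 1" "b \<bullet> i"]
  show "smooth_on UNIV (\<lambda>x. flat 0 ((x - a) \<bullet> i))" "smooth_on UNIV (\<lambda>x. flat 0 ((b - x) \<bullet> i))"
    by (simp_all add: inner_diff_left)
qed auto

lemma smooth_step_scaled: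
  assumes "smooth_on UNIV f"
  shows "smooth_on UNIV (\<lambda>x. smooth_step (c * f x))"
  by (intro smooth_on_compose[OF _ _ _ _ smooth_step_smooth] smooth_on_mult smooth_on_const assms) auto

text \<open>
  The step function of \<open>j\<close> times a bump that is positive exactly on the box.
\<close>

lemma indicator_box_limit_test_functions:
  fixes a b :: "'a::euclidean_space"
  assumes "cbox a b \<subseteq> \<Omega>"
  obtains \<xi> :: "nat \<Rightarrow> 'a \<Rightarrow> real" where "\<And>j. \<xi> j \<in> test_functions \<Omega>"
    "\<And>j x. 0 \<le> \<xi> j x \<and> \<xi> j x \<le> indicator (box a b) x" "\<And>x. (\<lambda>j. \<xi> j x) \<longlonglongrightarrow> indicator (box a b) x"
proof
  let ?\<xi> = "\<lambda>j x. smooth_step (real j * box_bump a b x)"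
  have z: "?\<xi> j x = 0" if "x \<notin> box a b" for j x
    using that box_bump_pos_iff[of a b x] box_bump_nonneg[of a b x]
    by (intro smooth_step_eq_0) simp
  show "?\<xi> j \<in> test_functions \<Omega>" for j
  proof (rule test_functionsI[OF smooth_step_scaled[OF smooth_box_bump] _ compact_cbox assms])
    show "{x. ?\<xi> j x \<noteq> 0} \<subseteq> cbox a b"
      using z box_subset_cbox by blast
  qed
  show "0 \<le> ?\<xi> j x \<and> ?\<xi> j x \<le> indicator (box a b) x" for j x
    using z smooth_step_bounds by (auto simp: indicator_def)
  show "(\<lambda>j. ?\<xi> j x) \<longlonglongrightarrow> indicator (box a b) x" for x
  proof (cases "x \<in> box a b")
    case True
    then obtain m :: nat where m: "1 / box_bump a b x \<le> m" "box_bump a b x > 0"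
      using real_arch_simple box_bump_pos_iff by blast
    have "?\<xi> j x = 1" if "j \<ge> m" for j
    proof (rule smooth_step_eq_1)
      have "1 \<le> real m * box_bump a b x" using m by (simp add: field_simps)
      also have "\<dots> \<le> real j * box_bump a b x" using that m by simp
      finally show "1 \<le> real j * box_bump a b x" .
    qed
    then show ?thesis using True by (auto intro!: tendsto_eventually eventually_sequentiallyI)
  qed (simp add: z)
qed


text \<open>
  A finite sum of bumps of boxes that cover \<open>K\<close> has a positive minimum on \<open>K\<close>; the step function of the sum
  divided by this minimum is \<open>1\<close> on \<open>K\<close>.
\<close>

lemma smooth_cutoff:
  fixes K :: "'a::euclidean_space set"
  assumes "compact K" "open \<Omega>" "K \<subseteq> \<Omega>"
  obtains \<kappa> where "\<kappa> \<in> test_functions \<Omega>" "\<And>x. x \<in> K \<Longrightarrow> \<kappa> x = 1"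
proof (cases "K = {}")
  case True
  have "(\<lambda>_. 0) \<in> test_functions \<Omega>"
    by (rule test_functionsI[OF smooth_on_const, of _ "{}"]) auto
  then show ?thesis by (rule that) (use True in auto)
next
  case False
  have "\<exists>a b. x \<in> box a b \<and> cbox a b \<subseteq> \<Omega>" if "x \<in> K" for x
    by (rule open_contains_cbox[OF assms(2) subsetD[OF assms(3) that]]) (intro exI conjI)
  then obtain a b where ab: "\<And>x. x \<in> K \<Longrightarrow> x \<in> box (a x) (b x) \<and> cbox (a x) (b x) \<subseteq> \<Omega>"
    by metis
  then have "K \<subseteq> (\<Union>x\<in>K. box (a x) (b x))" by blast
  then obtain F where F: "F \<subseteq> K" "finite F" "K \<subseteq> (\<Union>x\<in>F. box (a x) (b x))"
    using compactE_image[OF assms(1), of K "\<lambda>x. box (a x) (b x)"] open_box by blast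
  define S where "S = (\<lambda>x. \<Sum>y\<in>F. box_bump (a y) (b y) x)"
  have S: "smooth_on UNIV S" unfolding S_def by (intro smooth_on_sum smooth_box_bump) auto
  have pos: "S x > 0" if xK: "x \<in> K" for x
  proof -
    obtain y where "y \<in> F" "x \<in> box (a y) (b y)" using xK F(3) by blast
    then show ?thesis unfolding S_def
      by (intro sum_pos2[of F y]) (auto simp: F box_bump_pos_iff box_bump_nonneg)
  qed
  obtain x0 where x0: "x0 \<in> K" "\<And>x. x \<in> K \<Longrightarrow> S x0 \<le> S x"
    using continuous_attains_inf[OF assms(1) False
        continuous_on_subset[OF smooth_on_imp_continuous_on[OF S] subset_UNIV]] by blast
  let ?\<kappa> = "\<lambda>x. smooth_step (inverse (S x0) * S x)"
  show ?thesis
  proof (rule that)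
    show "?\<kappa> x = 1" if "x \<in> K" for x
      using x0(2)[OF that] pos[OF x0(1)] by (intro smooth_step_eq_1) (simp add: field_simps)
    show "?\<kappa> \<in> test_functions \<Omega>"
    proof (rule test_functionsI[OF smooth_step_scaled[OF S]])
      show "compact (\<Union>x\<in>F. cbox (a x) (b x))" using F by auto
      show "(\<Union>x\<in>F. cbox (a x) (b x)) \<subseteq> \<Omega>" using F ab by blast
      show "{x. ?\<kappa> x \<noteq> 0} \<subseteq> (\<Union>x\<in>F. cbox (a x) (b x))"
      proof (rule ccontr)
        assume "\<not> ?thesis"
        then obtain x where x: "?\<kappa> x \<noteq> 0" "x \<notin> (\<Union>x\<in>F. cbox (a x) (b x))" by blast
        have "box_bump (a y) (b y) x = 0" if "y \<in> F" for y
        proof -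
          have "x \<notin> box (a y) (b y)" using x(2) that box_subset_cbox[of "a y" "b y"] by blast
          then show ?thesis
            using box_bump_pos_iff[of "a y" "b y" x] box_bump_nonneg[of "a y" "b y" x] by simp
        qed
        then have "S x = 0" by (simp add: S_def)
        then show False using x(1) by (simp add: smooth_step_eq_0)
      qed
    qed
  qed
qed

section \<open>The fundamental lemma of the calculus of variations\<close>

lemma locally_integrable_set_integrable:
  assumes "locally_integrable_on \<Omega> v" "compact K" "K \<subseteq> \<Omega>"
  shows "integrable lebesgue (\<lambda>x. indicator K x * v x)"
  using assms by (auto simp: locally_integrable_on_def set_integrable_def)

lemma lebesgue_measurable_continuous:
  "continuous_on UNIV f \<Longrightarrow> (f :: 'a::euclidean_space \<Rightarrow> real) \<in> borel_measurable lebesgue"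
  by (intro measurable_completion) (simp add: borel_measurable_continuous_onI)

lemma integrable_bounded_mult:
  fixes f g :: "'a \<Rightarrow> real"
  assumes "integrable M f" "g \<in> borel_measurable M" "\<And>x. \<bar>g x\<bar> \<le> B"
  shows "integrable M (\<lambda>x. f x * g x)"
proof (rule Bochner_Integration.integrable_bound)
  show "integrable M (\<lambda>x. B * f x)" using assms by simp
  show "AE x in M. norm (f x * g x) \<le> norm (B * f x)"
  proof (rule AE_I2)
    fix x
    have "\<bar>g x\<bar> \<le> \<bar>B\<bar>" using assms(3)[of x] by simp
    then show "norm (f x * g x) \<le> norm (B * f x)"
      by (simp add: abs_mult mult.commute[of "\<bar>f x\<bar>"] mult_right_mono)
  qed
qed (use assms in auto)

lemma locally_integrable_mult_test_function:
  assumes v: "locally_integrable_on \<Omega> v" and \<xi>: "\<xi> \<in> test_functions \<Omega>"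
  shows "integrable lebesgue (\<lambda>x. v x * \<xi> x)"
proof -
  let ?K = "closure {x. \<xi> x \<noteq> 0}"
  obtain M where M: "\<And>x. \<bar>\<xi> x\<bar> \<le> M" using test_functions_bounded[OF \<xi>] by auto
  have "integrable lebesgue (\<lambda>x. (indicator ?K x * v x) * \<xi> x)"
    by (intro integrable_bounded_mult[OF _ _ M] locally_integrable_set_integrable[OF v]
        lebesgue_measurable_continuous test_functions_continuous_on[OF \<xi>] test_functionsD[OF \<xi>])
  also have "(\<lambda>x. (indicator ?K x * v x) * \<xi> x) = (\<lambda>x. v x * \<xi> x)"
  proof
    fix x
    have "\<xi> x = 0" if "x \<notin> ?K" using that closure_subset[of "{x. \<xi> x \<noteq> 0}"] by blast
    then show "(indicator ?K x * v x) * \<xi> x = v x * \<xi> x" by (cases "x \<in> ?K") auto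
  qed
  finally show ?thesis .
qed

lemma locally_integrable_diff:
  assumes "locally_integrable_on \<Omega> v" "locally_integrable_on \<Omega> w"
  shows "locally_integrable_on \<Omega> (\<lambda>x. v x - w x)"
  using assms by (auto simp: locally_integrable_on_def intro: set_integral_diff)

lemma locally_integrable_add:
  assumes "locally_integrable_on \<Omega> v" "locally_integrable_on \<Omega> w"
  shows "locally_integrable_on \<Omega> (\<lambda>x. v x + w x)"
  using assms by (auto simp: locally_integrable_on_def intro: set_integral_add)

lemma integrable_locally_integrable:
  assumes "integrable lebesgue v"
  shows "locally_integrable_on \<Omega> v"
  unfolding locally_integrable_on_def set_integrable_def
  using integrable_mult_indicator[OF _ assms] by (auto simp: lmeasurable_compact fmeasurableD)

lemma locally_integrable_mult_smooth:
  assumes v: "locally_integrable_on \<Omega> v" and f: "continuous_on UNIV f"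
  shows "locally_integrable_on \<Omega> (\<lambda>x. f x * v x)"
  unfolding locally_integrable_on_def
proof (intro allI impI)
  fix K assume K: "compact K \<and> K \<subseteq> \<Omega>"
  then have "compact (f ` K)" using f by (meson compact_continuous_image continuous_on_subset subset_UNIV)
  then have "bounded (f ` K)" by (rule compact_imp_bounded)
  then obtain M where M: "\<And>x. x \<in> K \<Longrightarrow> \<bar>f x\<bar> \<le> M"
    unfolding bounded_iff by auto
  have "integrable lebesgue (\<lambda>x. (indicator K x * v x) * (indicator K x * f x))"
  proof (rule integrable_bounded_mult[where B = "max M 0"])
    show "(\<lambda>x. indicator K x * f x) \<in> borel_measurable lebesgue"
      using K by (intro borel_measurable_times lebesgue_measurable_continuous f borel_measurable_indicator)
        (auto simp: lmeasurable_compact fmeasurableD)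
    show "\<bar>indicator K x * f x\<bar> \<le> max M 0" for x
      using M[of x] by (auto simp: indicator_def)
  qed (use K locally_integrable_set_integrable[OF v] in auto)
  also have "(\<lambda>x. (indicator K x * v x) * (indicator K x * f x)) = (\<lambda>x. indicator K x *\<^sub>R (f x * v x))"
    by (auto simp: indicator_def)
  finally show "(\<lambda>x. f x * v x) absolutely_integrable_on K" by (simp add: set_integrable_def)
qed

text \<open>
  The boxes are closed under intersection and generate the Borel sets, so the integral vanishes over
  every Borel set, in particular where the function is positive and where it is negative.
\<close>

lemma integral_zero_borel_imp_AE_zero:
  fixes w :: "'a::euclidean_space \<Rightarrow> real"
  assumes w: "integrable lborel w"
    and box: "\<And>a b. (LINT x|lborel. indicator (box a b) x * w x) = 0"
    and UNIV: "(LINT x|lborel. w x) = 0"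
  shows "AE x in lborel. w x = 0"
proof -
  let ?G = "range (\<lambda>(a, b). box a b :: 'a set)"
  have int: "integrable lborel (\<lambda>x. indicator A x * w x)" if "A \<in> sets borel" for A
    using integrable_mult_indicator[OF _ w, of A] that by simp
  have borel: "sets (borel :: 'a measure) = sigma_sets UNIV ?G"
    unfolding borel_eq_box by simp
  have zero: "(LINT x|lborel. indicator A x * w x) = 0" if "A \<in> sets borel" for A
  proof -
    have A: "A \<in> sigma_sets UNIV ?G" using that borel by simp
    have "Int_stable ?G"
    proof (rule Int_stableI)
      fix A B assume "A \<in> ?G" "B \<in> ?G"
      then obtain a b c d where "A = box a b" "B = box c d" by auto
      then show "A \<inter> B \<in> ?G" by (auto simp: box_Int_box)
    qed
    moreover have "?G \<subseteq> Pow UNIV" by simp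
    ultimately show ?thesis using A
    proof (induction rule: sigma_sets_induct_disjoint)
      case (basic A)
      then show ?case using box by auto
    next
      case (compl A)
      have "(LINT x|lborel. indicator (UNIV - A) x * w x) =
            (LINT x|lborel. w x - indicator A x * w x)"
        by (intro Bochner_Integration.integral_cong) (auto simp: indicator_def)
      also have "\<dots> = 0"
        using compl w int UNIV by (subst Bochner_Integration.integral_diff) (auto simp: borel)
      finally show ?case .
    next
      case (union A)
      have "(LINT x:(\<Union>i. A i)|lborel. w x) = (\<Sum>i. (LINT x:(A i)|lborel. w x))"
      proof (rule lebesgue_integral_countable_add)
        show "A i \<in> sets lborel" for i using union by (auto simp: borel)
        then have "(\<Union>i. A i) \<in> sets borel" by auto
        then show "set_integrable lborel (\<Union>i. A i) w"
          using int by (simp add: set_integrable_def)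
      qed (use union in \<open>auto simp: disjoint_family_on_def\<close>)
      then show ?case using union by (simp add: set_lebesgue_integral_def)
    qed auto
  qed
  have pos: "AE x in lborel. indicator {x. s * w x > 0} x * (s * w x) = 0" if "s \<in> {1, -1}" for s
  proof -
    have m: "{x. s * w x > 0} \<in> sets borel"
      using borel_measurable_integrable[OF w] by measurable
    have "integrable lborel (\<lambda>x. s * (indicator {x. s * w x > 0} x * w x))"
      by (intro integrable_mult_right int m)
    then have i: "integrable lborel (\<lambda>x. indicator {x. s * w x > 0} x * (s * w x))"
      by (simp add: mult.left_commute)
    have "(LINT x|lborel. indicator {x. s * w x > 0} x * (s * w x)) = 0"
      using zero[OF m] by (simp add: mult.left_commute)
    then show ?thesis
      by (subst integral_nonneg_eq_0_iff_AE[OF i, symmetric]) (auto simp: indicator_def)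
  qed
  have "AE x in lborel. indicator {x. 1 * w x > 0} x * (1 * w x) = 0"
    "AE x in lborel. indicator {x. - 1 * w x > 0} x * (- 1 * w x) = 0"
    by (rule pos, simp)+
  then show ?thesis
    by eventually_elim (auto simp: indicator_def split: if_splits)
qed

text \<open>
  Test functions converge to the indicator of a box from below, so by dominated convergence the
  integral over every box inside the domain vanishes.
\<close>

lemma fundamental_lemma_calculus_of_variations:
  fixes v :: "'a::euclidean_space \<Rightarrow> real"
  assumes \<Omega>: "open \<Omega>" and v: "locally_integrable_on \<Omega> v"
    and zero: "\<And>\<xi>. \<xi> \<in> test_functions \<Omega> \<Longrightarrow> (LINT x|lebesgue. v x * \<xi> x) = 0"
  shows "AE x in lebesgue. x \<in> \<Omega> \<longrightarrow> v x = 0"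
proof -
  have box0: "(LINT x|lebesgue. indicator (box a b) x * v x) = 0" if ab: "cbox a b \<subseteq> \<Omega>" for a b
  proof -
    obtain \<xi> :: "nat \<Rightarrow> 'a \<Rightarrow> real" where \<xi>: "\<And>j. \<xi> j \<in> test_functions \<Omega>"
      "\<And>j x. 0 \<le> \<xi> j x \<and> \<xi> j x \<le> indicator (box a b) x"
      "\<And>x. (\<lambda>j. \<xi> j x) \<longlonglongrightarrow> indicator (box a b) x"
      using indicator_box_limit_test_functions[OF ab] by metis
    have int: "integrable lebesgue (\<lambda>x. indicator (cbox a b) x * v x)"
      by (intro locally_integrable_set_integrable[OF v] compact_cbox ab)
    have "(\<lambda>j. LINT x|lebesgue. \<xi> j x * v x) \<longlonglongrightarrow> (LINT x|lebesgue. indicator (box a b) x * v x)"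
    proof (rule integral_dominated_convergence[where w = "\<lambda>x. \<bar>indicator (cbox a b) x * v x\<bar>"])
      show m: "(\<lambda>x. \<xi> j x * v x) \<in> borel_measurable lebesgue" for j
        using borel_measurable_integrable[OF locally_integrable_mult_test_function[OF v \<xi>(1)], of j]
        by (simp add: mult.commute)
      show lim: "AE x in lebesgue. (\<lambda>j. \<xi> j x * v x) \<longlonglongrightarrow> indicator (box a b) x * v x"
        by (intro AE_I2 tendsto_mult \<xi> tendsto_const)
      show "(\<lambda>x. indicator (box a b) x * v x) \<in> borel_measurable lebesgue"
      proof (rule borel_measurable_LIMSEQ_real[OF _ m])
        show "(\<lambda>j. \<xi> j x * v x) \<longlonglongrightarrow> indicator (box a b) x * v x" for x
          by (intro tendsto_mult \<xi> tendsto_const)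
      qed
      show "integrable lebesgue (\<lambda>x. \<bar>indicator (cbox a b) x * v x\<bar>)" using int by simp
      show "AE x in lebesgue. norm (\<xi> j x * v x) \<le> \<bar>indicator (cbox a b) x * v x\<bar>" for j
      proof (rule AE_I2)
        fix x
        have "\<bar>\<xi> j x\<bar> \<le> indicator (cbox a b) x"
          using \<xi>(2)[of j x] subsetD[OF box_subset_cbox[of a b], of x]
          by (cases "x \<in> box a b") auto
        then show "norm (\<xi> j x * v x) \<le> \<bar>indicator (cbox a b) x * v x\<bar>"
          by (simp add: abs_mult mult_right_mono)
      qed
    qed
    moreover have "(LINT x|lebesgue. \<xi> j x * v x) = 0" for j
      using zero[OF \<xi>(1)] by (simp add: mult.commute)
    ultimately show ?thesis by (simp add: LIMSEQ_const_iff)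
  qed
  have cbox: "AE x in lebesgue. x \<in> cbox a b \<longrightarrow> v x = 0" if ab: "cbox a b \<subseteq> \<Omega>" for a b
  proof -
    let ?w = "\<lambda>x. indicator (box a b) x * v x"
    have "integrable lebesgue (\<lambda>x. indicator (cbox a b) x * v x)"
      by (intro locally_integrable_set_integrable[OF v] compact_cbox ab)
    then have "integrable lebesgue (\<lambda>x. indicator (box a b) x *\<^sub>R (indicator (cbox a b) x * v x))"
      by (intro integrable_mult_indicator) auto
    also have "(\<lambda>x. indicator (box a b) x *\<^sub>R (indicator (cbox a b) x * v x)) = ?w"
      using subsetD[OF box_subset_cbox[of a b]] by (intro ext) (auto simp: indicator_def)
    finally have w: "integrable lebesgue ?w" .
    obtain w' where w': "w' \<in> borel_measurable lborel" "AE x in lborel. ?w x = w' x"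
      using completion_ex_borel_measurable_real[OF borel_measurable_integrable[OF w]] by auto
    have AE: "AE x in lebesgue. ?w x = w' x" using w'(2) by (rule AE_completion)
    have m': "w' \<in> borel_measurable lebesgue" using w'(1) by (rule measurable_completion)
    have int': "integrable lebesgue w'"
      using w m' AE by (subst integrable_cong_AE[symmetric, of ?w]) auto
    have eq: "(LINT x|lborel. indicator A x * w' x) = (LINT x|lebesgue. indicator A x * ?w x)"
      if [measurable]: "A \<in> sets borel" for A
    proof -
      have "(\<lambda>x. indicator A x * w' x) \<in> borel_measurable lborel" using w' by measurable
      then have "(LINT x|lborel. indicator A x * w' x) = (LINT x|lebesgue. indicator A x * w' x)"
        by (simp add: integral_completion)
      also have "\<dots> = (LINT x|lebesgue. indicator A x * ?w x)"
      proof (rule integral_cong_AE)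
        show "AE x in lebesgue. indicator A x * w' x = indicator A x * ?w x"
          using AE by eventually_elim simp
      qed (intro borel_measurable_times borel_measurable_indicator m' borel_measurable_integrable[OF w],
          use that in simp)+
      finally show ?thesis .
    qed
    \<comment> \<open>the intersection of an arbitrary box with the given one lies in the domain\<close>
    have "AE x in lborel. w' x = 0"
    proof (rule integral_zero_borel_imp_AE_zero)
      show "integrable lborel w'" using int' w' by (simp add: integrable_completion)
      show "(LINT x|lborel. indicator (box c d) x * w' x) = 0" for c d
      proof -
        obtain c' d' where cd: "box c d \<inter> box a b = box c' d'" by (simp add: box_Int_box)
        have "cbox c' d' \<subseteq> \<Omega> \<or> box c' d' = {}"
        proof (cases "box c' d' = {}")
          case False
          then have "closure (box c' d') = cbox c' d'" by simp
          moreover have "closure (box c' d') \<subseteq> cbox a b"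
            unfolding cd[symmetric] using box_subset_cbox[of a b] by (intro closure_minimal) auto
          ultimately show ?thesis using ab by blast
        qed simp
        then have "(LINT x|lebesgue. indicator (box c' d') x * v x) = 0"
          using box0[of c' d'] by auto
        moreover have "(\<lambda>x. indicator (box c d) x * ?w x) = (\<lambda>x. indicator (box c' d') x * v x)"
          unfolding cd[symmetric] by (auto simp: indicator_def)
        ultimately show ?thesis using eq[of "box c d"] by (simp only: box_borel)
      qed
      show "(LINT x|lborel. w' x) = 0" using eq[of UNIV] box0[OF ab] by simp
    qed
    then have "AE x in lebesgue. w' x = 0" by (rule AE_completion)
    moreover have "AE x in lebesgue. x \<notin> cbox a b - box a b"
      by (rule AE_not_in) (simp add: negligible_frontier_interval negligible_iff_null_sets[symmetric])
    ultimately show ?thesis using AE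
      by eventually_elim (auto simp: indicator_def split: if_splits)
  qed
  obtain \<D> where \<D>: "countable \<D>" "\<D> \<subseteq> Pow \<Omega>" "\<And>X. X \<in> \<D> \<Longrightarrow> \<exists>a b. X = cbox a b" "\<Union>\<D> = \<Omega>"
    using open_countable_Union_open_cbox[OF \<Omega>] by metis
  have "AE x in lebesgue. \<forall>X\<in>\<D>. x \<in> X \<longrightarrow> v x = 0"
  proof (subst AE_ball_countable[OF \<D>(1)], rule ballI)
    fix X assume X: "X \<in> \<D>"
    then obtain a b where "X = cbox a b" using \<D>(3) by blast
    moreover have "X \<subseteq> \<Omega>" using X \<D>(2) by blast
    ultimately show "AE x in lebesgue. x \<in> X \<longrightarrow> v x = 0" using cbox by simp
  qed
  then show ?thesis
    by eventually_elim (use \<D>(4) in blast)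
qed

section \<open>Weak derivatives\<close>

lemma lebesgue_on_integral_test_function:
  assumes "open \<Omega>" "\<xi> \<in> test_functions \<Omega>"
  shows "(LINT x|lebesgue_on \<Omega>. v x * \<xi> x) = (LINT x|lebesgue. v x * \<xi> x)"
proof -
  have "(LINT x|lebesgue_on \<Omega>. v x * \<xi> x) = (LINT x|lebesgue. indicator \<Omega> x *\<^sub>R (v x * \<xi> x))"
    using assms(1) by (intro integral_restrict_space) simp
  also have "\<dots> = (LINT x|lebesgue. v x * \<xi> x)"
    by (intro Bochner_Integration.integral_cong)
      (auto simp: indicator_def test_functions_eq_0[OF assms(2)])
  finally show ?thesis .
qed

lemma weak_derivs_iff:
  assumes "open \<Omega>"
  shows "v \<in> weak_derivs \<Omega> \<nu> u \<longleftrightarrow> locally_integrable_on \<Omega> v \<and>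
     (\<forall>\<xi>\<in>test_functions \<Omega>. (LINT x|lebesgue. u x * partials (multi_list \<nu>) \<xi> x) =
        (- 1) ^ multi_order \<nu> * (LINT x|lebesgue. v x * \<xi> x))"
  unfolding weak_derivs_def multi_deriv_eq_partials
  using lebesgue_on_integral_test_function[OF assms]
    lebesgue_on_integral_test_function[OF assms test_functions_partials] by simp

lemma weak_derivs_unique:
  assumes \<Omega>: "open \<Omega>" and v: "v \<in> weak_derivs \<Omega> \<nu> u" and w: "w \<in> weak_derivs \<Omega> \<nu> u"
  shows "AE x in lebesgue. x \<in> \<Omega> \<longrightarrow> v x = w x"
proof -
  have lv: "locally_integrable_on \<Omega> v" and lw: "locally_integrable_on \<Omega> w"
    using v w by (auto simp: weak_derivs_def)
  have "AE x in lebesgue. x \<in> \<Omega> \<longrightarrow> v x - w x = 0"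
  proof (rule fundamental_lemma_calculus_of_variations[OF \<Omega> locally_integrable_diff[OF lv lw]])
    fix \<xi> assume \<xi>: "\<xi> \<in> test_functions \<Omega>"
    have "(- 1) ^ multi_order \<nu> * (LINT x|lebesgue. v x * \<xi> x) =
      (- 1) ^ multi_order \<nu> * (LINT x|lebesgue. w x * \<xi> x)"
      using v w \<xi> by (simp add: weak_derivs_iff[OF \<Omega>])
    then have "(LINT x|lebesgue. v x * \<xi> x) = (LINT x|lebesgue. w x * \<xi> x)" by simp
    then show "(LINT x|lebesgue. (v x - w x) * \<xi> x) = 0"
      using locally_integrable_mult_test_function[OF lv \<xi>] locally_integrable_mult_test_function[OF lw \<xi>]
      by (simp add: left_diff_distrib)
  qed
  then show ?thesis by simp
qed

lemma locally_integrable_measurable: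
  assumes \<Omega>: "open \<Omega>" and v: "locally_integrable_on \<Omega> v"
  shows "(\<lambda>x. indicator \<Omega> x * v x) \<in> borel_measurable lebesgue"
proof -
  obtain \<D> where \<D>: "countable \<D>" "\<D> \<subseteq> Pow \<Omega>" "\<And>X. X \<in> \<D> \<Longrightarrow> \<exists>a b. X = cbox a b" "\<Union>\<D> = \<Omega>"
    using open_countable_Union_open_cbox[OF \<Omega>] by metis
  show ?thesis
  proof (rule measurable_piecewise_restrict[where C = "insert (- \<Omega>) \<D>"])
    fix X assume X: "X \<in> insert (- \<Omega>) \<D>"
    then show X': "X \<inter> space lebesgue \<in> sets lebesgue"
      using \<D>(3)[of X] \<Omega> by auto
    show "(\<lambda>x. indicator \<Omega> x * v x) \<in> borel_measurable (lebesgue_on X)"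
    proof (cases "X = - \<Omega>")
      case True
      show ?thesis
        by (subst measurable_cong[where g = "\<lambda>_. 0"]) (auto simp: True)
    next
      case False
      then have "X \<in> \<D>" using X by simp
      then obtain a b where ab: "X = cbox a b" "X \<subseteq> \<Omega>" using \<D>(2) \<D>(3)[of X] by blast
      have "(\<lambda>x. indicator X x * v x) \<in> borel_measurable lebesgue"
        by (intro borel_measurable_integrable locally_integrable_set_integrable[OF v]) (use ab in auto)
      then have "(\<lambda>x. indicator X x * v x) \<in> borel_measurable (lebesgue_on X)"
        by (rule measurable_restrict_space1)
      then show ?thesis
        by (subst measurable_cong[where g = "\<lambda>x. indicator X x * v x"])
          (use ab in \<open>auto simp: indicator_def\<close>)
    qed
  qed (use \<D> in auto)
qed

lemma locally_integrable_cong_AE: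
  assumes \<Omega>: "open \<Omega>" and v: "locally_integrable_on \<Omega> v" and w: "w \<in> borel_measurable lebesgue"
    and ae: "AE x in lebesgue. x \<in> \<Omega> \<longrightarrow> v x = w x"
  shows "locally_integrable_on \<Omega> w"
  unfolding locally_integrable_on_def set_integrable_def
proof (intro allI impI)
  fix K assume K: "compact K \<and> K \<subseteq> \<Omega>"
  have i: "integrable lebesgue (\<lambda>x. indicator K x * v x)"
    using locally_integrable_set_integrable[OF v] K by simp
  have [measurable]: "K \<in> sets lebesgue" using K by (simp add: lmeasurable_compact fmeasurableD)
  have "integrable lebesgue (\<lambda>x. indicator K x * w x)"
  proof (rule integrable_cong_AE_imp[OF i])
    show "AE x in lebesgue. indicator K x * v x = indicator K x * w x"
      using ae by eventually_elim (use K in \<open>auto simp: indicator_def\<close>)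
    show "(\<lambda>x. indicator K x * w x) \<in> borel_measurable lebesgue"
      using w by (intro borel_measurable_times borel_measurable_indicator) auto
  qed
  then show "integrable lebesgue (\<lambda>x. indicator K x *\<^sub>R w x)" by simp
qed

text \<open>
  A representative that is Borel and vanishes outside the domain allows all later
  integrals to be taken over the whole space with respect to \<open>lborel\<close>.
\<close>

definition borel_supported :: "'a::euclidean_space set \<Rightarrow> ('a \<Rightarrow> real) \<Rightarrow> bool" where
  "borel_supported \<Omega> v \<longleftrightarrow> v \<in> borel_measurable borel \<and> (\<forall>x. x \<notin> \<Omega> \<longrightarrow> v x = 0)"

lemma weak_derivs_borel_representative:
  assumes \<Omega>: "open \<Omega>" and v: "v \<in> weak_derivs \<Omega> \<nu> u"
  obtains w where "w \<in> weak_derivs \<Omega> \<nu> u" "borel_supported \<Omega> w"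
proof -
  have lv: "locally_integrable_on \<Omega> v" using v by (auto simp: weak_derivs_def)
  obtain w' where w': "w' \<in> borel_measurable lborel" "AE x in lborel. indicator \<Omega> x * v x = w' x"
    using completion_ex_borel_measurable_real[OF locally_integrable_measurable[OF \<Omega> lv]] by auto
  define w where "w = (\<lambda>x. indicator \<Omega> x * w' x)"
  have w: "w \<in> borel_measurable borel" using w' \<Omega> by (auto simp: w_def)
  have ae: "AE x in lebesgue. x \<in> \<Omega> \<longrightarrow> v x = w x"
    using AE_completion[OF w'(2)] by eventually_elim (auto simp: w_def indicator_def)
  have wm: "w \<in> borel_measurable lebesgue" using w by (auto intro: measurable_completion)
  have lw: "locally_integrable_on \<Omega> w" by (rule locally_integrable_cong_AE[OF \<Omega> lv wm ae])
  have "(LINT x|lebesgue. v x * \<xi> x) = (LINT x|lebesgue. w x * \<xi> x)" if \<xi>: "\<xi> \<in> test_functions \<Omega>" for \<xi>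
  proof (rule integral_cong_AE)
    show "AE x in lebesgue. v x * \<xi> x = w x * \<xi> x"
      using ae by eventually_elim (use test_functions_eq_0[OF \<xi>] in auto)
  qed (rule borel_measurable_integrable[OF locally_integrable_mult_test_function[OF lv \<xi>]]
      borel_measurable_integrable[OF locally_integrable_mult_test_function[OF lw \<xi>]])+
  then have "w \<in> weak_derivs \<Omega> \<nu> u" using v lw by (simp add: weak_derivs_iff[OF \<Omega>])
  then show ?thesis by (rule that) (use w in \<open>auto simp: borel_supported_def w_def\<close>)
qed

section \<open>Integrals of powers\<close>

lemma powr_add_le:
  fixes a b :: real
  assumes "0 \<le> a" "0 \<le> b" "0 < r" "r \<le> 1"
  shows "(a + b) powr r \<le> a powr r + b powr r"
proof (cases "a + b = 0")
  case False
  then have ab: "a + b > 0" using assms by simp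
  have le: "x \<le> x powr r" if "0 \<le> x" "x \<le> 1" for x :: real
    using powr_mono'[of r 1 x] that assms by simp
  have "1 = a / (a + b) + b / (a + b)" using ab by (simp add: add_divide_distrib[symmetric])
  also have "\<dots> \<le> (a / (a + b)) powr r + (b / (a + b)) powr r"
    by (intro add_mono le) (use assms ab in auto)
  also have "\<dots> = (a powr r + b powr r) / (a + b) powr r"
    using assms ab by (simp add: powr_divide add_divide_distrib)
  finally show ?thesis using ab by (simp add: field_simps)
qed (use assms in auto)

lemma powr_add_le_2:
  fixes a b p :: real
  assumes "0 \<le> a" "0 \<le> b" "0 \<le> p"
  shows "(a + b) powr p \<le> 2 powr p * (a powr p + b powr p)"
proof -
  have "(a + b) powr p \<le> (2 * max a b) powr p" using assms by (intro powr_mono2) auto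
  also have "\<dots> = 2 powr p * max a b powr p" using assms by (simp add: powr_mult)
  also have "\<dots> \<le> 2 powr p * (a powr p + b powr p)" by (intro mult_left_mono) (auto simp: max_def)
  finally show ?thesis .
qed

lemma abs_add_powr_le:
  fixes a b p :: real
  assumes "0 \<le> p"
  shows "\<bar>a + b\<bar> powr p \<le> 2 powr p * (\<bar>a\<bar> powr p + \<bar>b\<bar> powr p)"
  using powr_mono2[OF assms _ abs_triangle_ineq[of a b]] powr_add_le_2[of "\<bar>a\<bar>" "\<bar>b\<bar>" p] assms
  by simp

lemma ennreal_root_mono:
  assumes "0 < p" "s \<le> t"
  shows "ennreal_root p s \<le> ennreal_root p t"
proof (cases "t = \<infinity>")
  case False
  then have "s < top" "t < top" using assms(2) by (auto simp: top.not_eq_extremum)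
  then show ?thesis
    using assms by (auto simp: ennreal_root_def intro!: ennreal_leI powr_mono2 enn2real_mono)
qed (simp add: ennreal_root_def)

lemma ennreal_root_finite: "ennreal_root p t < \<infinity> \<longleftrightarrow> t < \<infinity>"
  by (auto simp: ennreal_root_def top.not_eq_extremum)

lemma ennreal_root_add:
  assumes "1 \<le> p"
  shows "ennreal_root p (s + t) \<le> ennreal_root p s + ennreal_root p t"
proof (cases "s = \<infinity> \<or> t = \<infinity>")
  case False
  then have st: "s < top" "t < top" by (auto simp: top.not_eq_extremum)
  then have "enn2real (s + t) = enn2real s + enn2real t" by (rule enn2real_plus)
  then show ?thesis
    using st powr_add_le[of "enn2real s" "enn2real t" "1 / p"] assms
    by (auto simp: ennreal_root_def ennreal_plus[symmetric] simp del: ennreal_plus intro!: ennreal_leI)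
qed (auto simp: ennreal_root_def)

lemma ennreal_root_sum:
  assumes "1 \<le> p"
  shows "ennreal_root p (\<Sum>i\<in>I. t i) \<le> (\<Sum>i\<in>I. ennreal_root p (t i))"
proof (induction I rule: infinite_finite_induct)
  case (insert i I)
  then show ?case
    using ennreal_root_add[OF assms, of "t i" "\<Sum>i\<in>I. t i"]
    by (auto intro: order_trans add_left_mono)
qed (use assms in \<open>auto simp: ennreal_root_def\<close>)

lemma ennreal_root_cmult:
  assumes "1 \<le> p" "0 < c"
  shows "ennreal_root p (ennreal c * t) = ennreal (c powr (1 / p)) * ennreal_root p t"
proof (cases "t = \<infinity>")
  case True
  then show ?thesis using assms by (simp add: ennreal_root_def ennreal_mult_top)
next
  case False
  then obtain r where r: "0 \<le> r" "t = ennreal r" by (cases t) auto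
  then show ?thesis using assms
    by (simp add: ennreal_root_def ennreal_mult[symmetric] powr_mult)
qed

definition Lp_integral :: "real \<Rightarrow> ('a::euclidean_space \<Rightarrow> real) \<Rightarrow> ennreal" where
  "Lp_integral p v = (\<integral>\<^sup>+ x. ennreal (\<bar>v x\<bar> powr p) \<partial>lborel)"

text \<open>
  The \<open>p\<close>-th power of the seminorm, as an iterated integral.
\<close>

definition gagliardo_integral ::
  "real \<Rightarrow> real \<Rightarrow> (real ^ 'n::finite) set \<Rightarrow> (real ^ 'n \<Rightarrow> real) \<Rightarrow> ennreal" where
  "gagliardo_integral \<theta> p \<Omega> v = (\<integral>\<^sup>+ x. \<integral>\<^sup>+ y. ennreal (indicator \<Omega> x * indicator \<Omega> y *
     (\<bar>v x - v y\<bar> powr p / norm (x - y) powr (real CARD('n) + \<theta> * p))) \<partial>lborel \<partial>lborel)"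

lemma Lp_norm_eq_root_Lp_integral:
  assumes "open \<Omega>" "borel_supported \<Omega> v"
  shows "Lp_norm p \<Omega> v = ennreal_root p (Lp_integral p v)"
proof -
  have "(\<integral>\<^sup>+ x. ennreal (\<bar>v x\<bar> powr p) \<partial>lebesgue_on \<Omega>) =
    (\<integral>\<^sup>+ x. ennreal (\<bar>v x\<bar> powr p) * indicator \<Omega> x \<partial>lebesgue)"
    using assms(1) by (intro nn_integral_restrict_space) simp
  also have "\<dots> = Lp_integral p v"
    unfolding nn_integral_completion Lp_integral_def
    using assms(2) by (intro nn_integral_cong) (auto simp: borel_supported_def indicator_def)
  finally show ?thesis by (simp add: Lp_norm_def)
qed

lemma Lp_norm_cong_AE:
  assumes "open \<Omega>" "AE x in lebesgue. x \<in> \<Omega> \<longrightarrow> v x = w x"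
  shows "Lp_norm p \<Omega> v = Lp_norm p \<Omega> w"
proof -
  have "(\<integral>\<^sup>+ x. ennreal (\<bar>v x\<bar> powr p) \<partial>lebesgue_on \<Omega>) = (\<integral>\<^sup>+ x. ennreal (\<bar>w x\<bar> powr p) \<partial>lebesgue_on \<Omega>)"
  proof (rule nn_integral_cong_AE)
    show "AE x in lebesgue_on \<Omega>. ennreal (\<bar>v x\<bar> powr p) = ennreal (\<bar>w x\<bar> powr p)"
      using assms by (subst AE_restrict_space_iff) (auto elim: eventually_mono)
  qed
  then show ?thesis by (simp add: Lp_norm_def)
qed

lemma gagliardo_seminorm_lborel:
  fixes \<Omega> :: "(real ^ 'n::finite) set"
  assumes "open \<Omega>"
  shows "gagliardo_seminorm \<theta> p \<Omega> v = ennreal_root p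
     (\<integral>\<^sup>+ z. ennreal (indicator \<Omega> (fst z) * indicator \<Omega> (snd z) * (\<bar>v (fst z) - v (snd z)\<bar> powr p /
               norm (fst z - snd z) powr (real CARD('n) + \<theta> * p))) \<partial>(lborel \<Otimes>\<^sub>M lborel))"
proof -
  have "open (\<Omega> \<times> \<Omega>)" using assms by (intro open_Times)
  then show ?thesis
    unfolding gagliardo_seminorm_def lborel_prod
    by (subst nn_integral_restrict_space)
      (auto simp: nn_integral_completion indicator_def intro!: arg_cong[of _ _ "ennreal_root p"] nn_integral_cong)
qed

lemma gagliardo_seminorm_eq_root:
  fixes \<Omega> :: "(real ^ 'n::finite) set"
  assumes "open \<Omega>" "v \<in> borel_measurable borel"
  shows "gagliardo_seminorm \<theta> p \<Omega> v = ennreal_root p (gagliardo_integral \<theta> p \<Omega> v)"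
proof -
  have [measurable]: "\<Omega> \<in> sets borel" "v \<in> borel_measurable borel" using assms by auto
  show ?thesis
    unfolding gagliardo_seminorm_lborel[OF assms(1)] gagliardo_integral_def
    by (subst lborel.nn_integral_fst[symmetric]) (simp_all add: case_prod_unfold)
qed

text \<open>
  If the functions differ on a null set \<open>N\<close>, the integrands differ only on \<open>N \<times> \<real>\<^sup>n \<union> \<real>\<^sup>n \<times> N\<close>, which is
  null in the product.
\<close>

lemma gagliardo_seminorm_cong_AE:
  fixes \<Omega> :: "(real ^ 'n::finite) set"
  assumes \<Omega>: "open \<Omega>" and ae: "AE x in lebesgue. x \<in> \<Omega> \<longrightarrow> v x = w x"
  shows "gagliardo_seminorm \<theta> p \<Omega> v = gagliardo_seminorm \<theta> p \<Omega> w"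
proof -
  have "AE x in lborel. x \<in> \<Omega> \<longrightarrow> v x = w x" using ae by (simp add: AE_completion_iff)
  then obtain N where N: "{x \<in> space lborel. \<not> (x \<in> \<Omega> \<longrightarrow> v x = w x)} \<subseteq> N" "N \<in> null_sets lborel"
    by (auto elim!: AE_E simp: null_sets_def)
  have n1: "N \<times> UNIV \<in> null_sets (lborel \<Otimes>\<^sub>M (lborel :: (real ^ 'n) measure))"
    using lborel.times_in_null_sets1[OF N(2), of UNIV] by simp
  have n2: "UNIV \<times> N \<in> null_sets ((lborel :: (real ^ 'n) measure) \<Otimes>\<^sub>M lborel)"
    by (rule lborel.times_in_null_sets2[OF _ N(2)]) simp
  have "AE z in lborel \<Otimes>\<^sub>M lborel. z \<notin> N \<times> UNIV \<and> z \<notin> UNIV \<times> N"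
    using AE_not_in[OF n1] AE_not_in[OF n2] by eventually_elim simp
  then have "AE z in lborel \<Otimes>\<^sub>M lborel.
     ennreal (indicator \<Omega> (fst z) * indicator \<Omega> (snd z) * (\<bar>v (fst z) - v (snd z)\<bar> powr p /
               norm (fst z - snd z) powr (real CARD('n) + \<theta> * p))) =
     ennreal (indicator \<Omega> (fst z) * indicator \<Omega> (snd z) * (\<bar>w (fst z) - w (snd z)\<bar> powr p /
               norm (fst z - snd z) powr (real CARD('n) + \<theta> * p)))"
  proof eventually_elim
    case (elim z)
    have "x \<in> \<Omega> \<longrightarrow> v x = w x" if "x \<notin> N" for x using N(1) that by auto
    then show ?case using elim by (cases z) (auto simp: indicator_def)
  qed
  then show ?thesis
    unfolding gagliardo_seminorm_lborel[OF \<Omega>] by (intro arg_cong[of _ _ "ennreal_root p"] nn_integral_cong_AE)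
qed

lemma Lp_integral_add:
  assumes "v \<in> borel_measurable borel" "w \<in> borel_measurable borel" "0 \<le> p"
  shows "Lp_integral p (\<lambda>x. v x + w x) \<le> ennreal (2 powr p) * (Lp_integral p v + Lp_integral p w)"
proof -
  note [measurable] = assms(1,2)
  have "Lp_integral p (\<lambda>x. v x + w x) \<le>
    (\<integral>\<^sup>+ x. ennreal (2 powr p) * (ennreal (\<bar>v x\<bar> powr p) + ennreal (\<bar>w x\<bar> powr p)) \<partial>lborel)"
    unfolding Lp_integral_def
    by (intro nn_integral_mono)
      (auto simp: ennreal_plus[symmetric] ennreal_mult[symmetric] simp del: ennreal_plus
        intro!: ennreal_leI abs_add_powr_le assms)
  also have "\<dots> = ennreal (2 powr p) * (Lp_integral p v + Lp_integral p w)"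
    unfolding Lp_integral_def by (subst nn_integral_cmult) (auto simp: nn_integral_add)
  finally show ?thesis .
qed

lemma Lp_integral_mult_bounded:
  assumes "v \<in> borel_measurable borel" "\<And>x. \<bar>f x\<bar> \<le> M" "0 \<le> p"
  shows "Lp_integral p (\<lambda>x. f x * v x) \<le> ennreal (M powr p) * Lp_integral p v"
proof -
  note [measurable] = assms(1)
  have "Lp_integral p (\<lambda>x. f x * v x) \<le> (\<integral>\<^sup>+ x. ennreal (M powr p) * ennreal (\<bar>v x\<bar> powr p) \<partial>lborel)"
    unfolding Lp_integral_def
    by (intro nn_integral_mono)
      (auto simp: ennreal_mult[symmetric] abs_mult powr_mult intro!: ennreal_leI mult_right_mono powr_mono2 assms)
  also have "\<dots> = ennreal (M powr p) * Lp_integral p v"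
    unfolding Lp_integral_def by (rule nn_integral_cmult) simp
  finally show ?thesis .
qed

lemma gagliardo_integral_add:
  fixes \<Omega> :: "(real ^ 'n::finite) set"
  assumes "open \<Omega>" "v \<in> borel_measurable borel" "w \<in> borel_measurable borel" "0 \<le> p"
  shows "gagliardo_integral \<theta> p \<Omega> (\<lambda>x. v x + w x) \<le>
    ennreal (2 powr p) * (gagliardo_integral \<theta> p \<Omega> v + gagliardo_integral \<theta> p \<Omega> w)"
proof -
  have [measurable]: "\<Omega> \<in> sets borel" "v \<in> borel_measurable borel" "w \<in> borel_measurable borel"
    using assms by auto
  let ?F = "\<lambda>v x y. ennreal (indicator \<Omega> x * indicator \<Omega> y *
     (\<bar>v x - v y\<bar> powr p / norm (x - y) powr (real CARD('n) + \<theta> * p)))"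
  have "?F (\<lambda>x. v x + w x) x y \<le> ennreal (2 powr p) * (?F v x y + ?F w x y)" for x y
  proof -
    have "\<bar>v x + w x - (v y + w y)\<bar> powr p \<le> 2 powr p * (\<bar>v x - v y\<bar> powr p + \<bar>w x - w y\<bar> powr p)"
      using abs_add_powr_le[OF assms(4), of "v x - v y" "w x - w y"] by (simp add: algebra_simps)
    then have "\<bar>v x + w x - (v y + w y)\<bar> powr p / norm (x - y) powr (real CARD('n) + \<theta> * p) \<le>
       2 powr p * (\<bar>v x - v y\<bar> powr p / norm (x - y) powr (real CARD('n) + \<theta> * p) +
         \<bar>w x - w y\<bar> powr p / norm (x - y) powr (real CARD('n) + \<theta> * p))"
      unfolding add_divide_distrib[symmetric] times_divide_eq_right
      by (rule divide_right_mono) simp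
    then show ?thesis
      by (simp add: ennreal_plus[symmetric] ennreal_mult[symmetric] indicator_def del: ennreal_plus)
  qed
  then have "gagliardo_integral \<theta> p \<Omega> (\<lambda>x. v x + w x) \<le>
    (\<integral>\<^sup>+ x. \<integral>\<^sup>+ y. ennreal (2 powr p) * (?F v x y + ?F w x y) \<partial>lborel \<partial>lborel)"
    unfolding gagliardo_integral_def by (intro nn_integral_mono)
  also have "\<dots> = ennreal (2 powr p) * (gagliardo_integral \<theta> p \<Omega> v + gagliardo_integral \<theta> p \<Omega> w)"
    unfolding gagliardo_integral_def
    by (simp add: nn_integral_cmult nn_integral_add)
  finally show ?thesis .
qed

lemma gagliardo_integral_mono_domain:
  "\<Omega> \<subseteq> \<Omega>' \<Longrightarrow> gagliardo_integral \<theta> p \<Omega> v \<le> gagliardo_integral \<theta> p \<Omega>' v"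
  unfolding gagliardo_integral_def
  by (intro nn_integral_mono ennreal_leI mult_right_mono mult_mono) (auto simp: indicator_def)

section \<open>The truncated Gagliardo kernel\<close>

text \<open>
  The kernel of the seminorm times the \<open>p\<close>-th power of the bound \<open>min(1, \<bar>z\<bar>)\<close> for the increments of a bounded
  Lipschitz function.
\<close>

definition gagliardo_kernel :: "real \<Rightarrow> real \<Rightarrow> real ^ 'n::finite \<Rightarrow> real" where
  "gagliardo_kernel \<theta> p z = min 1 (norm z) powr p / norm z powr (real CARD('n) + \<theta> * p)"

lemma gagliardo_kernel_nonneg: "gagliardo_kernel \<theta> p z \<ge> 0"
  by (simp add: gagliardo_kernel_def)

lemma gagliardo_kernel_measurable [measurable]: "gagliardo_kernel \<theta> p \<in> borel_measurable borel"
  unfolding gagliardo_kernel_def by measurable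

lemma dyadic_shell_large:
  fixes t :: real
  assumes "1 \<le> t"
  obtains j :: nat where "2 powr real j \<le> t" "t \<le> 2 powr (real j + 1)"
proof
  let ?j = "nat \<lfloor>log 2 t\<rfloor>"
  have l: "log 2 t \<ge> 0" using assms by simp
  then have "real ?j \<le> log 2 t" "log 2 t \<le> real ?j + 1" by linarith+
  then have "2 powr real ?j \<le> 2 powr log 2 t" "2 powr log 2 t \<le> 2 powr (real ?j + 1)"
    by (intro powr_mono; simp)+
  then show "2 powr real ?j \<le> t" "t \<le> 2 powr (real ?j + 1)" using assms by simp_all
qed

text \<open>
  At infinity the kernel decays like \<open>\<bar>z\<bar>\<close> to the power \<open>-n - \<theta> p\<close>, at the origin it behaves
  like the power \<open>-n + (1 - \<theta>) p\<close>.  On dyadic shells this gives two geometric series.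
\<close>

lemma gagliardo_kernel_integrable:
  assumes "0 < \<theta>" "\<theta> < 1" "0 < p"
  shows "(\<integral>\<^sup>+ z. ennreal (gagliardo_kernel \<theta> p (z :: real ^ 'n::finite)) \<partial>lborel) < \<infinity>"
proof -
  let ?n = "real CARD('n)" and ?a = "real CARD('n) + \<theta> * p"
  let ?V = "unit_ball_vol ?n"
  \<comment> \<open>majorants on the shells where the norm is about \<open>2\<^sup>j\<close> or about \<open>2\<^sup>-\<^sup>j\<close>\<close>
  define far where "far = (\<lambda>j::nat. \<lambda>z :: real ^ 'n.
    ennreal (2 powr (- real j * ?a)) * indicator (cball 0 (2 powr (real j + 1))) z)"
  define near where "near = (\<lambda>j::nat. \<lambda>z :: real ^ 'n.
    ennreal (2 powr ((real j + 1) * ?a - real j * p)) * indicator (cball 0 (2 powr (- real j))) z)"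
  have a: "?a \<ge> 0" using assms by simp
  have bound: "ennreal (gagliardo_kernel \<theta> p z) \<le> (\<Sum>j. far j z) + (\<Sum>j. near j z)" for z :: "real ^ 'n"
  proof -
    have term_le: "f j \<le> suminf f" for f :: "nat \<Rightarrow> ennreal" and j
      using sum_le_suminf[OF summableI, of "{j}" f] by simp
    consider "z = 0" | "norm z \<ge> 1" | "z \<noteq> 0" "norm z \<le> 1" by linarith
    then show ?thesis
    proof cases
      case 1
      then show ?thesis by (simp add: gagliardo_kernel_def)
    next
      case 2
      obtain j where j: "2 powr real j \<le> norm z" "norm z \<le> 2 powr (real j + 1)"
        using dyadic_shell_large[OF 2] by metis
      have "gagliardo_kernel \<theta> p z = norm z powr (- ?a)"
        unfolding gagliardo_kernel_def powr_minus using 2 by (simp add: divide_inverse)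
      also have "\<dots> \<le> (2 powr real j) powr (- ?a)"
        using j a by (intro powr_mono2') auto
      also have "\<dots> = 2 powr (- real j * ?a)" by (simp add: powr_powr algebra_simps)
      finally have "ennreal (gagliardo_kernel \<theta> p z) \<le> far j z"
        using j by (simp add: far_def ennreal_leI)
      also have "\<dots> \<le> (\<Sum>j. far j z)" by (rule term_le[of "\<lambda>j. far j z"])
      finally show ?thesis by (simp add: add_increasing2)
    next
      case 3
      then have "1 \<le> inverse (norm z)" by (simp add: one_le_inverse)
      then obtain j where j: "2 powr real j \<le> inverse (norm z)" "inverse (norm z) \<le> 2 powr (real j + 1)"
        using dyadic_shell_large by metis
      have z: "norm z > 0" using 3 by simp
      have j': "norm z \<le> 2 powr (- real j)" "2 powr (- (real j + 1)) \<le> norm z"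
        using le_imp_inverse_le[OF j(1)] le_imp_inverse_le[OF j(2)] z by (simp_all only: powr_minus) auto
      have "gagliardo_kernel \<theta> p z = norm z powr p * norm z powr (- ?a)"
        unfolding gagliardo_kernel_def powr_minus using 3 by (simp add: divide_inverse)
      also have "\<dots> \<le> (2 powr (- real j)) powr p * (2 powr (- (real j + 1))) powr (- ?a)"
      proof (intro mult_mono)
        show "norm z powr p \<le> (2 powr (- real j)) powr p"
          using j' assms by (intro powr_mono2) auto
        show "norm z powr (- ?a) \<le> (2 powr (- (real j + 1))) powr (- ?a)"
          using a by (intro powr_mono2'[OF _ _ j'(2)]) auto
      qed auto
      also have "\<dots> = 2 powr ((real j + 1) * ?a - real j * p)"
        by (simp add: powr_powr powr_add[symmetric] algebra_simps)
      finally have "ennreal (gagliardo_kernel \<theta> p z) \<le> near j z"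
        using j' by (simp add: near_def ennreal_leI)
      also have "\<dots> \<le> (\<Sum>j. near j z)" by (rule term_le[of "\<lambda>j. near j z"])
      finally show ?thesis by (simp add: add_increasing)
    qed
  qed
  have ind: "(indicator (cball 0 r) :: real ^ 'n \<Rightarrow> ennreal) \<in> borel_measurable borel" for r
    by (intro borel_measurable_indicator borel_closed closed_cball)
  have [measurable]: "far j \<in> borel_measurable borel" for j
    unfolding far_def by (rule borel_measurable_times_ennreal[OF borel_measurable_const ind])
  have [measurable]: "near j \<in> borel_measurable borel" for j
    unfolding near_def by (rule borel_measurable_times_ennreal[OF borel_measurable_const ind])
  have ball: "emeasure lborel (cball 0 r :: (real ^ 'n) set) = ennreal (?V * r powr ?n)" if "r > 0" for r
    using that by (subst emeasure_cball) (auto simp: powr_realpow)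
  have far: "(\<integral>\<^sup>+ z. far j z \<partial>lborel) = ennreal (?V * 2 powr ?n * (2 powr (- (\<theta> * p))) ^ j)" for j
  proof -
    have "(\<integral>\<^sup>+ z. far j z \<partial>lborel) = ennreal (2 powr (- real j * ?a)) * ennreal (?V * (2 powr (real j + 1)) powr ?n)"
      unfolding far_def by (subst nn_integral_cmult) (auto simp: ball ind)
    also have "\<dots> = ennreal (?V * (2 powr (- real j * ?a) * (2 powr (real j + 1)) powr ?n))"
      by (subst ennreal_mult[symmetric]) (auto simp: mult_ac)
    also have "2 powr (- real j * ?a) * (2 powr (real j + 1)) powr ?n = 2 powr ?n * (2 powr (- (\<theta> * p))) ^ j"
      by (simp add: powr_powr powr_add[symmetric] powr_realpow[symmetric] algebra_simps)
    finally show ?thesis by (simp add: mult.assoc)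
  qed
  have near: "(\<integral>\<^sup>+ z. near j z \<partial>lborel) = ennreal (?V * 2 powr ?a * (2 powr (- ((1 - \<theta>) * p))) ^ j)" for j
  proof -
    have "(\<integral>\<^sup>+ z. near j z \<partial>lborel) =
      ennreal (2 powr ((real j + 1) * ?a - real j * p)) * ennreal (?V * (2 powr (- real j)) powr ?n)"
      unfolding near_def by (subst nn_integral_cmult) (auto simp: ball ind)
    also have "\<dots> = ennreal (?V * (2 powr ((real j + 1) * ?a - real j * p) * (2 powr (- real j)) powr ?n))"
      by (subst ennreal_mult[symmetric]) (auto simp: mult_ac)
    also have "2 powr ((real j + 1) * ?a - real j * p) * (2 powr (- real j)) powr ?n =
       2 powr ?a * (2 powr (- ((1 - \<theta>) * p))) ^ j"
      by (simp add: powr_powr powr_add[symmetric] powr_realpow[symmetric] algebra_simps)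
    finally show ?thesis by (simp add: mult.assoc)
  qed
  have geo: "(\<Sum>j. ennreal (c * (2 powr (- q)) ^ j)) \<noteq> top" if "q > 0" "c \<ge> 0" for c q :: real
  proof (rule ennreal_suminf_neq_top)
    show "summable (\<lambda>j. c * (2 powr (- q)) ^ j)"
      using that by (intro summable_mult summable_geometric) (simp add: powr_less_one)
  qed (use that in auto)
  have "(\<integral>\<^sup>+ z. ennreal (gagliardo_kernel \<theta> p (z :: real ^ 'n)) \<partial>lborel) \<le>
    (\<integral>\<^sup>+ z. (\<Sum>j. far j z) + (\<Sum>j. near j z) \<partial>lborel)"
    by (intro nn_integral_mono bound)
  also have "\<dots> = (\<Sum>j. \<integral>\<^sup>+ z. far j z \<partial>lborel) + (\<Sum>j. \<integral>\<^sup>+ z. near j z \<partial>lborel)"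
    by (simp add: nn_integral_add nn_integral_suminf)
  also have "\<dots> < \<infinity>"
  proof -
    have "(\<Sum>j. ennreal (?V * 2 powr ?n * (2 powr (- (\<theta> * p))) ^ j)) \<noteq> top"
      "(\<Sum>j. ennreal (?V * 2 powr ?a * (2 powr (- ((1 - \<theta>) * p))) ^ j)) \<noteq> top"
      by (rule geo; use assms in simp)+
    then show ?thesis
      unfolding far near infinity_ennreal_def less_top[symmetric] ennreal_add_eq_top by blast
  qed
  finally show ?thesis .
qed

lemma nn_integral_lborel_translate:
  fixes f :: "'a::euclidean_space \<Rightarrow> ennreal"
  assumes [measurable]: "f \<in> borel_measurable borel"
  shows "(\<integral>\<^sup>+ x. f (x + c) \<partial>lborel) = (\<integral>\<^sup>+ x. f x \<partial>lborel)"
proof -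
  have "(\<integral>\<^sup>+ x. f x \<partial>lborel) = (\<integral>\<^sup>+ x. f x \<partial>(distr lborel borel ((+) c)))"
    by (simp add: lborel_distr_plus)
  also have "\<dots> = (\<integral>\<^sup>+ x. f (c + x) \<partial>lborel)"
    by (subst nn_integral_distr) auto
  finally show ?thesis by (simp add: add.commute)
qed

lemma test_function_truncated_lipschitz:
  fixes f :: "real ^ 'n::finite \<Rightarrow> real"
  assumes "f \<in> test_functions \<Omega>"
  obtains L where "L > 0" "\<And>x. \<bar>f x\<bar> \<le> L" "\<And>x y. \<bar>f x - f y\<bar> \<le> L * min 1 (norm (x - y))"
proof -
  obtain M where M: "M \<ge> 0" "\<And>x. \<bar>f x\<bar> \<le> M" using test_functions_bounded[OF assms] by auto
  obtain L where L: "L \<ge> 0" "\<And>x y. \<bar>f x - f y\<bar> \<le> L * norm (x - y)"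
    using test_functions_lipschitz[OF assms] by auto
  show ?thesis
  proof (rule that[of "2 * M + L + 1"])
    show "\<bar>f x\<bar> \<le> 2 * M + L + 1" for x using M(1) M(2)[of x] L(1) by linarith
    show "\<bar>f x - f y\<bar> \<le> (2 * M + L + 1) * min 1 (norm (x - y))" for x y
    proof (cases "norm (x - y) \<le> 1")
      case True
      have "\<bar>f x - f y\<bar> \<le> L * norm (x - y)" by (rule L)
      also have "\<dots> \<le> (2 * M + L + 1) * norm (x - y)"
        using M(1) by (intro mult_right_mono) auto
      finally show ?thesis using True by simp
    next
      case False
      have "\<bar>f x - f y\<bar> \<le> \<bar>f x\<bar> + \<bar>f y\<bar>" by (rule abs_triangle_ineq4)
      then have "\<bar>f x - f y\<bar> \<le> 2 * M + L + 1" using M(2)[of x] M(2)[of y] L(1) by linarith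
      then show ?thesis using False by simp
    qed
  qed (use M L in simp)
qed

text \<open>
  The increment of \<open>f v\<close> is \<open>f(x) (v(x) - v(y)) + (f(x) - f(y)) v(y)\<close>.  The \<open>p\<close>-th power of the second summand
  over that of the distance is at most a multiple of \<open>\<bar>v(y)\<bar>\<^sup>p\<close> times the truncated kernel at \<open>x - y\<close>, whose integral
  in \<open>x\<close> is the same for all \<open>y\<close>.
\<close>

lemma gagliardo_integral_mult_test_function:
  fixes \<Omega> :: "(real ^ 'n::finite) set"
  assumes \<Omega>: "open \<Omega>" and f: "f \<in> test_functions \<Omega>'" and \<theta>: "0 < \<theta>" "\<theta> < 1" and p: "0 < p"
  obtains C where "C > 0" "\<And>v. v \<in> borel_measurable borel \<Longrightarrow>
    gagliardo_integral \<theta> p \<Omega> (\<lambda>x. f x * v x) \<le>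
      ennreal C * (gagliardo_integral \<theta> p \<Omega> v + Lp_integral p v)"
proof -
  obtain L where L: "L > 0" "\<And>x. \<bar>f x\<bar> \<le> L" "\<And>x y. \<bar>f x - f y\<bar> \<le> L * min 1 (norm (x - y))"
    using test_function_truncated_lipschitz[OF f] by auto
  obtain K where K: "K \<ge> 0" "(\<integral>\<^sup>+ z. ennreal (gagliardo_kernel \<theta> p (z :: real ^ 'n)) \<partial>lborel) = ennreal K"
    using gagliardo_kernel_integrable[OF \<theta> p, where 'n = 'n]
    by (cases "\<integral>\<^sup>+ z. ennreal (gagliardo_kernel \<theta> p (z :: real ^ 'n)) \<partial>lborel") auto
  have [measurable]: "\<Omega> \<in> sets borel" using \<Omega> by auto
  define c where "c = 2 powr p * L powr p"
  have c: "c > 0" using L by (simp add: c_def)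
  have main: "gagliardo_integral \<theta> p \<Omega> (\<lambda>x. f x * v x) \<le>
      ennreal (c * (1 + K)) * (gagliardo_integral \<theta> p \<Omega> v + Lp_integral p v)"
    if [measurable]: "v \<in> borel_measurable borel" for v
  proof -
    let ?a = "real CARD('n) + \<theta> * p"
    let ?F = "\<lambda>v x y. ennreal (indicator \<Omega> x * indicator \<Omega> y * (\<bar>v x - v y\<bar> powr p / norm (x - y) powr ?a))"
    have pw: "?F (\<lambda>x. f x * v x) x y \<le> ennreal c * (?F v x y +
        ennreal (\<bar>v y\<bar> powr p) * ennreal (gagliardo_kernel \<theta> p (x - y)))" for x y
    proof -
      have "\<bar>f x * v x - f y * v y\<bar> = \<bar>f x * (v x - v y) + (f x - f y) * v y\<bar>" by (simp add: algebra_simps)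
      then have "\<bar>f x * v x - f y * v y\<bar> powr p \<le>
          2 powr p * (\<bar>f x * (v x - v y)\<bar> powr p + \<bar>(f x - f y) * v y\<bar> powr p)"
        using abs_add_powr_le[of p "f x * (v x - v y)" "(f x - f y) * v y"] p by simp
      also have "\<dots> \<le> 2 powr p * (L powr p * \<bar>v x - v y\<bar> powr p +
          L powr p * min 1 (norm (x - y)) powr p * \<bar>v y\<bar> powr p)"
      proof (intro mult_left_mono add_mono)
        show "\<bar>f x * (v x - v y)\<bar> powr p \<le> L powr p * \<bar>v x - v y\<bar> powr p"
          using L p by (auto simp: abs_mult powr_mult intro!: mult_right_mono powr_mono2)
        have "\<bar>f x - f y\<bar> powr p \<le> (L * min 1 (norm (x - y))) powr p"
          using L p by (intro powr_mono2) auto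
        also have "\<dots> = L powr p * min 1 (norm (x - y)) powr p"
          using L by (simp add: powr_mult)
        finally show "\<bar>(f x - f y) * v y\<bar> powr p \<le> L powr p * min 1 (norm (x - y)) powr p * \<bar>v y\<bar> powr p"
          by (simp add: abs_mult powr_mult mult_right_mono)
      qed simp
      also have "\<dots> = c * (\<bar>v x - v y\<bar> powr p + \<bar>v y\<bar> powr p * min 1 (norm (x - y)) powr p)"
        by (simp add: c_def algebra_simps)
      finally have "\<bar>f x * v x - f y * v y\<bar> powr p / norm (x - y) powr ?a \<le>
        c * (\<bar>v x - v y\<bar> powr p + \<bar>v y\<bar> powr p * min 1 (norm (x - y)) powr p) / norm (x - y) powr ?a"
        by (rule divide_right_mono) simp
      also have "\<dots> = c * (\<bar>v x - v y\<bar> powr p / norm (x - y) powr ?a + \<bar>v y\<bar> powr p * gagliardo_kernel \<theta> p (x - y))"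
        unfolding gagliardo_kernel_def times_divide_eq_right add_divide_distrib[symmetric] ..
      finally have le: "\<bar>f x * v x - f y * v y\<bar> powr p / norm (x - y) powr ?a \<le>
        c * (\<bar>v x - v y\<bar> powr p / norm (x - y) powr ?a + \<bar>v y\<bar> powr p * gagliardo_kernel \<theta> p (x - y))" .
      show ?thesis
      proof (cases "x \<in> \<Omega> \<and> y \<in> \<Omega>")
        case True
        have "ennreal (\<bar>f x * v x - f y * v y\<bar> powr p / norm (x - y) powr ?a) \<le>
          ennreal (c * (\<bar>v x - v y\<bar> powr p / norm (x - y) powr ?a + \<bar>v y\<bar> powr p * gagliardo_kernel \<theta> p (x - y)))"
          by (rule ennreal_leI[OF le])
        also have "\<dots> = ennreal c * (ennreal (\<bar>v x - v y\<bar> powr p / norm (x - y) powr ?a) +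
          ennreal (\<bar>v y\<bar> powr p) * ennreal (gagliardo_kernel \<theta> p (x - y)))"
          using c gagliardo_kernel_nonneg[of \<theta> p "x - y"]
          by (simp add: ennreal_mult ennreal_plus)
        finally show ?thesis using True by simp
      qed auto
    qed
    have "gagliardo_integral \<theta> p \<Omega> (\<lambda>x. f x * v x) \<le> (\<integral>\<^sup>+ x. \<integral>\<^sup>+ y. ennreal c * (?F v x y +
        ennreal (\<bar>v y\<bar> powr p) * ennreal (gagliardo_kernel \<theta> p (x - y))) \<partial>lborel \<partial>lborel)"
      unfolding gagliardo_integral_def by (intro nn_integral_mono pw)
    also have "\<dots> = ennreal c * (gagliardo_integral \<theta> p \<Omega> v +
        (\<integral>\<^sup>+ x. \<integral>\<^sup>+ y. ennreal (\<bar>v y\<bar> powr p) * ennreal (gagliardo_kernel \<theta> p (x - y)) \<partial>lborel \<partial>lborel))"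
      unfolding gagliardo_integral_def by (simp add: nn_integral_cmult nn_integral_add)
    also have "(\<integral>\<^sup>+ x. \<integral>\<^sup>+ y. ennreal (\<bar>v y\<bar> powr p) * ennreal (gagliardo_kernel \<theta> p (x - y)) \<partial>lborel \<partial>lborel) =
        (\<integral>\<^sup>+ y. \<integral>\<^sup>+ x. ennreal (\<bar>v y\<bar> powr p) * ennreal (gagliardo_kernel \<theta> p (x - y)) \<partial>lborel \<partial>lborel)"
      by (rule lborel_pair.Fubini') simp
    also have "\<dots> = (\<integral>\<^sup>+ y. ennreal (\<bar>v y\<bar> powr p) * ennreal K \<partial>lborel)"
    proof (rule nn_integral_cong)
      fix y :: "real ^ 'n"
      have "(\<integral>\<^sup>+ x. ennreal (gagliardo_kernel \<theta> p (x - y)) \<partial>lborel) = ennreal K"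
        using nn_integral_lborel_translate[of "\<lambda>x. ennreal (gagliardo_kernel \<theta> p x)" "- y"] K(2) by simp
      then show "(\<integral>\<^sup>+ x. ennreal (\<bar>v y\<bar> powr p) * ennreal (gagliardo_kernel \<theta> p (x - y)) \<partial>lborel) =
        ennreal (\<bar>v y\<bar> powr p) * ennreal K"
        by (subst nn_integral_cmult) auto
    qed
    also have "\<dots> = ennreal K * Lp_integral p v"
      unfolding Lp_integral_def by (subst nn_integral_multc) (auto simp: mult.commute)
    also have "gagliardo_integral \<theta> p \<Omega> v + ennreal K * Lp_integral p v \<le>
        ennreal (1 + K) * (gagliardo_integral \<theta> p \<Omega> v + Lp_integral p v)"
      using K(1) by (simp add: ennreal_plus distrib_left distrib_right add_mono add_increasing2 add_increasing)
    finally show ?thesis using c K(1) by (simp add: ennreal_mult mult.assoc mult_left_mono)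
  qed
  show ?thesis by (rule that[of "c * (1 + K)"]) (use c K(1) main in auto)
qed

section \<open>Translates of a function with weak first derivatives\<close>

lemma integrable_lborel_translate:
  fixes f :: "'a::euclidean_space \<Rightarrow> real"
  assumes "integrable lborel f"
  shows "integrable lborel (\<lambda>x. f (x + c))" "(LINT x|lborel. f (x + c)) = (LINT x|lborel. f x)"
proof -
  have m: "f \<in> borel_measurable borel" using borel_measurable_integrable[OF assms] by simp
  have "integrable (distr lborel borel ((+) c)) f" using assms by (simp add: lborel_distr_plus)
  then show "integrable lborel (\<lambda>x. f (x + c))"
    using m by (subst (asm) integrable_distr_eq) (auto simp: add.commute)
  have "(LINT x|lborel. f x) = (LINT x|distr lborel borel ((+) c). f x)" by (simp add: lborel_distr_plus)
  also have "\<dots> = (LINT x|lborel. f (x + c))"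
    using m by (subst integral_distr) (auto simp: add.commute)
  finally show "(LINT x|lborel. f (x + c)) = (LINT x|lborel. f x)" ..
qed

lemma frechet_derivative_translate:
  fixes f :: "'a::real_normed_vector \<Rightarrow> 'b::real_normed_vector"
  assumes "f differentiable at (x + c)"
  shows "frechet_derivative (\<lambda>y. f (y + c)) (at x) = frechet_derivative f (at (x + c))"
proof -
  have "((\<lambda>y. y + c) has_derivative (\<lambda>v. v)) (at x)" by (auto intro!: derivative_eq_intros)
  then have "((\<lambda>y. f (y + c)) has_derivative (\<lambda>v. frechet_derivative f (at (x + c)) v)) (at x)"
    using assms by (intro has_derivative_compose[of "\<lambda>y. y + c" _ _ _ f]) (auto simp: frechet_derivative_works)
  from frechet_derivative_at[OF this] show ?thesis by simp
qed

lemma test_functions_translate: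
  fixes \<xi> :: "'a::euclidean_space \<Rightarrow> real"
  assumes "\<xi> \<in> test_functions UNIV"
  shows "(\<lambda>x. \<xi> (x + c)) \<in> test_functions UNIV"
proof (rule test_functionsI)
  have id: "smooth_on UNIV (\<lambda>x::'a. x + c)"
    by (intro smooth_on_add smooth_on_const smooth_on_bounded_linear bounded_linear_ident) auto
  show "smooth_on UNIV (\<lambda>x. \<xi> (x + c))"
    by (intro smooth_on_compose[OF _ _ _ id test_functionsD(1)[OF assms]]) auto
  show "compact ((\<lambda>x. x - c) ` closure {x. \<xi> x \<noteq> 0})"
    by (intro compact_continuous_image continuous_intros test_functionsD(2)[OF assms])
  show "{x. \<xi> (x + c) \<noteq> 0} \<subseteq> (\<lambda>x. x - c) ` closure {x. \<xi> x \<noteq> 0}"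
  proof
    fix x assume "x \<in> {x. \<xi> (x + c) \<noteq> 0}"
    then have "x + c \<in> closure {x. \<xi> x \<noteq> 0}" using closure_subset[of "{x. \<xi> x \<noteq> 0}"] by blast
    then show "x \<in> (\<lambda>x. x - c) ` closure {x. \<xi> x \<noteq> 0}" by (intro image_eqI[of _ _ "x + c"]) auto
  qed
qed simp

text \<open>
  Testing both sides against a test function, the translation and the derivative move over to it,
  where the identity is the fundamental theorem of calculus along a segment.
\<close>

lemma difference_eq_integral_weak_derivative:
  fixes g D :: "real ^ 'n::finite \<Rightarrow> real"
  assumes g: "integrable lborel g" and D: "integrable lborel D"
    and weak: "\<And>\<xi>. \<xi> \<in> test_functions UNIV \<Longrightarrow>
      (LINT x|lborel. g x * frechet_derivative \<xi> (at x) h) = - (LINT x|lborel. D x * \<xi> x)"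
  shows "AE x in lborel. g (x + h) - g x = (LINT t|lborel. indicator {0..1} t * D (x + t *\<^sub>R h))"
proof -
  have [measurable]: "g \<in> borel_measurable borel" "D \<in> borel_measurable borel"
    using borel_measurable_integrable[OF g] borel_measurable_integrable[OF D] by auto
  let ?P = "\<lambda>t x. indicator {0..1::real} t * D (x + t *\<^sub>R h)"
  let ?I = "\<lambda>x. LINT t|lborel. ?P t x"
  have P: "integrable (lborel \<Otimes>\<^sub>M lborel) (\<lambda>(t, x). ?P t x)"
  proof (rule integrableI_bounded)
    have "(\<integral>\<^sup>+ z. ennreal (norm (case z of (t, x) \<Rightarrow> ?P t x)) \<partial>(lborel \<Otimes>\<^sub>M lborel)) =
       (\<integral>\<^sup>+ t. \<integral>\<^sup>+ x. ennreal (norm (?P t x)) \<partial>lborel \<partial>lborel)"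
      by (subst lborel.nn_integral_fst[symmetric]) (simp_all add: case_prod_unfold)
    also have "\<dots> = (\<integral>\<^sup>+ t. indicator {0..1::real} t * (\<integral>\<^sup>+ x. ennreal \<bar>D x\<bar> \<partial>lborel) \<partial>lborel)"
    proof (rule nn_integral_cong)
      fix t :: real
      have "(\<integral>\<^sup>+ x. ennreal (norm (?P t x)) \<partial>lborel) =
          (\<integral>\<^sup>+ x. indicator {0..1} t * ennreal \<bar>D (x + t *\<^sub>R h)\<bar> \<partial>lborel)"
        by (intro nn_integral_cong) (auto simp: indicator_def)
      also have "\<dots> = indicator {0..1} t * (\<integral>\<^sup>+ x. ennreal \<bar>D (x + t *\<^sub>R h)\<bar> \<partial>lborel)"
        by (rule nn_integral_cmult) simp
      also have "(\<integral>\<^sup>+ x. ennreal \<bar>D (x + t *\<^sub>R h)\<bar> \<partial>lborel) = (\<integral>\<^sup>+ x. ennreal \<bar>D x\<bar> \<partial>lborel)"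
        by (rule nn_integral_lborel_translate) simp
      finally show "(\<integral>\<^sup>+ x. ennreal (norm (?P t x)) \<partial>lborel) =
        indicator {0..1} t * (\<integral>\<^sup>+ x. ennreal \<bar>D x\<bar> \<partial>lborel)" .
    qed
    also have "\<dots> = (\<integral>\<^sup>+ x. ennreal \<bar>D x\<bar> \<partial>lborel)"
      by (subst nn_integral_multc) auto
    also have "\<dots> < \<infinity>" using D by (simp add: integrable_iff_bounded)
    finally show "(\<integral>\<^sup>+ z. ennreal (norm (case z of (t, x) \<Rightarrow> ?P t x)) \<partial>(lborel \<Otimes>\<^sub>M lborel)) < \<infinity>" .
  qed measurable
  have I: "integrable lborel ?I" by (rule lborel_pair.integrable_snd[OF P])
  have gh: "integrable lborel (\<lambda>x. g (x + h))" by (rule integrable_lborel_translate[OF g])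
  let ?v = "\<lambda>x. g (x + h) - g x - ?I x"
  have v: "integrable lborel ?v" using gh g I by (intro Bochner_Integration.integrable_diff)
  have vm: "?v \<in> borel_measurable borel" using borel_measurable_integrable[OF v] by simp
  have "AE x in lebesgue. x \<in> UNIV \<longrightarrow> ?v x = 0"
  proof (rule fundamental_lemma_calculus_of_variations)
    show "locally_integrable_on UNIV ?v"
      using v vm by (intro integrable_locally_integrable) (simp add: integrable_completion)
    fix \<xi> :: "real ^ 'n \<Rightarrow> real" assume \<xi>: "\<xi> \<in> test_functions UNIV"
    obtain M where M: "\<And>x. \<bar>\<xi> x\<bar> \<le> M" using test_functions_bounded[OF \<xi>] by auto
    let ?D\<xi> = "\<lambda>x. frechet_derivative \<xi> (at x) h"
    have D\<xi>: "?D\<xi> \<in> test_functions UNIV" by (rule test_functions_directional_deriv[OF \<xi>])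
    obtain M' where M': "\<And>x. \<bar>?D\<xi> x\<bar> \<le> M'" using test_functions_bounded[OF D\<xi>] by auto
    have [measurable]: "\<xi> \<in> borel_measurable borel" "?D\<xi> \<in> borel_measurable borel"
      using test_functions_continuous_on[OF \<xi>] test_functions_continuous_on[OF D\<xi>]
      by (auto intro: borel_measurable_continuous_onI)
    have d: "\<xi> differentiable at x" for x
      using smooth_on_differentiable[OF test_functionsD(1)[OF \<xi>]] by simp
    have P\<xi>: "integrable (lborel \<Otimes>\<^sub>M lborel) (\<lambda>(t, x). ?P t x * \<xi> x)"
      using integrable_bounded_mult[OF P, of "\<lambda>z. \<xi> (snd z)" M] M by (simp add: case_prod_unfold)
    let ?Q = "\<lambda>t x. indicator {0..1::real} t * (g x * ?D\<xi> (x + (- t) *\<^sub>R h))"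
    have Q: "integrable (lborel \<Otimes>\<^sub>M lborel) (\<lambda>(t, x). ?Q t x)"
    proof -
      have "integrable (lborel \<Otimes>\<^sub>M lborel) (\<lambda>(t::real, x). indicator {0..1} t * g x)"
      proof (rule integrableI_bounded)
        have "(\<integral>\<^sup>+ z. ennreal (norm (case z of (t::real, x) \<Rightarrow> indicator {0..1} t * g x)) \<partial>(lborel \<Otimes>\<^sub>M lborel)) =
           (\<integral>\<^sup>+ t. \<integral>\<^sup>+ x. indicator {0..1::real} t * ennreal \<bar>g x\<bar> \<partial>lborel \<partial>lborel)"
          by (subst lborel.nn_integral_fst[symmetric])
            (auto simp: case_prod_unfold indicator_def intro!: nn_integral_cong)
        also have "\<dots> = (\<integral>\<^sup>+ x. ennreal \<bar>g x\<bar> \<partial>lborel)"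
          by (simp add: nn_integral_cmult nn_integral_multc)
        also have "\<dots> < \<infinity>" using g by (simp add: integrable_iff_bounded)
        finally show "(\<integral>\<^sup>+ z. ennreal (norm (case z of (t::real, x) \<Rightarrow> indicator {0..1} t * g x)) \<partial>(lborel \<Otimes>\<^sub>M lborel)) < \<infinity>" .
      qed measurable
      from integrable_bounded_mult[OF this, of "\<lambda>z. ?D\<xi> (snd z + (- fst z) *\<^sub>R h)" M'] M'
      show ?thesis by (simp add: case_prod_unfold mult.assoc)
    qed
    have inner: "(LINT x|lborel. ?P t x * \<xi> x) = - (LINT x|lborel. ?Q t x)" for t
    proof -
      have "integrable lborel (\<lambda>x. D x * \<xi> (x + (- t) *\<^sub>R h))"
        by (rule integrable_bounded_mult[OF D _ M]) measurable
      from integrable_lborel_translate(2)[OF this, of "t *\<^sub>R h"]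
      have "(LINT x|lborel. D (x + t *\<^sub>R h) * \<xi> x) = (LINT x|lborel. D x * \<xi> (x + (- t) *\<^sub>R h))"
        by simp
      also have "\<dots> = - (LINT x|lborel. g x * frechet_derivative (\<lambda>x. \<xi> (x + (- t) *\<^sub>R h)) (at x) h)"
        using weak[OF test_functions_translate[OF \<xi>, of "(- t) *\<^sub>R h"]] by simp
      also have "\<dots> = - (LINT x|lborel. g x * ?D\<xi> (x + (- t) *\<^sub>R h))"
        by (simp only: frechet_derivative_translate[OF d])
      finally have e: "(LINT x|lborel. D (x + t *\<^sub>R h) * \<xi> x) = - (LINT x|lborel. g x * ?D\<xi> (x + (- t) *\<^sub>R h))" .
      show ?thesis
        using e by (cases "t \<in> {0..1}") simp_all
    qed
    have line: "(LINT t|lborel. ?Q t x) = g x * (\<xi> x - \<xi> (x - h))" for x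
    proof -
      have "(LINT t|lborel. ?D\<xi> (x + (- t) *\<^sub>R h) * indicator {0..1} t) =
        (- \<xi> (x + (- 1) *\<^sub>R h)) - (- \<xi> (x + (- 0) *\<^sub>R h))"
      proof (rule integral_FTC_Icc_real)
        fix t :: real
        have "((\<lambda>s. \<xi> (x + s *\<^sub>R (- h))) has_real_derivative frechet_derivative \<xi> (at (x + t *\<^sub>R (- h))) (- h)) (at t)"
          by (rule line_has_derivative[OF d])
        moreover have "frechet_derivative \<xi> (at (x + t *\<^sub>R (- h))) (- h) = - ?D\<xi> (x + t *\<^sub>R (- h))"
          using d[of "x + t *\<^sub>R (- h)"]
          by (simp add: frechet_derivative_works has_derivative_linear linear_neg)
        ultimately show "((\<lambda>t. - \<xi> (x + (- t) *\<^sub>R h)) has_real_derivative ?D\<xi> (x + (- t) *\<^sub>R h)) (at t)"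
          by (auto intro!: derivative_eq_intros)
        have c: "isCont ?D\<xi> y" for y
          using test_functions_continuous_on[OF D\<xi>, of UNIV] by (simp add: continuous_on_eq_continuous_at)
        show "isCont (\<lambda>t. ?D\<xi> (x + (- t) *\<^sub>R h)) t"
          by (rule isCont_o2[OF _ c]) (intro continuous_intros)
      qed simp
      moreover have "(LINT t|lborel. ?Q t x) = (LINT t|lborel. g x * (?D\<xi> (x + (- t) *\<^sub>R h) * indicator {0..1} t))"
        by (intro Bochner_Integration.integral_cong) (auto simp: mult_ac)
      ultimately show ?thesis by simp
    qed
    have "(LINT x|lborel. ?I x * \<xi> x) = (LINT x|lborel. LINT t|lborel. ?P t x * \<xi> x)"
      by simp
    also have "\<dots> = (LINT t|lborel. LINT x|lborel. ?P t x * \<xi> x)"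
      by (rule lborel_pair.Fubini_integral[OF P\<xi>])
    also have "\<dots> = - (LINT t|lborel. LINT x|lborel. ?Q t x)"
      by (simp only: inner Bochner_Integration.integral_minus)
    also have "(LINT t|lborel. LINT x|lborel. ?Q t x) = (LINT x|lborel. LINT t|lborel. ?Q t x)"
      by (rule lborel_pair.Fubini_integral[OF Q, symmetric])
    also have "\<dots> = (LINT x|lborel. g x * \<xi> x - g x * \<xi> (x - h))"
      by (simp only: line right_diff_distrib)
    also have "\<dots> = (LINT x|lborel. g x * \<xi> x) - (LINT x|lborel. g x * \<xi> (x - h))"
      by (intro Bochner_Integration.integral_diff integrable_bounded_mult[OF g _ M]) measurable
    also have "(LINT x|lborel. g x * \<xi> (x - h)) = (LINT x|lborel. g (x + h) * \<xi> x)"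
    proof -
      have "integrable lborel (\<lambda>x. g x * \<xi> (x - h))" by (rule integrable_bounded_mult[OF g _ M]) measurable
      from integrable_lborel_translate(2)[OF this, of h] show ?thesis by simp
    qed
    finally have eq: "(LINT x|lborel. ?I x * \<xi> x) = (LINT x|lborel. g (x + h) * \<xi> x) - (LINT x|lborel. g x * \<xi> x)"
      by simp
    have \<xi>m: "\<xi> \<in> borel_measurable lborel" by simp
    note i = integrable_bounded_mult[OF gh \<xi>m M] integrable_bounded_mult[OF g \<xi>m M]
      integrable_bounded_mult[OF I \<xi>m M]
    have "(LINT x|lebesgue. ?v x * \<xi> x) = (LINT x|lborel. ?v x * \<xi> x)"
      by (rule integral_completion, rule borel_measurable_times) (use vm in simp_all)
    also have "\<dots> = 0"
      unfolding left_diff_distrib using i eq by simp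
    finally show "(LINT x|lebesgue. ?v x * \<xi> x) = 0" .
  qed simp
  then have "AE x in lborel. ?v x = 0" by (simp add: AE_completion_iff)
  then show ?thesis by eventually_elim simp
qed

text \<open>
  Jensen's inequality on the unit interval.  Young's inequality for \<open>\<bar>F\<bar>\<close> and \<open>A\<^sup>p\<^sup>-\<^sup>1\<close>, where \<open>A\<close> is the
  integral of \<open>\<bar>F\<bar>\<close>, is integrated and solved for \<open>A\<^sup>p\<close>.
\<close>

lemma powr_integral_le:
  fixes F :: "real \<Rightarrow> real"
  assumes p: "1 < p" and [measurable]: "F \<in> borel_measurable borel"
  shows "ennreal (\<bar>LINT t|lborel. indicator {0..1} t * F t\<bar> powr p) \<le>
    (\<integral>\<^sup>+ t. indicator {0..1} t * ennreal (\<bar>F t\<bar> powr p) \<partial>lborel)"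
proof (cases "integrable lborel (\<lambda>t. indicator {0..1} t * F t)")
  case False
  then show ?thesis using p by (simp add: not_integrable_integral_eq)
next
  case i: True
  let ?B = "\<integral>\<^sup>+ t. indicator {0..1} t * ennreal (\<bar>F t\<bar> powr p) \<partial>lborel"
  have e: "?B = (\<integral>\<^sup>+ t. ennreal (indicator {0..1} t * \<bar>F t\<bar> powr p) \<partial>lborel)"
    by (intro nn_integral_cong) (auto simp: indicator_def)
  show ?thesis
  proof (cases "?B = \<infinity>")
    case False
    then have j: "integrable lborel (\<lambda>t. indicator {0..1} t * \<bar>F t\<bar> powr p)"
      unfolding e by (intro integrableI_nonneg) (use False in \<open>auto simp: e[symmetric] less_top[symmetric]\<close>)
    define A where "A = (LINT t|lborel. indicator {0..1} t * \<bar>F t\<bar>)"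
    define b where "b = (LINT t|lborel. indicator {0..1} t * \<bar>F t\<bar> powr p)"
    have iA: "integrable lborel (\<lambda>t. indicator {0..1} t * \<bar>F t\<bar>)"
      using integrable_abs[OF i] by (simp add: abs_mult)
    have A0: "A \<ge> 0" unfolding A_def by (intro Bochner_Integration.integral_nonneg) auto
    define q where "q = p / (p - 1)"
    have q: "1 < q" "1 / p + 1 / q = 1" "q * (p - 1) = p" using p by (auto simp: q_def field_simps)
    have ones: "integrable lborel (\<lambda>t::real. indicator {0..1} t * c)" for c :: real
      by (intro integrable_mult_left) (auto simp: integrable_indicator_iff)
    have "A * A powr (p - 1) = (LINT t|lborel. indicator {0..1} t * \<bar>F t\<bar> * A powr (p - 1))"
      by (simp add: A_def)
    also have "\<dots> \<le> (LINT t|lborel. (indicator {0..1} t * \<bar>F t\<bar> powr p) / p + indicator {0..1} t * (A powr p / q))"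
    proof (rule integral_mono)
      show "integrable lborel (\<lambda>t. indicator {0..1} t * \<bar>F t\<bar> * A powr (p - 1))"
        by (intro integrable_mult_left iA)
      show "integrable lborel (\<lambda>t. (indicator {0..1} t * \<bar>F t\<bar> powr p) / p + indicator {0..1} t * (A powr p / q))"
        by (intro Bochner_Integration.integrable_add integrable_divide j ones)
      fix t :: real
      have "\<bar>F t\<bar> * A powr (p - 1) \<le> \<bar>F t\<bar> powr p / p + (A powr (p - 1)) powr q / q"
        by (rule Youngs_inequality) (use p q in auto)
      then show "indicator {0..1} t * \<bar>F t\<bar> * A powr (p - 1) \<le>
          (indicator {0..1} t * \<bar>F t\<bar> powr p) / p + indicator {0..1} t * (A powr p / q)"
        using q by (auto simp: indicator_def powr_powr mult.commute)
    qed
    also have "\<dots> = b / p + A powr p / q"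
    proof -
      have "(LINT t|lborel. indicator {0..1::real} t * (A powr p / q)) = A powr p / q"
        by (subst integral_mult_left_zero) simp
      then show ?thesis
        by (subst Bochner_Integration.integral_add) (use integrable_divide[OF j] ones in \<open>auto simp: b_def\<close>)
    qed
    also have "A * A powr (p - 1) = A powr p"
      using A0 p by (cases "A = 0") (auto simp: powr_diff)
    finally have "A powr p * (1 - 1 / q) \<le> b / p" by (simp add: algebra_simps)
    moreover have "1 - 1 / q = 1 / p" using q(2) by simp
    ultimately have Ab: "A powr p \<le> b" using p by (simp add: field_simps)
    have "\<bar>LINT t|lborel. indicator {0..1} t * F t\<bar> \<le> A"
      unfolding A_def using integral_abs_bound[of lborel "\<lambda>t. indicator {0..1} t * F t"] by (simp add: abs_mult)
    then have "\<bar>LINT t|lborel. indicator {0..1} t * F t\<bar> powr p \<le> b"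
      using Ab p by (meson abs_ge_zero order_trans powr_mono2 less_imp_le less_trans zero_less_one)
    moreover have "?B = ennreal b"
      unfolding e b_def by (intro nn_integral_eq_integral j) auto
    ultimately show ?thesis by (simp add: ennreal_leI)
  qed simp
qed

lemma sum_powr_le:
  fixes a :: "'n::finite \<Rightarrow> real"
  assumes "\<And>i. 0 \<le> a i" "0 < p"
  shows "(\<Sum>i\<in>UNIV. a i) powr p \<le> real CARD('n) powr p * (\<Sum>i\<in>UNIV. a i powr p)"
proof -
  let ?m = "Max (range a)"
  have "?m \<in> range a" by (rule Max_in) auto
  then obtain k where k: "?m = a k" by (rule imageE)
  have "(\<Sum>i\<in>UNIV. a i) \<le> (\<Sum>i\<in>(UNIV::'n set). ?m)" by (intro sum_mono) auto
  then have "(\<Sum>i\<in>UNIV. a i) powr p \<le> (real CARD('n) * a k) powr p"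
    using assms k by (intro powr_mono2) (auto intro: sum_nonneg)
  also have "\<dots> = real CARD('n) powr p * a k powr p" using assms by (simp add: powr_mult)
  also have "\<dots> \<le> real CARD('n) powr p * (\<Sum>i\<in>UNIV. a i powr p)"
    by (intro mult_left_mono member_le_sum) auto
  finally show ?thesis .
qed

text \<open>
  Jensen's inequality for the integral along the segment, then Tonelli and translation invariance.
\<close>

lemma Lp_integral_difference_le:
  fixes g :: "real ^ 'n::finite \<Rightarrow> real" and D :: "'n \<Rightarrow> real ^ 'n \<Rightarrow> real"
  assumes p: "1 < p" and g: "integrable lborel g" and D: "\<And>i. integrable lborel (D i)"
    and weak: "\<And>\<xi> i. \<xi> \<in> test_functions UNIV \<Longrightarrow>
      (LINT x|lborel. g x * partial_deriv i \<xi> x) = - (LINT x|lborel. D i x * \<xi> x)"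
  shows "Lp_integral p (\<lambda>x. g (x + h) - g x) \<le>
    ennreal (real CARD('n) powr p * norm h powr p) * (\<Sum>i\<in>UNIV. Lp_integral p (D i))"
proof -
  have [measurable]: "D i \<in> borel_measurable borel" for i
    using borel_measurable_integrable[OF D] by simp
  define Dh where "Dh = (\<lambda>x. \<Sum>i\<in>UNIV. h $ i * D i x)"
  have Dh: "integrable lborel Dh" unfolding Dh_def by (intro Bochner_Integration.integrable_sum integrable_mult_right D)
  have [measurable]: "Dh \<in> borel_measurable borel" unfolding Dh_def by measurable
  have "AE x in lborel. g (x + h) - g x = (LINT t|lborel. indicator {0..1} t * Dh (x + t *\<^sub>R h))"
  proof (rule difference_eq_integral_weak_derivative[OF g Dh])
    fix \<xi> :: "real ^ 'n \<Rightarrow> real" assume \<xi>: "\<xi> \<in> test_functions UNIV"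
    have d: "\<xi> differentiable at x" for x
      using smooth_on_differentiable[OF test_functionsD(1)[OF \<xi>]] by simp
    obtain M where M: "\<And>x. \<bar>\<xi> x\<bar> \<le> M" using test_functions_bounded[OF \<xi>] by auto
    have m: "f \<in> borel_measurable lborel" if "f \<in> test_functions UNIV" for f :: "real ^ 'n \<Rightarrow> real"
      using test_functions_continuous_on[OF that] by (auto intro: borel_measurable_continuous_onI)
    have i1: "integrable lborel (\<lambda>x. g x * partial_deriv i \<xi> x)" for i
    proof -
      obtain M' where "\<And>x. \<bar>partial_deriv i \<xi> x\<bar> \<le> M'"
        using test_functions_bounded[OF test_functions_partial_deriv[OF \<xi>]] by metis
      then show ?thesis by (rule integrable_bounded_mult[OF g m[OF test_functions_partial_deriv[OF \<xi>]]])
    qed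
    have i2: "integrable lborel (\<lambda>x. D i x * \<xi> x)" for i
      by (rule integrable_bounded_mult[OF D m[OF \<xi>] M])
    have "(LINT x|lborel. g x * frechet_derivative \<xi> (at x) h) =
        (LINT x|lborel. (\<Sum>i\<in>UNIV. h $ i * (g x * partial_deriv i \<xi> x)))"
      by (simp add: frechet_derivative_eq_sum_partial_deriv[OF d] sum_distrib_left mult_ac)
    also have "\<dots> = (\<Sum>i\<in>UNIV. h $ i * (LINT x|lborel. g x * partial_deriv i \<xi> x))"
      using i1 by (subst Bochner_Integration.integral_sum) auto
    also have "\<dots> = - (\<Sum>i\<in>UNIV. h $ i * (LINT x|lborel. D i x * \<xi> x))"
      by (simp add: weak[OF \<xi>] sum_negf)
    also have "(\<Sum>i\<in>UNIV. h $ i * (LINT x|lborel. D i x * \<xi> x)) = (LINT x|lborel. (\<Sum>i\<in>UNIV. h $ i * (D i x * \<xi> x)))"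
      using i2 by (subst Bochner_Integration.integral_sum) auto
    also have "\<dots> = (LINT x|lborel. Dh x * \<xi> x)"
      by (simp add: Dh_def sum_distrib_right mult.assoc)
    finally show "(LINT x|lborel. g x * frechet_derivative \<xi> (at x) h) = - (LINT x|lborel. Dh x * \<xi> x)" .
  qed
  then have "Lp_integral p (\<lambda>x. g (x + h) - g x) =
      (\<integral>\<^sup>+ x. ennreal (\<bar>LINT t|lborel. indicator {0..1} t * Dh (x + t *\<^sub>R h)\<bar> powr p) \<partial>lborel)"
    unfolding Lp_integral_def by (intro nn_integral_cong_AE) (auto elim: eventually_mono)
  also have "\<dots> \<le> (\<integral>\<^sup>+ x. \<integral>\<^sup>+ t. indicator {0..1::real} t * ennreal (\<bar>Dh (x + t *\<^sub>R h)\<bar> powr p) \<partial>lborel \<partial>lborel)"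
    by (intro nn_integral_mono powr_integral_le p) measurable
  also have "\<dots> = (\<integral>\<^sup>+ t. \<integral>\<^sup>+ x. indicator {0..1::real} t * ennreal (\<bar>Dh (x + t *\<^sub>R h)\<bar> powr p) \<partial>lborel \<partial>lborel)"
    by (rule lborel_pair.Fubini') measurable
  also have "\<dots> = (\<integral>\<^sup>+ t. indicator {0..1::real} t * Lp_integral p Dh \<partial>lborel)"
  proof (rule nn_integral_cong)
    fix t :: real
    show "(\<integral>\<^sup>+ x. indicator {0..1::real} t * ennreal (\<bar>Dh (x + t *\<^sub>R h)\<bar> powr p) \<partial>lborel) =
      indicator {0..1::real} t * Lp_integral p Dh"
      using nn_integral_lborel_translate[of "\<lambda>x. ennreal (\<bar>Dh x\<bar> powr p)" "t *\<^sub>R h"]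
      by (subst nn_integral_cmult) (auto simp: Lp_integral_def)
  qed
  also have "\<dots> = Lp_integral p Dh" by (subst nn_integral_multc) auto
  also have "\<dots> \<le> (\<integral>\<^sup>+ x. ennreal (real CARD('n) powr p * norm h powr p) * (\<Sum>i\<in>UNIV. ennreal (\<bar>D i x\<bar> powr p)) \<partial>lborel)"
    unfolding Lp_integral_def
  proof (rule nn_integral_mono)
    fix x
    have "\<bar>Dh x\<bar> \<le> (\<Sum>i\<in>UNIV. norm h * \<bar>D i x\<bar>)"
      unfolding Dh_def by (rule order_trans[OF sum_abs], rule sum_mono, unfold abs_mult, rule mult_right_mono)
        (use component_le_norm_cart[of h] in auto)
    then have "\<bar>Dh x\<bar> powr p \<le> (\<Sum>i\<in>UNIV. norm h * \<bar>D i x\<bar>) powr p" using p by (intro powr_mono2) auto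
    also have "\<dots> \<le> real CARD('n) powr p * (\<Sum>i\<in>UNIV. (norm h * \<bar>D i x\<bar>) powr p)"
      using p by (intro sum_powr_le) auto
    also have "\<dots> = real CARD('n) powr p * norm h powr p * (\<Sum>i\<in>UNIV. \<bar>D i x\<bar> powr p)"
      by (simp add: powr_mult sum_distrib_left mult.assoc)
    finally have "ennreal (\<bar>Dh x\<bar> powr p) \<le>
        ennreal (real CARD('n) powr p * norm h powr p * (\<Sum>i\<in>UNIV. \<bar>D i x\<bar> powr p))"
      by (rule ennreal_leI)
    also have "\<dots> = ennreal (real CARD('n) powr p * norm h powr p) * (\<Sum>i\<in>UNIV. ennreal (\<bar>D i x\<bar> powr p))"
      by (simp add: ennreal_mult sum_nonneg sum_ennreal)
    finally show "ennreal (\<bar>Dh x\<bar> powr p) \<le> \<dots>" .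
  qed
  also have "\<dots> = ennreal (real CARD('n) powr p * norm h powr p) * (\<Sum>i\<in>UNIV. Lp_integral p (D i))"
    unfolding Lp_integral_def by (subst nn_integral_cmult) (simp_all add: nn_integral_sum del: sum_ennreal)
  finally show ?thesis .
qed

text \<open>
  The \<open>L\<^sup>p\<close> distance of \<open>g\<close> from its translate by \<open>h\<close> is \<open>O(\<bar>h\<bar>)\<close> for small \<open>h\<close> and \<open>O(1)\<close> for large \<open>h\<close>,
  so the Gagliardo integral, written as an integral over \<open>h\<close>, is dominated by the truncated kernel.
\<close>

lemma gagliardo_integral_le_weak_derivative:
  assumes \<theta>: "0 < \<theta>" "\<theta> < 1" and p: "1 < p"
  obtains C where "C > 0" "\<And>(g :: real ^ 'n::finite \<Rightarrow> real) D.
    integrable lborel g \<Longrightarrow> (\<And>i. integrable lborel (D i)) \<Longrightarrow>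
    (\<And>\<xi> i. \<xi> \<in> test_functions UNIV \<Longrightarrow>
      (LINT x|lborel. g x * partial_deriv i \<xi> x) = - (LINT x|lborel. D i x * \<xi> x)) \<Longrightarrow>
    gagliardo_integral \<theta> p UNIV g \<le> ennreal C * (Lp_integral p g + (\<Sum>i\<in>UNIV. Lp_integral p (D i)))"
proof -
  let ?n = "real CARD('n)" and ?a = "real CARD('n) + \<theta> * p"
  obtain K where K: "K \<ge> 0" "(\<integral>\<^sup>+ z. ennreal (gagliardo_kernel \<theta> p (z :: real ^ 'n)) \<partial>lborel) = ennreal K"
    using gagliardo_kernel_integrable[OF \<theta>, of p, where 'n = 'n] p
    by (cases "\<integral>\<^sup>+ z. ennreal (gagliardo_kernel \<theta> p (z :: real ^ 'n)) \<partial>lborel") auto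
  define c where "c = ?n powr p + 2 * 2 powr p"
  have c: "c > 0" by (simp add: c_def add_nonneg_pos)
  have main: "gagliardo_integral \<theta> p UNIV g \<le> ennreal (c * (K + 1)) * (Lp_integral p g + (\<Sum>i\<in>UNIV. Lp_integral p (D i)))"
    if g: "integrable lborel g" and D: "\<And>i. integrable lborel (D i)"
      and weak: "\<And>\<xi> i. \<xi> \<in> test_functions UNIV \<Longrightarrow>
      (LINT x|lborel. g x * partial_deriv i \<xi> x) = - (LINT x|lborel. D i x * \<xi> x)"
    for g :: "real ^ 'n \<Rightarrow> real" and D
  proof -
    have [measurable]: "g \<in> borel_measurable borel" using borel_measurable_integrable[OF g] by simp
    let ?S = "Lp_integral p g + (\<Sum>i\<in>UNIV. Lp_integral p (D i))"
    have diff: "Lp_integral p (\<lambda>x. g (x + h) - g x) \<le> ennreal (min 1 (norm h) powr p) * (ennreal c * ?S)" for h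
    proof (cases "norm h \<le> 1")
      case True
      have "Lp_integral p (\<lambda>x. g (x + h) - g x) \<le>
        ennreal (?n powr p * norm h powr p) * (\<Sum>i\<in>UNIV. Lp_integral p (D i))"
        by (rule Lp_integral_difference_le[OF p g D weak])
      also have "\<dots> \<le> ennreal (norm h powr p * c) * ?S"
      proof (rule mult_mono)
        show "ennreal (?n powr p * norm h powr p) \<le> ennreal (norm h powr p * c)"
          by (intro ennreal_leI) (simp add: c_def mult.commute mult_left_mono)
        show "(\<Sum>i\<in>UNIV. Lp_integral p (D i)) \<le> ?S" by (rule add_increasing) auto
      qed auto
      finally show ?thesis using True c by (simp add: ennreal_mult mult.assoc)
    next
      case False
      have "Lp_integral p (\<lambda>x. g (x + h) + (- g x)) \<le>
          ennreal (2 powr p) * (Lp_integral p (\<lambda>x. g (x + h)) + Lp_integral p (\<lambda>x. - g x))"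
        using p by (intro Lp_integral_add) auto
      also have "Lp_integral p (\<lambda>x. g (x + h)) = Lp_integral p g"
        unfolding Lp_integral_def by (rule nn_integral_lborel_translate[of "\<lambda>x. ennreal (\<bar>g x\<bar> powr p)"]) simp
      also have "Lp_integral p (\<lambda>x. - g x) = Lp_integral p g" by (simp add: Lp_integral_def)
      also have "ennreal (2 powr p) * (Lp_integral p g + Lp_integral p g) = ennreal (2 * 2 powr p) * Lp_integral p g"
        by (simp add: ennreal_mult mult_2[symmetric] mult_ac)
      also have "\<dots> \<le> ennreal c * ?S"
        by (intro mult_mono ennreal_leI) (auto simp: c_def intro: add_increasing2)
      finally show ?thesis using False by simp
    qed
    have "gagliardo_integral \<theta> p UNIV g =
        (\<integral>\<^sup>+ x. \<integral>\<^sup>+ y. ennreal (\<bar>g x - g y\<bar> powr p / norm (x - y) powr ?a) \<partial>lborel \<partial>lborel)"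
      by (simp add: gagliardo_integral_def)
    also have "\<dots> = (\<integral>\<^sup>+ y. \<integral>\<^sup>+ x. ennreal (\<bar>g x - g y\<bar> powr p / norm (x - y) powr ?a) \<partial>lborel \<partial>lborel)"
      by (rule lborel_pair.Fubini') measurable
    also have "\<dots> = (\<integral>\<^sup>+ y. \<integral>\<^sup>+ h. ennreal (\<bar>g (h + y) - g y\<bar> powr p / norm h powr ?a) \<partial>lborel \<partial>lborel)"
    proof (rule nn_integral_cong)
      fix y
      show "(\<integral>\<^sup>+ x. ennreal (\<bar>g x - g y\<bar> powr p / norm (x - y) powr ?a) \<partial>lborel) =
        (\<integral>\<^sup>+ h. ennreal (\<bar>g (h + y) - g y\<bar> powr p / norm h powr ?a) \<partial>lborel)"
        using nn_integral_lborel_translate[of "\<lambda>x. ennreal (\<bar>g x - g y\<bar> powr p / norm (x - y) powr ?a)" y]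
        by simp
    qed
    also have "\<dots> = (\<integral>\<^sup>+ h. \<integral>\<^sup>+ y. ennreal (\<bar>g (h + y) - g y\<bar> powr p / norm h powr ?a) \<partial>lborel \<partial>lborel)"
      by (rule lborel_pair.Fubini') measurable
    also have "\<dots> \<le> (\<integral>\<^sup>+ h. ennreal (gagliardo_kernel \<theta> p (h :: real ^ 'n)) * (ennreal c * ?S) \<partial>lborel)"
    proof (rule nn_integral_mono)
      fix h :: "real ^ 'n"
      have "(\<integral>\<^sup>+ y. ennreal (\<bar>g (h + y) - g y\<bar> powr p / norm h powr ?a) \<partial>lborel) =
        (\<integral>\<^sup>+ y. ennreal (1 / norm h powr ?a) * ennreal (\<bar>g (y + h) - g y\<bar> powr p) \<partial>lborel)"
        by (simp add: ennreal_mult[symmetric] add.commute)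
      also have "\<dots> = ennreal (1 / norm h powr ?a) * Lp_integral p (\<lambda>y. g (y + h) - g y)"
        unfolding Lp_integral_def by (rule nn_integral_cmult) measurable
      also have "\<dots> \<le> ennreal (1 / norm h powr ?a) * (ennreal (min 1 (norm h) powr p) * (ennreal c * ?S))"
        by (intro mult_left_mono diff) simp
      also have "\<dots> = ennreal (gagliardo_kernel \<theta> p h) * (ennreal c * ?S)"
        by (simp add: gagliardo_kernel_def mult.assoc[symmetric] ennreal_mult[symmetric])
      finally show "(\<integral>\<^sup>+ y. ennreal (\<bar>g (h + y) - g y\<bar> powr p / norm h powr ?a) \<partial>lborel) \<le> \<dots>" .
    qed
    also have "\<dots> = ennreal K * (ennreal c * ?S)"
      by (subst nn_integral_multc) (auto simp: K(2))
    also have "\<dots> \<le> ennreal (c * (K + 1)) * ?S"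
      using c K(1) by (simp add: mult.assoc[symmetric] ennreal_mult[symmetric]) (intro mult_right_mono ennreal_leI, auto simp: algebra_simps)
    finally show ?thesis .
  qed
  show ?thesis by (rule that[of "c * (K + 1)"]) (use c K(1) main in \<open>auto intro!: mult_pos_pos add_nonneg_pos\<close>)
qed

section \<open>Multiplication by a test function on Sobolev spaces of nonnegative order\<close>

lemma finite_multi_order_le: "finite {\<nu> :: 'n::finite \<Rightarrow> nat. multi_order \<nu> \<le> k}"
proof (rule finite_subset)
  show "{\<nu> :: 'n \<Rightarrow> nat. multi_order \<nu> \<le> k} \<subseteq> Pi\<^sub>E UNIV (\<lambda>_. {..k})"
  proof
    fix \<nu> :: "'n \<Rightarrow> nat" assume "\<nu> \<in> {\<nu>. multi_order \<nu> \<le> k}"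
    then have "multi_order \<nu> \<le> k" by simp
    moreover have "\<nu> i \<le> multi_order \<nu>" for i by (rule member_le_sum) auto
    ultimately have "\<nu> i \<le> k" for i using order_trans by blast
    then show "\<nu> \<in> Pi\<^sub>E UNIV (\<lambda>_. {..k})" by (simp add: PiE_UNIV_domain)
  qed
qed (rule finite_PiE, auto)

lemma finite_multi_order_eq: "finite {\<nu> :: 'n::finite \<Rightarrow> nat. multi_order \<nu> = k}"
  by (rule finite_subset[OF _ finite_multi_order_le[of k]]) auto

lemma multi_order_Suc: "multi_order (\<mu>(i := Suc (\<mu> i))) = Suc (multi_order \<mu>)"
proof -
  have "multi_order (\<mu>(i := Suc (\<mu> i))) = Suc (\<mu> i) + sum (\<mu>(i := Suc (\<mu> i))) (UNIV - {i})"
    by (subst sum.remove[of _ i]) auto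
  also have "sum (\<mu>(i := Suc (\<mu> i))) (UNIV - {i}) = sum \<mu> (UNIV - {i})" by (intro sum.cong) auto
  also have "Suc (\<mu> i) + sum \<mu> (UNIV - {i}) = Suc (multi_order \<mu>)" by (subst (2) sum.remove[of _ i]) auto
  finally show ?thesis .
qed

lemma Lp_space_locally_integrable:
  assumes \<Omega>: "open \<Omega>" and u: "u \<in> Lp_space p \<Omega>" and p: "1 \<le> p"
  shows "locally_integrable_on \<Omega> u"
  unfolding locally_integrable_on_def set_integrable_def
proof (intro allI impI)
  fix K assume K: "compact K \<and> K \<subseteq> \<Omega>"
  have [measurable]: "K \<in> sets lebesgue" using K by (simp add: lmeasurable_compact fmeasurableD)
  have \<Omega>': "\<Omega> \<inter> space lebesgue \<in> sets lebesgue" using \<Omega> by simp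
  have um: "(\<lambda>x. indicator \<Omega> x *\<^sub>R u x) \<in> borel_measurable lebesgue"
    using u borel_measurable_restrict_space_iff[OF \<Omega>', of u] by (simp add: Lp_space_def)
  have "(\<lambda>x. indicator K x * (indicator \<Omega> x *\<^sub>R u x)) \<in> borel_measurable lebesgue"
    by (intro borel_measurable_times borel_measurable_indicator um) simp
  also have "(\<lambda>x. indicator K x * (indicator \<Omega> x *\<^sub>R u x)) = (\<lambda>x. indicator K x *\<^sub>R u x)"
    by (intro ext) (use K in \<open>auto simp: indicator_def\<close>)
  finally have m: "(\<lambda>x. indicator K x *\<^sub>R u x) \<in> borel_measurable lebesgue" .
  have "(\<integral>\<^sup>+ x. ennreal (norm (indicator K x *\<^sub>R u x)) \<partial>lebesgue) \<le>
    (\<integral>\<^sup>+ x. indicator K x + ennreal (\<bar>indicator \<Omega> x *\<^sub>R u x\<bar> powr p) \<partial>lebesgue)"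
  proof (rule nn_integral_mono)
    fix x
    have "\<bar>u x\<bar> \<le> 1 + \<bar>u x\<bar> powr p"
    proof (cases "\<bar>u x\<bar> \<le> 1")
      case False
      then show ?thesis using powr_mono[of 1 p "\<bar>u x\<bar>"] p by simp
    qed (simp add: add_increasing2)
    then have "ennreal \<bar>u x\<bar> \<le> 1 + ennreal (\<bar>u x\<bar> powr p)"
      by (metis ennreal_1 ennreal_leI ennreal_plus powr_ge_zero zero_le_one)
    then show "ennreal (norm (indicator K x *\<^sub>R u x)) \<le> indicator K x + ennreal (\<bar>indicator \<Omega> x *\<^sub>R u x\<bar> powr p)"
      using K by (auto simp: indicator_def)
  qed
  also have "\<dots> = emeasure lebesgue K + (\<integral>\<^sup>+ x. ennreal (\<bar>indicator \<Omega> x *\<^sub>R u x\<bar> powr p) \<partial>lebesgue)"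
    using um by (subst nn_integral_add) auto
  also have "\<dots> < \<infinity>"
  proof -
    have "(\<integral>\<^sup>+ x. ennreal (\<bar>indicator \<Omega> x *\<^sub>R u x\<bar> powr p) \<partial>lebesgue) =
      (\<integral>\<^sup>+ x. ennreal (\<bar>u x\<bar> powr p) * indicator \<Omega> x \<partial>lebesgue)"
      using p by (intro nn_integral_cong) (auto simp: indicator_def)
    also have "\<dots> = (\<integral>\<^sup>+ x. ennreal (\<bar>u x\<bar> powr p) \<partial>lebesgue_on \<Omega>)"
      by (rule nn_integral_restrict_space[OF \<Omega>', symmetric])
    also have "\<dots> < \<infinity>" using u unfolding Lp_space_def Lp_norm_def ennreal_root_finite by blast
    finally have "(\<integral>\<^sup>+ x. ennreal (\<bar>indicator \<Omega> x *\<^sub>R u x\<bar> powr p) \<partial>lebesgue) < \<infinity>" .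
    moreover have "emeasure lebesgue K < \<infinity>"
      using fmeasurableD2[OF lmeasurable_compact, of K] K by (simp add: less_top del: emeasure_completion)
    ultimately show ?thesis by (simp add: ennreal_add_less_top)
  qed
  finally show "integrable lebesgue (\<lambda>x. indicator K x *\<^sub>R u x)"
    using m by (simp add: integrable_iff_bounded)
qed

lemma integral_sum_list:
  fixes f :: "'i \<Rightarrow> 'a \<Rightarrow> real"
  assumes "\<And>j. j \<in> set J \<Longrightarrow> integrable M (f j)"
  shows "integrable M (\<lambda>x. \<Sum>j\<leftarrow>J. f j x)" "(LINT x|M. (\<Sum>j\<leftarrow>J. f j x)) = (\<Sum>j\<leftarrow>J. LINT x|M. f j x)"
proof -
  have "integrable M (\<lambda>x. \<Sum>j\<leftarrow>J. f j x) \<and> (LINT x|M. (\<Sum>j\<leftarrow>J. f j x)) = (\<Sum>j\<leftarrow>J. LINT x|M. f j x)"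
    using assms by (induction J) auto
  then show "integrable M (\<lambda>x. \<Sum>j\<leftarrow>J. f j x)" "(LINT x|M. (\<Sum>j\<leftarrow>J. f j x)) = (\<Sum>j\<leftarrow>J. LINT x|M. f j x)"
    by auto
qed

lemma locally_integrable_sum_list:
  assumes "\<And>j. j \<in> set J \<Longrightarrow> locally_integrable_on \<Omega> (f j)"
  shows "locally_integrable_on \<Omega> (\<lambda>x. \<Sum>j\<leftarrow>J. f j x)"
  using assms
proof (induction J)
  case Nil
  then show ?case by (simp add: locally_integrable_on_def set_integrable_def)
qed (auto intro: locally_integrable_add)

text \<open>
  The Leibniz rule in adjoint form is integrated against \<open>u\<close>; each derivative there acts on a single test
  function, so the definition of the weak derivatives applies.  The term of top order, with
  coefficient \<open>\<theta>\<close>, is singled out because only it involves the derivative of order \<open>\<nu>\<close>.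
\<close>

lemma weak_derivs_mult_test_function:
  fixes \<Omega> :: "(real ^ 'n::finite) set"
  assumes \<Omega>: "open \<Omega>" and \<theta>: "\<theta> \<in> test_functions \<Omega>"
  obtains J :: "((real ^ 'n \<Rightarrow> real) \<times> ('n \<Rightarrow> nat)) list" where
    "\<And>j. j \<in> set J \<Longrightarrow> fst j \<in> test_functions \<Omega> \<and> multi_order (snd j) < multi_order \<nu>"
    "\<And>u v. locally_integrable_on \<Omega> u \<Longrightarrow> (\<And>\<mu>. \<mu> \<in> insert \<nu> (snd ` set J) \<Longrightarrow> v \<mu> \<in> weak_derivs \<Omega> \<mu> u) \<Longrightarrow>
      (\<lambda>x. \<Sum>j\<leftarrow>(\<theta>, \<nu>) # J. fst j x * v (snd j) x) \<in> weak_derivs \<Omega> \<nu> (\<lambda>x. \<theta> x * u x)"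
proof -
  let ?L = "multi_list \<nu>"
  obtain J0 where J0: "\<And>\<theta>' B. (\<theta>', B) \<in> set J0 \<Longrightarrow> \<theta>' \<in> test_functions \<Omega> \<and> subseq B ?L \<and> length B < length ?L"
    and leibniz: "\<And>\<xi> x. smooth_on UNIV \<xi> \<Longrightarrow> \<theta> x * partials ?L \<xi> x =
       partials ?L (\<lambda>y. \<theta> y * \<xi> y) x + (\<Sum>(\<theta>', B)\<leftarrow>J0. partials B (\<lambda>y. \<theta>' y * \<xi> y) x)"
  proof (rule mult_partials[OF \<theta>, of ?L], goal_cases)
    case (1 J)
    show ?case by (rule 1(1)[OF 1(2) 1(3)])
  qed
  \<comment> \<open>the multi-index of a subsequence, and the sign that its integration by parts leaves\<close>
  define m where "m = (\<lambda>B :: 'n list. SOME \<mu>. B = multi_list \<mu>)"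
  define s where "s = (\<lambda>B :: 'n list. (- 1 :: real) ^ (multi_order \<nu> + length B))"
  have m: "B = multi_list (m B)" "length B = multi_order (m B)" if "(\<theta>', B) \<in> set J0" for \<theta>' B
  proof -
    have "\<exists>\<mu>. B = multi_list \<mu>" using subseq_multi_list[of B \<nu>] J0[OF that] by blast
    then show "B = multi_list (m B)" unfolding m_def by (rule someI_ex)
    then show "length B = multi_order (m B)" by (metis length_multi_list)
  qed
  define J where "J = map (\<lambda>(\<theta>', B). (\<lambda>x. s B * \<theta>' x, m B)) J0"
  show ?thesis
  proof (rule that[of J])
    show J: "fst j \<in> test_functions \<Omega> \<and> multi_order (snd j) < multi_order \<nu>" if j: "j \<in> set J" for j
    proof -
      obtain \<theta>' B where B: "(\<theta>', B) \<in> set J0" "j = (\<lambda>x. s B * \<theta>' x, m B)"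
        using j by (auto simp: J_def)
      then show ?thesis
        using J0[OF B(1)] m(2)[OF B(1)] by (auto simp: length_multi_list intro: test_functions_cmult)
    qed
    fix u and v :: "('n \<Rightarrow> nat) \<Rightarrow> real ^ 'n \<Rightarrow> real"
    assume u: "locally_integrable_on \<Omega> u"
      and v: "\<And>\<mu>. \<mu> \<in> insert \<nu> (snd ` set J) \<Longrightarrow> v \<mu> \<in> weak_derivs \<Omega> \<mu> u"
    let ?J = "(\<theta>, \<nu>) # J"
    let ?w = "\<lambda>x. \<Sum>j\<leftarrow>?J. fst j x * v (snd j) x"
    have lv: "locally_integrable_on \<Omega> (v \<mu>)" if "\<mu> \<in> insert \<nu> (snd ` set J)" for \<mu>
      using v[OF that] by (simp add: weak_derivs_def)
    have test: "fst j \<in> test_functions \<Omega>" if "j \<in> set ?J" for j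
      using that J[of j] \<theta> by auto
    have w: "locally_integrable_on \<Omega> ?w"
    proof (rule locally_integrable_sum_list)
      fix j assume j: "j \<in> set ?J"
      then show "locally_integrable_on \<Omega> (\<lambda>x. fst j x * v (snd j) x)"
        using test_functions_continuous_on[OF test[OF j]]
        by (intro locally_integrable_mult_smooth lv) auto
    qed
    have "(LINT x|lebesgue. \<theta> x * u x * partials ?L \<xi> x) =
      (- 1) ^ multi_order \<nu> * (LINT x|lebesgue. ?w x * \<xi> x)" if \<xi>: "\<xi> \<in> test_functions \<Omega>" for \<xi>
    proof -
      have sm: "smooth_on UNIV \<xi>" by (rule test_functionsD[OF \<xi>])
      have prod: "(\<lambda>y. f y * \<xi> y) \<in> test_functions \<Omega>" if "f \<in> test_functions \<Omega>" for f
        by (rule test_functions_mult[OF that sm])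
      have int: "integrable lebesgue (\<lambda>x. u x * partials B (\<lambda>y. f y * \<xi> y) x)" if "f \<in> test_functions \<Omega>" for f B
        by (rule locally_integrable_mult_test_function[OF u test_functions_partials[OF prod[OF that]]])
      have weak: "(LINT x|lebesgue. u x * partials (multi_list \<mu>) (\<lambda>y. f y * \<xi> y) x) =
          (- 1) ^ multi_order \<mu> * (LINT x|lebesgue. v \<mu> x * (f x * \<xi> x))"
        if "f \<in> test_functions \<Omega>" "\<mu> \<in> insert \<nu> (snd ` set J)" for f \<mu>
        using v[OF that(2)] prod[OF that(1)] unfolding weak_derivs_iff[OF \<Omega>] by blast
      have "(LINT x|lebesgue. \<theta> x * u x * partials ?L \<xi> x) =
          (LINT x|lebesgue. u x * partials ?L (\<lambda>y. \<theta> y * \<xi> y) x +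
            (\<Sum>j\<leftarrow>J0. u x * partials (snd j) (\<lambda>y. fst j y * \<xi> y) x))"
      proof (rule Bochner_Integration.integral_cong[OF refl])
        fix x
        have "\<theta> x * u x * partials ?L \<xi> x = u x * (\<theta> x * partials ?L \<xi> x)" by simp
        also have "\<dots> = u x * (partials ?L (\<lambda>y. \<theta> y * \<xi> y) x + (\<Sum>(\<theta>', B)\<leftarrow>J0. partials B (\<lambda>y. \<theta>' y * \<xi> y) x))"
          by (simp only: leibniz[OF sm])
        finally show "\<theta> x * u x * partials ?L \<xi> x = u x * partials ?L (\<lambda>y. \<theta> y * \<xi> y) x +
            (\<Sum>j\<leftarrow>J0. u x * partials (snd j) (\<lambda>y. fst j y * \<xi> y) x)"
          by (simp add: distrib_left sum_list_const_mult case_prod_unfold)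
      qed
      also have "\<dots> = (LINT x|lebesgue. u x * partials ?L (\<lambda>y. \<theta> y * \<xi> y) x) +
          (\<Sum>j\<leftarrow>J0. LINT x|lebesgue. u x * partials (snd j) (\<lambda>y. fst j y * \<xi> y) x)"
      proof -
        have "integrable lebesgue (\<lambda>x. u x * partials (snd j) (\<lambda>y. fst j y * \<xi> y) x)" if "j \<in> set J0" for j
          using J0[of "fst j" "snd j"] that by (intro int) auto
        note sl = integral_sum_list[of J0 lebesgue "\<lambda>j x. u x * partials (snd j) (\<lambda>y. fst j y * \<xi> y) x", OF this]
        show ?thesis using int[OF \<theta>, of ?L] sl by simp
      qed
      also have "(\<Sum>j\<leftarrow>J0. LINT x|lebesgue. u x * partials (snd j) (\<lambda>y. fst j y * \<xi> y) x) =
          (\<Sum>j\<leftarrow>J0. (- 1) ^ multi_order \<nu> * (LINT x|lebesgue. (s (snd j) * fst j x) * v (m (snd j)) x * \<xi> x))"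
      proof (rule arg_cong[of _ _ sum_list], rule map_cong[OF refl])
        fix j assume j: "j \<in> set J0"
        obtain \<theta>' B where jB: "j = (\<theta>', B)" by (cases j)
        have B: "(\<theta>', B) \<in> set J0" using j jB by simp
        have "m B \<in> snd ` set J" using B by (force simp: J_def)
        then have "(LINT x|lebesgue. u x * partials (multi_list (m B)) (\<lambda>y. \<theta>' y * \<xi> y) x) =
            (- 1) ^ multi_order (m B) * (LINT x|lebesgue. v (m B) x * (\<theta>' x * \<xi> x))"
          using J0[OF B] by (intro weak) auto
        then have "(LINT x|lebesgue. u x * partials B (\<lambda>y. \<theta>' y * \<xi> y) x) =
            (- 1) ^ length B * (LINT x|lebesgue. v (m B) x * (\<theta>' x * \<xi> x))"
          using m[OF B] by metis
        also have "(- 1 :: real) ^ length B = (- 1) ^ multi_order \<nu> * s B"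
          by (simp add: s_def power_add power_mult_distrib[symmetric] mult.assoc[symmetric])
        also have "(- 1) ^ multi_order \<nu> * s B * (LINT x|lebesgue. v (m B) x * (\<theta>' x * \<xi> x)) =
            (- 1) ^ multi_order \<nu> * (LINT x|lebesgue. s B * (v (m B) x * (\<theta>' x * \<xi> x)))"
          by simp
        finally show "(LINT x|lebesgue. u x * partials (snd j) (\<lambda>y. fst j y * \<xi> y) x) =
          (- 1) ^ multi_order \<nu> * (LINT x|lebesgue. (s (snd j) * fst j x) * v (m (snd j)) x * \<xi> x)"
          by (simp add: jB mult_ac)
      qed
      also have "\<dots> = (\<Sum>j\<leftarrow>J. (- 1) ^ multi_order \<nu> * (LINT x|lebesgue. fst j x * v (snd j) x * \<xi> x))"
        by (simp add: J_def case_prod_unfold comp_def)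
      also have "(LINT x|lebesgue. u x * partials ?L (\<lambda>y. \<theta> y * \<xi> y) x) =
          (- 1) ^ multi_order \<nu> * (LINT x|lebesgue. \<theta> x * v \<nu> x * \<xi> x)"
        using weak[OF \<theta>, of \<nu>] by (simp add: mult_ac)
      also have "(- 1) ^ multi_order \<nu> * (LINT x|lebesgue. \<theta> x * v \<nu> x * \<xi> x) +
          (\<Sum>j\<leftarrow>J. (- 1) ^ multi_order \<nu> * (LINT x|lebesgue. fst j x * v (snd j) x * \<xi> x)) =
          (- 1) ^ multi_order \<nu> * (\<Sum>j\<leftarrow>?J. LINT x|lebesgue. fst j x * v (snd j) x * \<xi> x)"
        by (simp add: distrib_left sum_list_const_mult)
      also have "(\<Sum>j\<leftarrow>?J. LINT x|lebesgue. fst j x * v (snd j) x * \<xi> x) =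
          (LINT x|lebesgue. (\<Sum>j\<leftarrow>?J. fst j x * v (snd j) x * \<xi> x))"
      proof (rule integral_sum_list(2)[symmetric])
        fix j assume j: "j \<in> set ?J"
        have "integrable lebesgue (\<lambda>x. v (snd j) x * (fst j x * \<xi> x))"
          by (rule locally_integrable_mult_test_function[OF lv prod[OF test[OF j]]]) (use j in auto)
        then show "integrable lebesgue (\<lambda>x. fst j x * v (snd j) x * \<xi> x)" by (simp add: mult_ac)
      qed
      also have "\<dots> = (LINT x|lebesgue. ?w x * \<xi> x)" by (simp only: sum_list_mult_const)
      finally show ?thesis .
    qed
    then show "?w \<in> weak_derivs \<Omega> \<nu> (\<lambda>x. \<theta> x * u x)"
      using w unfolding weak_derivs_iff[OF \<Omega>] by blast
  qed
qed

definition weak_derivs_family ::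
  "(real ^ 'n::finite) set \<Rightarrow> nat \<Rightarrow> (real ^ 'n \<Rightarrow> real) \<Rightarrow> (('n \<Rightarrow> nat) \<Rightarrow> real ^ 'n \<Rightarrow> real) \<Rightarrow> bool" where
  "weak_derivs_family \<Omega> k u v \<longleftrightarrow> locally_integrable_on \<Omega> u \<and>
     (\<forall>\<mu>. multi_order \<mu> \<le> k \<longrightarrow> v \<mu> \<in> weak_derivs \<Omega> \<mu> u \<and> borel_supported \<Omega> (v \<mu>))"

definition Lp_total :: "nat \<Rightarrow> real \<Rightarrow> (('n::finite \<Rightarrow> nat) \<Rightarrow> real ^ 'n \<Rightarrow> real) \<Rightarrow> ennreal" where
  "Lp_total k p v = (\<Sum>\<mu> | multi_order \<mu> \<le> k. Lp_integral p (v \<mu>))"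

definition gagliardo_total ::
  "nat \<Rightarrow> real \<Rightarrow> real \<Rightarrow> (real ^ 'n::finite) set \<Rightarrow> (('n \<Rightarrow> nat) \<Rightarrow> real ^ 'n \<Rightarrow> real) \<Rightarrow> ennreal" where
  "gagliardo_total k \<theta> p \<Omega> v = (\<Sum>\<mu> | multi_order \<mu> = k. gagliardo_integral \<theta> p \<Omega> (v \<mu>))"

lemma Lp_integral_le_total: "multi_order \<mu> \<le> k \<Longrightarrow> Lp_integral p (v \<mu>) \<le> Lp_total k p v"
  unfolding Lp_total_def
  by (rule member_le_sum[of \<mu> _ "\<lambda>\<mu>. Lp_integral p (v \<mu>)"]) (auto simp: finite_multi_order_le)

lemma gagliardo_integral_le_total:
  "multi_order \<mu> = k \<Longrightarrow> gagliardo_integral \<theta> p \<Omega> (v \<mu>) \<le> gagliardo_total k \<theta> p \<Omega> v"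
  unfolding gagliardo_total_def
  by (rule member_le_sum[of \<mu> _ "\<lambda>\<mu>. gagliardo_integral \<theta> p \<Omega> (v \<mu>)"]) (auto simp: finite_multi_order_eq)

lemma weak_derivs_family_measurable:
  "weak_derivs_family \<Omega> k u v \<Longrightarrow> multi_order \<mu> \<le> k \<Longrightarrow> v \<mu> \<in> borel_measurable borel"
  by (auto simp: weak_derivs_family_def borel_supported_def)

lemma test_function_measurable:
  "f \<in> test_functions \<Omega> \<Longrightarrow> (f :: 'a::euclidean_space \<Rightarrow> real) \<in> borel_measurable borel"
  using test_functions_continuous_on[of f \<Omega> UNIV] by (auto intro: borel_measurable_continuous_onI)

lemma Lp_integral_mult_test_function:
  assumes "f \<in> test_functions \<Omega>" "0 < p"
  obtains C where "C > 0" "\<And>v. v \<in> borel_measurable borel \<Longrightarrow>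
    Lp_integral p (\<lambda>x. f x * v x) \<le> ennreal C * Lp_integral p v"
proof -
  obtain M where M: "M \<ge> 0" "\<And>x. \<bar>f x\<bar> \<le> M" using test_functions_bounded[OF assms(1)] by auto
  have "\<bar>f x\<bar> \<le> M + 1" for x using M(2)[of x] by simp
  then show ?thesis
    using that[of "(M + 1) powr p"] Lp_integral_mult_bounded[of _ f "M + 1" p] M assms(2) by simp
qed

text \<open>
  The product rule for first derivatives, on the whole space: for any \<open>\<xi>\<close> the function \<open>f \<xi>\<close> is a test
  function of \<open>\<Omega>\<close>, so only the behaviour of \<open>v \<mu>\<close> on \<open>\<Omega>\<close> matters.
\<close>

lemma weak_derivative_mult_test_function:
  fixes f :: "real ^ 'n::finite \<Rightarrow> real"
  assumes \<Omega>: "open \<Omega>" and f: "f \<in> test_functions \<Omega>" and fam: "weak_derivs_family \<Omega> k u v"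
    and \<mu>: "multi_order \<mu> < k" and \<xi>: "\<xi> \<in> test_functions UNIV"
  shows "(LINT x|lborel. f x * v \<mu> x * partial_deriv i \<xi> x) =
    - (LINT x|lborel. (partial_deriv i f x * v \<mu> x + f x * v (\<mu>(i := Suc (\<mu> i))) x) * \<xi> x)"
proof -
  let ?\<mu>' = "\<mu>(i := Suc (\<mu> i))"
  have \<mu>': "multi_order ?\<mu>' = Suc (multi_order \<mu>)" by (rule multi_order_Suc)
  have weak: "v \<mu> \<in> weak_derivs \<Omega> \<mu> u" "v ?\<mu>' \<in> weak_derivs \<Omega> ?\<mu>' u"
    using fam \<mu> \<mu>' by (auto simp: weak_derivs_family_def)
  have meas: "v \<mu> \<in> borel_measurable borel" "v ?\<mu>' \<in> borel_measurable borel"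
    using weak_derivs_family_measurable[OF fam] \<mu> \<mu>' by auto
  have loc: "locally_integrable_on \<Omega> (v \<mu>)" "locally_integrable_on \<Omega> (v ?\<mu>')"
    using weak by (auto simp: weak_derivs_def)
  define \<eta> where "\<eta> = (\<lambda>x. f x * \<xi> x)"
  have sf: "smooth_on UNIV f" and s\<xi>: "smooth_on UNIV \<xi>" using f \<xi> by (auto simp: test_functions_def)
  have \<eta>: "\<eta> \<in> test_functions \<Omega>" unfolding \<eta>_def by (rule test_functions_mult[OF f s\<xi>])
  have fi: "partial_deriv i f \<in> test_functions \<Omega>" and \<xi>i: "partial_deriv i \<xi> \<in> test_functions UNIV"
    using test_functions_partial_deriv f \<xi> by auto
  have dprod: "partial_deriv i \<eta> x = partial_deriv i f x * \<xi> x + f x * partial_deriv i \<xi> x" for x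
    unfolding \<eta>_def
    by (rule partial_deriv_mult[OF smooth_on_differentiable[OF sf] smooth_on_differentiable[OF s\<xi>]]) auto
  have "(- 1) ^ multi_order \<mu> * (LINT x|lebesgue. v \<mu> x * partial_deriv i \<eta> x) =
      (LINT x|lebesgue. u x * partials (multi_list \<mu>) (partial_deriv i \<eta>) x)"
    using weak(1) test_functions_partial_deriv[OF \<eta>, of i] unfolding weak_derivs_iff[OF \<Omega>] by simp
  also have "\<dots> = (LINT x|lebesgue. u x * partials (multi_list ?\<mu>') \<eta> x)"
    using multi_deriv_partial_deriv[OF test_functionsD(1)[OF \<eta>], of \<mu> i]
    by (simp only: multi_deriv_eq_partials)
  also have "\<dots> = (- 1) ^ Suc (multi_order \<mu>) * (LINT x|lebesgue. v ?\<mu>' x * \<eta> x)"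
    using weak(2) \<eta> unfolding weak_derivs_iff[OF \<Omega>] \<mu>' by blast
  finally have "(- 1) ^ multi_order \<mu> * (LINT x|lebesgue. v \<mu> x * partial_deriv i \<eta> x) =
      (- 1) ^ multi_order \<mu> * (- (LINT x|lebesgue. v ?\<mu>' x * \<eta> x))" by simp
  moreover have "(- 1 :: real) ^ multi_order \<mu> \<noteq> 0" by simp
  ultimately have main: "(LINT x|lebesgue. v \<mu> x * partial_deriv i \<eta> x) = - (LINT x|lebesgue. v ?\<mu>' x * \<eta> x)"
    using mult_left_cancel by blast
  have i1: "integrable lebesgue (\<lambda>x. v \<mu> x * (partial_deriv i f x * \<xi> x))"
    by (rule locally_integrable_mult_test_function[OF loc(1) test_functions_mult[OF fi s\<xi>]])
  have i2: "integrable lebesgue (\<lambda>x. v \<mu> x * (f x * partial_deriv i \<xi> x))"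
    by (rule locally_integrable_mult_test_function[OF loc(1) test_functions_mult[OF f test_functionsD(1)[OF \<xi>i]]])
  have i3: "integrable lebesgue (\<lambda>x. v ?\<mu>' x * (f x * \<xi> x))"
    by (rule locally_integrable_mult_test_function[OF loc(2) test_functions_mult[OF f s\<xi>]])
  have "(LINT x|lebesgue. v \<mu> x * partial_deriv i \<eta> x) =
      (LINT x|lebesgue. v \<mu> x * (partial_deriv i f x * \<xi> x)) + (LINT x|lebesgue. v \<mu> x * (f x * partial_deriv i \<xi> x))"
    unfolding dprod distrib_left by (rule Bochner_Integration.integral_add[OF i1 i2])
  moreover have "(LINT x|lebesgue. (partial_deriv i f x * v \<mu> x + f x * v ?\<mu>' x) * \<xi> x) =
      (LINT x|lebesgue. v \<mu> x * (partial_deriv i f x * \<xi> x)) + (LINT x|lebesgue. v ?\<mu>' x * (f x * \<xi> x))"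
    by (subst Bochner_Integration.integral_add[OF i1 i3, symmetric]) (simp add: algebra_simps)
  ultimately have "(LINT x|lebesgue. v \<mu> x * (f x * partial_deriv i \<xi> x)) =
    - (LINT x|lebesgue. (partial_deriv i f x * v \<mu> x + f x * v ?\<mu>' x) * \<xi> x)"
    using main by (simp add: \<eta>_def)
  moreover note m = test_function_measurable[OF f] test_function_measurable[OF \<xi>]
    test_function_measurable[OF fi] test_function_measurable[OF \<xi>i] meas
  have "(LINT x|lebesgue. v \<mu> x * (f x * partial_deriv i \<xi> x)) = (LINT x|lborel. f x * v \<mu> x * partial_deriv i \<xi> x)"
    by (subst integral_completion) (use m in \<open>auto simp: mult_ac\<close>)
  moreover have "(LINT x|lebesgue. (partial_deriv i f x * v \<mu> x + f x * v ?\<mu>' x) * \<xi> x) =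
    (LINT x|lborel. (partial_deriv i f x * v \<mu> x + f x * v ?\<mu>' x) * \<xi> x)"
    by (rule integral_completion) (use m in auto)
  ultimately show ?thesis by simp
qed

lemma integrable_lborel_mult_test_function:
  assumes f: "f \<in> test_functions \<Omega>" and v: "locally_integrable_on \<Omega> v" "v \<in> borel_measurable borel"
  shows "integrable lborel (\<lambda>x. f x * v x)"
proof -
  have "integrable lebesgue (\<lambda>x. f x * v x)"
    using locally_integrable_mult_test_function[OF v(1) f] by (simp add: mult.commute)
  then show ?thesis
    using v(2) test_function_measurable[OF f] by (subst (asm) integrable_completion) auto
qed

text \<open>
  Below the top order, a derivative times a test function lies in \<open>W\<^sup>1\<^sup>,\<^sup>p\<close> of the whole space after
  extension by zero, which the compact support makes possible.
\<close>

lemma gagliardo_integral_lower_order: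
  fixes \<Omega> :: "(real ^ 'n::finite) set"
  assumes \<Omega>: "open \<Omega>" and f: "f \<in> test_functions \<Omega>" and \<theta>: "0 < \<theta>" "\<theta> < 1" and p: "1 < p"
    and \<mu>: "multi_order \<mu> < k"
  obtains C where "C > 0" "\<And>u v. weak_derivs_family \<Omega> k u v \<Longrightarrow>
    gagliardo_integral \<theta> p \<Omega> (\<lambda>x. f x * v \<mu> x) \<le> ennreal C * Lp_total k p v"
proof -
  obtain C where C: "C > 0" "\<And>(g :: real ^ 'n \<Rightarrow> real) D.
    integrable lborel g \<Longrightarrow> (\<And>i. integrable lborel (D i)) \<Longrightarrow>
    (\<And>\<xi> i. \<xi> \<in> test_functions UNIV \<Longrightarrow>
      (LINT x|lborel. g x * partial_deriv i \<xi> x) = - (LINT x|lborel. D i x * \<xi> x)) \<Longrightarrow>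
    gagliardo_integral \<theta> p UNIV g \<le> ennreal C * (Lp_integral p g + (\<Sum>i\<in>UNIV. Lp_integral p (D i)))"
  proof (rule gagliardo_integral_le_weak_derivative[OF \<theta> p, where 'n = 'n], goal_cases)
    case (1 C)
    show ?case by (rule 1(1)[OF 1(2) 1(3)])
  qed
  obtain c where c: "c > 0" "\<And>v. v \<in> borel_measurable borel \<Longrightarrow>
    Lp_integral p (\<lambda>x. f x * v x) \<le> ennreal c * Lp_integral p v"
    using Lp_integral_mult_test_function[OF f, of p] p by auto
  have fi: "partial_deriv i f \<in> test_functions \<Omega>" for i by (rule test_functions_partial_deriv[OF f])
  have "\<forall>i. \<exists>c>0. \<forall>v. v \<in> borel_measurable borel \<longrightarrow>
    Lp_integral p (\<lambda>x. partial_deriv i f x * v x) \<le> ennreal c * Lp_integral p v"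
  proof
    fix i
    obtain c where "c > 0" "\<And>v. v \<in> borel_measurable borel \<Longrightarrow>
      Lp_integral p (\<lambda>x. partial_deriv i f x * v x) \<le> ennreal c * Lp_integral p v"
      using Lp_integral_mult_test_function[OF fi, of p i] p by auto
    then show "\<exists>c>0. \<forall>v. v \<in> borel_measurable borel \<longrightarrow>
      Lp_integral p (\<lambda>x. partial_deriv i f x * v x) \<le> ennreal c * Lp_integral p v" by auto
  qed
  then obtain d where d: "\<And>i. d i > 0" "\<And>i v. v \<in> borel_measurable borel \<Longrightarrow>
    Lp_integral p (\<lambda>x. partial_deriv i f x * v x) \<le> ennreal (d i) * Lp_integral p v"
    by metis
  define e where "e = (\<lambda>i. 2 powr p * (d i + c))"
  have e: "e i > 0" for i using d(1)[of i] c(1) by (simp add: e_def)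
  have main: "gagliardo_integral \<theta> p \<Omega> (\<lambda>x. f x * v \<mu> x) \<le> ennreal (C * (c + (\<Sum>i\<in>UNIV. e i))) * Lp_total k p v"
    if fam: "weak_derivs_family \<Omega> k u v" for u v
  proof -
    let ?T = "Lp_total k p v"
    let ?\<mu>' = "\<lambda>i. \<mu>(i := Suc (\<mu> i))"
    let ?D = "\<lambda>i x. partial_deriv i f x * v \<mu> x + f x * v (?\<mu>' i) x"
    have ord1: "multi_order \<mu> \<le> k" using \<mu> by simp
    have ord2: "multi_order (?\<mu>' i) \<le> k" for i unfolding multi_order_Suc using \<mu> by simp
    note ord = ord1 ord2
    have meas: "v \<mu> \<in> borel_measurable borel" "v (?\<mu>' i) \<in> borel_measurable borel" for i
      using weak_derivs_family_measurable[OF fam] ord by auto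
    have loc: "locally_integrable_on \<Omega> (v \<mu>)" "locally_integrable_on \<Omega> (v (?\<mu>' i))" for i
      using fam ord by (auto simp: weak_derivs_family_def weak_derivs_def)
    have fv: "Lp_integral p (\<lambda>x. f x * v \<mu> x) \<le> ennreal c * ?T"
      by (rule order_trans[OF c(2)[OF meas(1)]]) (intro mult_left_mono Lp_integral_le_total ord, simp)
    have D: "Lp_integral p (?D i) \<le> ennreal (e i) * ?T" for i
    proof -
      have "Lp_integral p (?D i) \<le> ennreal (2 powr p) *
          (Lp_integral p (\<lambda>x. partial_deriv i f x * v \<mu> x) + Lp_integral p (\<lambda>x. f x * v (?\<mu>' i) x))"
        using meas test_function_measurable[OF f] test_function_measurable[OF fi] p
        by (intro Lp_integral_add borel_measurable_times) auto
      also have "\<dots> \<le> ennreal (2 powr p) * (ennreal (d i) * ?T + ennreal c * ?T)"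
      proof (intro mult_left_mono add_mono)
        show "Lp_integral p (\<lambda>x. partial_deriv i f x * v \<mu> x) \<le> ennreal (d i) * ?T"
          by (rule order_trans[OF d(2)[OF meas(1)]]) (intro mult_left_mono Lp_integral_le_total ord, simp)
        show "Lp_integral p (\<lambda>x. f x * v (?\<mu>' i) x) \<le> ennreal c * ?T"
          by (rule order_trans[OF c(2)[OF meas(2)]]) (intro mult_left_mono Lp_integral_le_total ord, simp)
      qed simp
      also have "\<dots> = ennreal (e i) * ?T"
        using c(1) d(1)[of i] by (simp add: e_def ennreal_mult ennreal_plus distrib_right mult.assoc)
      finally show ?thesis .
    qed
    have "gagliardo_integral \<theta> p \<Omega> (\<lambda>x. f x * v \<mu> x) \<le> gagliardo_integral \<theta> p UNIV (\<lambda>x. f x * v \<mu> x)"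
      by (rule gagliardo_integral_mono_domain) simp
    also have "\<dots> \<le> ennreal C * (Lp_integral p (\<lambda>x. f x * v \<mu> x) + (\<Sum>i\<in>UNIV. Lp_integral p (?D i)))"
    proof (rule C(2))
      show "integrable lborel (\<lambda>x. f x * v \<mu> x)" by (rule integrable_lborel_mult_test_function[OF f loc(1) meas(1)])
      show "integrable lborel (?D i)" for i
        by (intro Bochner_Integration.integrable_add integrable_lborel_mult_test_function[OF f loc(2) meas(2)]
            integrable_lborel_mult_test_function[OF fi loc(1) meas(1)])
    qed (rule weak_derivative_mult_test_function[OF \<Omega> f fam \<mu>])
    also have "\<dots> \<le> ennreal C * (ennreal c * ?T + (\<Sum>i\<in>UNIV. ennreal (e i) * ?T))"
      by (intro mult_left_mono add_mono sum_mono fv D) simp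
    also have "(\<Sum>i\<in>UNIV. ennreal (e i) * ?T) = ennreal (\<Sum>i\<in>UNIV. e i) * ?T"
      using e by (simp add: sum_distrib_right[symmetric] sum_ennreal less_imp_le)
    also have "ennreal c * ?T + ennreal (\<Sum>i\<in>UNIV. e i) * ?T = ennreal (c + (\<Sum>i\<in>UNIV. e i)) * ?T"
      using c(1) e by (simp add: ennreal_plus distrib_right sum_nonneg less_imp_le)
    also have "ennreal C * (ennreal (c + (\<Sum>i\<in>UNIV. e i)) * ?T) = ennreal (C * (c + (\<Sum>i\<in>UNIV. e i))) * ?T"
      using C(1) c(1) e by (simp add: ennreal_mult mult.assoc sum_nonneg less_imp_le)
    finally show ?thesis .
  qed
  have "(\<Sum>i\<in>UNIV. e i) \<ge> 0" using e by (simp add: sum_nonneg less_imp_le)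
  then have "C * (c + (\<Sum>i\<in>UNIV. e i)) > 0" using C(1) c(1) by (intro mult_pos_pos add_pos_nonneg)
  then show ?thesis using main by (rule that)
qed

text \<open>
  The constants are quantified before \<open>v\<close>, since they have to be independent of the function that is
  multiplied.
\<close>

lemma sum_list_bound:
  fixes \<Phi> :: "('a \<Rightarrow> real) \<Rightarrow> ennreal" and F :: "'j \<Rightarrow> 'v \<Rightarrow> 'a \<Rightarrow> real"
  assumes add: "\<And>f g. f \<in> B \<Longrightarrow> g \<in> B \<Longrightarrow>
      (\<lambda>x. f x + g x) \<in> B \<and> \<Phi> (\<lambda>x. f x + g x) \<le> ennreal c * (\<Phi> f + \<Phi> g)"
    and c: "0 < c" and zero: "(\<lambda>_. 0) \<in> B" "\<Phi> (\<lambda>_. 0) = 0"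
    and each: "\<And>j. j \<in> set J \<Longrightarrow> \<exists>C>0. \<forall>v\<in>V. F j v \<in> B \<and> \<Phi> (F j v) \<le> ennreal C * A v"
  shows "\<exists>C>0. \<forall>v\<in>V. (\<lambda>x. \<Sum>j\<leftarrow>J. F j v x) \<in> B \<and> \<Phi> (\<lambda>x. \<Sum>j\<leftarrow>J. F j v x) \<le> ennreal C * A v"
  using each
proof (induction J)
  case Nil
  then show ?case using zero by (auto intro!: exI[of _ 1])
next
  case (Cons j J)
  from Cons obtain C where C: "C > 0" "\<forall>v\<in>V. (\<lambda>x. \<Sum>j\<leftarrow>J. F j v x) \<in> B \<and> \<Phi> (\<lambda>x. \<Sum>j\<leftarrow>J. F j v x) \<le> ennreal C * A v"
    by auto
  from Cons.prems[of j] obtain D where D: "D > 0" "\<forall>v\<in>V. F j v \<in> B \<and> \<Phi> (F j v) \<le> ennreal D * A v"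
    by auto
  have "(\<lambda>x. F j v x + (\<Sum>j\<leftarrow>J. F j v x)) \<in> B \<and>
      \<Phi> (\<lambda>x. F j v x + (\<Sum>j\<leftarrow>J. F j v x)) \<le> ennreal (c * (D + C)) * A v" if v: "v \<in> V" for v
  proof -
    have "\<Phi> (\<lambda>x. F j v x + (\<Sum>j\<leftarrow>J. F j v x)) \<le> ennreal c * (\<Phi> (F j v) + \<Phi> (\<lambda>x. \<Sum>j\<leftarrow>J. F j v x))"
      using add C(2) D(2) v by blast
    also have "\<dots> \<le> ennreal c * (ennreal D * A v + ennreal C * A v)"
      using C(2) D(2) v by (intro mult_left_mono add_mono) auto
    also have "\<dots> = ennreal (c * (D + C)) * A v"
      using c C(1) D(1) by (simp add: ennreal_mult ennreal_plus distrib_right mult.assoc)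
    finally show ?thesis using add C(2) D(2) v by blast
  qed
  then show ?case using c C(1) D(1) by (intro exI[of _ "c * (D + C)"]) simp
qed

text \<open>
  In the Leibniz sum the term \<open>\<theta> v \<nu>\<close> needs the Gagliardo integral of \<open>v \<nu>\<close> itself, which is available
  exactly when \<open>\<nu>\<close> has order \<open>k\<close>; the other terms have order below \<open>k\<close> and need only \<open>L\<^sup>p\<close> bounds.
\<close>

lemma weak_deriv_product_bound:
  fixes \<Omega> :: "(real ^ 'n::finite) set"
  assumes \<Omega>: "open \<Omega>" and \<theta>: "\<theta> \<in> test_functions \<Omega>" and p: "1 < p" and \<nu>: "multi_order \<nu> \<le> k"
  shows "\<exists>C>0. \<forall>u v. weak_derivs_family \<Omega> k u v \<longrightarrow>
    (\<exists>w\<in>weak_derivs \<Omega> \<nu> (\<lambda>x. \<theta> x * u x). borel_supported \<Omega> w \<and>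
       Lp_integral p w \<le> ennreal C * Lp_total k p v \<and>
       (0 < \<sigma> \<and> \<sigma> < 1 \<and> multi_order \<nu> = k \<longrightarrow>
         gagliardo_integral \<sigma> p \<Omega> w \<le> ennreal C * (Lp_total k p v + gagliardo_total k \<sigma> p \<Omega> v)))"
proof -
  obtain J0 :: "((real ^ 'n \<Rightarrow> real) \<times> ('n \<Rightarrow> nat)) list" where
    J0: "\<And>j. j \<in> set J0 \<Longrightarrow> fst j \<in> test_functions \<Omega> \<and> multi_order (snd j) < multi_order \<nu>"
    and leibniz: "\<And>u v. locally_integrable_on \<Omega> u \<Longrightarrow> (\<And>\<mu>. \<mu> \<in> insert \<nu> (snd ` set J0) \<Longrightarrow> v \<mu> \<in> weak_derivs \<Omega> \<mu> u) \<Longrightarrow>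
      (\<lambda>x. \<Sum>j\<leftarrow>(\<theta>, \<nu>) # J0. fst j x * v (snd j) x) \<in> weak_derivs \<Omega> \<nu> (\<lambda>x. \<theta> x * u x)"
  proof (rule weak_derivs_mult_test_function[OF \<Omega> \<theta>, of \<nu>], goal_cases)
    case (1 J)
    show ?case by (rule 1(1)[OF 1(2) 1(3)])
  qed
  define J where "J = (\<theta>, \<nu>) # J0"
  have J: "fst j \<in> test_functions \<Omega>" "multi_order (snd j) \<le> k" "snd j \<noteq> \<nu> \<Longrightarrow> multi_order (snd j) < multi_order \<nu>"
    if "j \<in> set J" for j
    using that J0[of j] \<theta> \<nu> by (auto simp: J_def)
  define B where "B = {w. borel_supported \<Omega> w}"
  define V where "V = {v. \<exists>u. weak_derivs_family \<Omega> k u v}"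
  define F where "F = (\<lambda>(j :: (real ^ 'n \<Rightarrow> real) \<times> ('n \<Rightarrow> nat)) (v :: ('n \<Rightarrow> nat) \<Rightarrow> real ^ 'n \<Rightarrow> real) x. fst j x * v (snd j) x)"
  have FB: "F j v \<in> B" if "j \<in> set J" "v \<in> V" for j v
  proof -
    have "borel_supported \<Omega> (v (snd j))" using that(2) J(2)[OF that(1)] unfolding V_def weak_derivs_family_def by blast
    then show ?thesis
      using test_function_measurable[OF J(1)[OF that(1)]]
      by (auto simp: B_def borel_supported_def F_def intro: borel_measurable_times)
  qed
  have Bm: "w \<in> borel_measurable borel" if "w \<in> B" for w using that by (simp add: B_def borel_supported_def)
  have Badd: "(\<lambda>x. f x + g x) \<in> B" if "f \<in> B" "g \<in> B" for f g
    using that by (auto simp: B_def borel_supported_def intro: borel_measurable_add)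
  have zero: "(\<lambda>_. 0) \<in> B" by (simp add: B_def borel_supported_def)
  have vm: "v (snd j) \<in> borel_measurable borel" if "j \<in> set J" "v \<in> V" for j v
    using that(2) weak_derivs_family_measurable[OF _ J(2)[OF that(1)]] unfolding V_def by blast
  have Lp: "\<exists>C>0. \<forall>v\<in>V. (\<lambda>x. \<Sum>j\<leftarrow>J. F j v x) \<in> B \<and> Lp_integral p (\<lambda>x. \<Sum>j\<leftarrow>J. F j v x) \<le> ennreal C * Lp_total k p v"
  proof (rule sum_list_bound[where c = "2 powr p"])
    show "(\<lambda>x. f x + g x) \<in> B \<and> Lp_integral p (\<lambda>x. f x + g x) \<le> ennreal (2 powr p) * (Lp_integral p f + Lp_integral p g)"
      if "f \<in> B" "g \<in> B" for f g
      using that Badd Bm p by (auto intro: Lp_integral_add)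
    show "Lp_integral p (\<lambda>_. 0) = 0" by (simp add: Lp_integral_def)
    fix j assume j: "j \<in> set J"
    obtain C where C: "C > 0" "\<And>v. v \<in> borel_measurable borel \<Longrightarrow>
      Lp_integral p (\<lambda>x. fst j x * v x) \<le> ennreal C * Lp_integral p v"
      using Lp_integral_mult_test_function[OF J(1)[OF j], of p] p by auto
    have "Lp_integral p (F j v) \<le> ennreal C * Lp_total k p v" if v: "v \<in> V" for v
      unfolding F_def
      by (rule order_trans[OF C(2)[OF vm[OF j v]]]) (intro mult_left_mono Lp_integral_le_total J(2)[OF j], simp)
    then show "\<exists>C>0. \<forall>v\<in>V. F j v \<in> B \<and> Lp_integral p (F j v) \<le> ennreal C * Lp_total k p v"
      using C(1) FB[OF j] by blast
  qed (use zero in auto)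
  have Gag: "\<exists>C>0. \<forall>v\<in>V. (\<lambda>x. \<Sum>j\<leftarrow>J. F j v x) \<in> B \<and>
     gagliardo_integral \<sigma> p \<Omega> (\<lambda>x. \<Sum>j\<leftarrow>J. F j v x) \<le> ennreal C * (Lp_total k p v + gagliardo_total k \<sigma> p \<Omega> v)"
    if \<sigma>: "0 < \<sigma>" "\<sigma> < 1" and top: "multi_order \<nu> = k"
  proof (rule sum_list_bound[where c = "2 powr p"])
    show "(\<lambda>x. f x + g x) \<in> B \<and> gagliardo_integral \<sigma> p \<Omega> (\<lambda>x. f x + g x) \<le>
        ennreal (2 powr p) * (gagliardo_integral \<sigma> p \<Omega> f + gagliardo_integral \<sigma> p \<Omega> g)"
      if "f \<in> B" "g \<in> B" for f g
      using that Badd Bm p by (auto intro: gagliardo_integral_add[OF \<Omega>])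
    show "gagliardo_integral \<sigma> p \<Omega> (\<lambda>_. 0) = 0" by (simp add: gagliardo_integral_def)
    fix j assume j: "j \<in> set J"
    show "\<exists>C>0. \<forall>v\<in>V. F j v \<in> B \<and> gagliardo_integral \<sigma> p \<Omega> (F j v) \<le> ennreal C * (Lp_total k p v + gagliardo_total k \<sigma> p \<Omega> v)"
    proof (cases "snd j = \<nu>")
      case True
      obtain C where C: "C > 0" "\<And>v. v \<in> borel_measurable borel \<Longrightarrow>
        gagliardo_integral \<sigma> p \<Omega> (\<lambda>x. fst j x * v x) \<le> ennreal C * (gagliardo_integral \<sigma> p \<Omega> v + Lp_integral p v)"
        using gagliardo_integral_mult_test_function[OF \<Omega> J(1)[OF j] \<sigma>, of p] p by auto
      have "gagliardo_integral \<sigma> p \<Omega> (F j v) \<le> ennreal C * (Lp_total k p v + gagliardo_total k \<sigma> p \<Omega> v)"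
        if v: "v \<in> V" for v
      proof -
        have "gagliardo_integral \<sigma> p \<Omega> (F j v) \<le>
          ennreal C * (gagliardo_integral \<sigma> p \<Omega> (v (snd j)) + Lp_integral p (v (snd j)))"
          unfolding F_def by (rule C(2)[OF vm[OF j v]])
        also have "\<dots> \<le> ennreal C * (gagliardo_total k \<sigma> p \<Omega> v + Lp_total k p v)"
          using True top by (intro mult_left_mono add_mono gagliardo_integral_le_total Lp_integral_le_total) auto
        finally show ?thesis by (simp add: add.commute)
      qed
      then show ?thesis using C(1) FB[OF j] by blast
    next
      case False
      have "multi_order (snd j) < k" using J(3)[OF j False] top by simp
      then obtain C where C: "C > 0" "\<And>u v. weak_derivs_family \<Omega> k u v \<Longrightarrow>
        gagliardo_integral \<sigma> p \<Omega> (\<lambda>x. fst j x * v (snd j) x) \<le> ennreal C * Lp_total k p v"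
        using gagliardo_integral_lower_order[OF \<Omega> J(1)[OF j] \<sigma> p, of "snd j" k] by metis
      have "gagliardo_integral \<sigma> p \<Omega> (F j v) \<le> ennreal C * (Lp_total k p v + gagliardo_total k \<sigma> p \<Omega> v)"
        if v: "v \<in> V" for v
      proof -
        obtain u where "weak_derivs_family \<Omega> k u v" using v by (auto simp: V_def)
        from C(2)[OF this] show ?thesis
          unfolding F_def by (rule order_trans) (intro mult_left_mono, auto)
      qed
      then show ?thesis using C(1) FB[OF j] by blast
    qed
  qed (use zero in auto)
  obtain C1 where C1: "C1 > 0" "\<forall>v\<in>V. (\<lambda>x. \<Sum>j\<leftarrow>J. F j v x) \<in> B \<and>
     Lp_integral p (\<lambda>x. \<Sum>j\<leftarrow>J. F j v x) \<le> ennreal C1 * Lp_total k p v" using Lp by blast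
  obtain C2 where C2: "C2 > 0" "0 < \<sigma> \<and> \<sigma> < 1 \<and> multi_order \<nu> = k \<longrightarrow> (\<forall>v\<in>V.
     gagliardo_integral \<sigma> p \<Omega> (\<lambda>x. \<Sum>j\<leftarrow>J. F j v x) \<le> ennreal C2 * (Lp_total k p v + gagliardo_total k \<sigma> p \<Omega> v))"
  proof (cases "0 < \<sigma> \<and> \<sigma> < 1 \<and> multi_order \<nu> = k")
    case True
    then show ?thesis using Gag by (auto intro: that)
  next
    case False
    then show ?thesis by (intro that[OF zero_less_one]) blast
  qed
  show ?thesis
  proof (intro exI[of _ "C1 + C2"] conjI allI impI)
    show "C1 + C2 > 0" using C1 C2 by simp
    fix u v assume fam: "weak_derivs_family \<Omega> k u v"
    then have v: "v \<in> V" by (auto simp: V_def)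
    let ?w = "\<lambda>x. \<Sum>j\<leftarrow>J. F j v x"
    have le: "ennreal C1 * a \<le> ennreal (C1 + C2) * a" "ennreal C2 * a \<le> ennreal (C1 + C2) * a" for a
      using C1(1) C2(1) by (auto intro!: mult_right_mono ennreal_leI)
    show "\<exists>w\<in>weak_derivs \<Omega> \<nu> (\<lambda>x. \<theta> x * u x). borel_supported \<Omega> w \<and>
       Lp_integral p w \<le> ennreal (C1 + C2) * Lp_total k p v \<and>
       (0 < \<sigma> \<and> \<sigma> < 1 \<and> multi_order \<nu> = k \<longrightarrow>
         gagliardo_integral \<sigma> p \<Omega> w \<le> ennreal (C1 + C2) * (Lp_total k p v + gagliardo_total k \<sigma> p \<Omega> v))"
    proof (intro bexI[of _ ?w] conjI impI)
      show "borel_supported \<Omega> ?w" using C1(2) v by (auto simp: B_def)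
      show "Lp_integral p ?w \<le> ennreal (C1 + C2) * Lp_total k p v"
        using C1(2) v le(1) order_trans by blast
      show "gagliardo_integral \<sigma> p \<Omega> ?w \<le> ennreal (C1 + C2) * (Lp_total k p v + gagliardo_total k \<sigma> p \<Omega> v)"
        if "0 < \<sigma> \<and> \<sigma> < 1 \<and> multi_order \<nu> = k"
        using C2(2) that v le(2) order_trans by blast
      show "?w \<in> weak_derivs \<Omega> \<nu> (\<lambda>x. \<theta> x * u x)"
        unfolding F_def J_def
      proof (rule leibniz)
        show "locally_integrable_on \<Omega> u" using fam by (simp add: weak_derivs_family_def)
        fix \<mu> assume "\<mu> \<in> insert \<nu> (snd ` set J0)"
        then have "multi_order \<mu> \<le> k" using J0 \<nu> by force
        then show "v \<mu> \<in> weak_derivs \<Omega> \<mu> u" using fam by (simp add: weak_derivs_family_def)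
      qed
    qed
  qed
qed

lemma INF_constant:
  fixes f :: "'a \<Rightarrow> ennreal"
  assumes "v \<in> S" "\<And>w. w \<in> S \<Longrightarrow> f w = f v"
  shows "(INF w\<in>S. f w) = f v"
proof (rule antisym)
  show "(INF w\<in>S. f w) \<le> f v" by (rule INF_lower[OF assms(1)])
  show "f v \<le> (INF w\<in>S. f w)" by (rule INF_greatest) (simp add: assms(2))
qed

lemma weak_derivs_Lp_norm:
  assumes \<Omega>: "open \<Omega>" and v: "v \<in> weak_derivs \<Omega> \<nu> u" "borel_supported \<Omega> v"
  shows "(INF w\<in>weak_derivs \<Omega> \<nu> u. Lp_norm p \<Omega> w) = ennreal_root p (Lp_integral p v)"
  unfolding Lp_norm_eq_root_Lp_integral[OF \<Omega> v(2), symmetric]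
  by (rule INF_constant[OF v(1)], rule Lp_norm_cong_AE[OF \<Omega>], rule weak_derivs_unique[OF \<Omega> _ v(1)])

lemma weak_derivs_gagliardo_seminorm:
  assumes \<Omega>: "open \<Omega>" and v: "v \<in> weak_derivs \<Omega> \<nu> u" "borel_supported \<Omega> v"
  shows "(INF w\<in>weak_derivs \<Omega> \<nu> u. gagliardo_seminorm \<sigma> p \<Omega> w) = ennreal_root p (gagliardo_integral \<sigma> p \<Omega> v)"
proof -
  have m: "v \<in> borel_measurable borel" using v(2) by (simp add: borel_supported_def)
  show ?thesis
    unfolding gagliardo_seminorm_eq_root[OF \<Omega> m, symmetric]
    by (rule INF_constant[OF v(1)], rule gagliardo_seminorm_cong_AE[OF \<Omega>], rule weak_derivs_unique[OF \<Omega> _ v(1)])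
qed

text \<open>
  Weak derivatives are unique almost everywhere, so each infimum is attained at the given family.
\<close>

lemma sobolev_norm_fun_family:
  fixes \<Omega> :: "(real ^ 'n::finite) set"
  assumes \<Omega>: "open \<Omega>" and fam: "weak_derivs_family \<Omega> (nat \<lfloor>s\<rfloor>) u v"
  shows "sobolev_norm_fun s p \<Omega> u =
     (\<Sum>\<nu> | multi_order \<nu> \<le> nat \<lfloor>s\<rfloor>. ennreal_root p (Lp_integral p (v \<nu>))) +
     (if s \<in> \<int> then 0
      else \<Sum>\<nu> | multi_order \<nu> = nat \<lfloor>s\<rfloor>. ennreal_root p (gagliardo_integral (frac s) p \<Omega> (v \<nu>)))"
proof -
  have v: "v \<nu> \<in> weak_derivs \<Omega> \<nu> u" "borel_supported \<Omega> (v \<nu>)" if "multi_order \<nu> \<le> nat \<lfloor>s\<rfloor>" for \<nu>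
    using fam that by (auto simp: weak_derivs_family_def)
  have "(\<Sum>\<nu> | multi_order \<nu> \<le> nat \<lfloor>s\<rfloor>. INF w\<in>weak_derivs \<Omega> \<nu> u. Lp_norm p \<Omega> w) =
      (\<Sum>\<nu> | multi_order \<nu> \<le> nat \<lfloor>s\<rfloor>. ennreal_root p (Lp_integral p (v \<nu>)))"
    by (intro sum.cong refl weak_derivs_Lp_norm[OF \<Omega>] v) auto
  moreover have "(\<Sum>\<nu> | multi_order \<nu> = nat \<lfloor>s\<rfloor>. INF w\<in>weak_derivs \<Omega> \<nu> u. gagliardo_seminorm (frac s) p \<Omega> w) =
      (\<Sum>\<nu> | multi_order \<nu> = nat \<lfloor>s\<rfloor>. ennreal_root p (gagliardo_integral (frac s) p \<Omega> (v \<nu>)))"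
    by (intro sum.cong refl weak_derivs_gagliardo_seminorm[OF \<Omega>] v) auto
  ultimately show ?thesis by (simp add: sobolev_norm_fun_def)
qed

lemma sobolev_norm_fun_finite_family:
  fixes \<Omega> :: "(real ^ 'n::finite) set"
  assumes \<Omega>: "open \<Omega>" and p: "1 \<le> p" and u: "u \<in> Lp_space p \<Omega>" and fin: "sobolev_norm_fun s p \<Omega> u < \<infinity>"
  obtains v where "weak_derivs_family \<Omega> (nat \<lfloor>s\<rfloor>) u v"
proof -
  have "\<exists>w. w \<in> weak_derivs \<Omega> \<mu> u \<and> borel_supported \<Omega> w" if \<mu>: "multi_order \<mu> \<le> nat \<lfloor>s\<rfloor>" for \<mu>
  proof -
    have "(INF w\<in>weak_derivs \<Omega> \<mu> u. Lp_norm p \<Omega> w) \<le>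
        (\<Sum>\<nu> | multi_order \<nu> \<le> nat \<lfloor>s\<rfloor>. INF w\<in>weak_derivs \<Omega> \<nu> u. Lp_norm p \<Omega> w)"
      by (rule member_le_sum[of \<mu> _ "\<lambda>\<nu>. INF w\<in>weak_derivs \<Omega> \<nu> u. Lp_norm p \<Omega> w"])
        (use \<mu> in \<open>auto simp: finite_multi_order_le\<close>)
    also have "\<dots> \<le> sobolev_norm_fun s p \<Omega> u" unfolding sobolev_norm_fun_def by (rule add_increasing2) auto
    also have "\<dots> < top" using fin by simp
    finally have "weak_derivs \<Omega> \<mu> u \<noteq> {}" by (auto simp: less_top[symmetric])
    then obtain w where "w \<in> weak_derivs \<Omega> \<mu> u" by blast
    then show ?thesis by (rule weak_derivs_borel_representative[OF \<Omega>]) (intro exI conjI)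
  qed
  then have "\<forall>\<mu>\<in>{\<mu>. multi_order \<mu> \<le> nat \<lfloor>s\<rfloor>}. \<exists>w. w \<in> weak_derivs \<Omega> \<mu> u \<and> borel_supported \<Omega> w"
    by blast
  from bchoice[OF this] obtain v
    where "\<forall>\<mu>\<in>{\<mu>. multi_order \<mu> \<le> nat \<lfloor>s\<rfloor>}. v \<mu> \<in> weak_derivs \<Omega> \<mu> u \<and> borel_supported \<Omega> (v \<mu>)"
    by (elim exE)
  then have "weak_derivs_family \<Omega> (nat \<lfloor>s\<rfloor>) u v"
    using Lp_space_locally_integrable[OF \<Omega> u p] by (auto simp: weak_derivs_family_def)
  then show ?thesis by (rule that)
qed

lemma Lp_space_mult_test_function:
  assumes \<Omega>: "open \<Omega>" and f: "f \<in> test_functions \<Omega>'" and u: "u \<in> Lp_space p \<Omega>" and p: "0 < p"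
  shows "(\<lambda>x. f x * u x) \<in> Lp_space p \<Omega>"
proof -
  obtain M where M: "M \<ge> 0" "\<And>x. \<bar>f x\<bar> \<le> M" using test_functions_bounded[OF f] by auto
  have um: "u \<in> borel_measurable (lebesgue_on \<Omega>)" using u by (simp add: Lp_space_def)
  have fm: "f \<in> borel_measurable (lebesgue_on \<Omega>)"
    by (intro measurable_restrict_space1 lebesgue_measurable_continuous test_functions_continuous_on[OF f])
  have "(\<integral>\<^sup>+ x. ennreal (\<bar>f x * u x\<bar> powr p) \<partial>lebesgue_on \<Omega>) \<le>
      (\<integral>\<^sup>+ x. ennreal (M powr p) * ennreal (\<bar>u x\<bar> powr p) \<partial>lebesgue_on \<Omega>)"
    using M p by (intro nn_integral_mono)
      (auto simp: ennreal_mult[symmetric] abs_mult powr_mult intro!: ennreal_leI mult_right_mono powr_mono2)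
  also have "\<dots> = ennreal (M powr p) * (\<integral>\<^sup>+ x. ennreal (\<bar>u x\<bar> powr p) \<partial>lebesgue_on \<Omega>)"
    using um by (intro nn_integral_cmult) simp
  also have "\<dots> < \<infinity>"
  proof -
    have "(\<integral>\<^sup>+ x. ennreal (\<bar>u x\<bar> powr p) \<partial>lebesgue_on \<Omega>) < \<infinity>"
      using u unfolding Lp_space_def Lp_norm_def ennreal_root_finite by blast
    then show ?thesis by (simp add: ennreal_mult_less_top)
  qed
  finally have "(\<integral>\<^sup>+ x. ennreal (\<bar>f x * u x\<bar> powr p) \<partial>lebesgue_on \<Omega>) < \<infinity>" .
  then have "Lp_norm p \<Omega> (\<lambda>x. f x * u x) < \<infinity>" unfolding Lp_norm_def ennreal_root_finite .
  moreover have "(\<lambda>x. f x * u x) \<in> borel_measurable (lebesgue_on \<Omega>)"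
    by (rule borel_measurable_times[OF fm um])
  ultimately show ?thesis by (simp add: Lp_space_def)
qed

text \<open>
  A function of infinite norm needs no estimate; one of finite norm has a family of weak derivatives, to
  which the bounds for the single derivatives of the product apply.  Subadditivity of the \<open>p\<close>-th root
  turns these bounds for \<open>p\<close>-th powers into one for the norm.
\<close>

theorem sobolev_norm_fun_mult_test_function:
  fixes \<Omega> :: "(real ^ 'n::finite) set"
  assumes \<Omega>: "open \<Omega>" and \<theta>: "\<theta> \<in> test_functions \<Omega>" and p: "1 < p"
  obtains C where "C > 0" "\<And>u. u \<in> Lp_space p \<Omega> \<Longrightarrow>
    sobolev_norm_fun s p \<Omega> (\<lambda>x. \<theta> x * u x) \<le> ennreal C * sobolev_norm_fun s p \<Omega> u"
proof -
  let ?k = "nat \<lfloor>s\<rfloor>"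
  let ?\<sigma> = "frac s"
  define I where "I = {\<nu> :: 'n \<Rightarrow> nat. multi_order \<nu> \<le> ?k}"
  define I' where "I' = {\<nu> :: 'n \<Rightarrow> nat. multi_order \<nu> = ?k}"
  have fin: "finite I" "finite I'" by (simp_all add: I_def I'_def finite_multi_order_le finite_multi_order_eq)
  have sub: "I' \<subseteq> I" by (auto simp: I_def I'_def)
  have \<sigma>: "0 < ?\<sigma> \<and> ?\<sigma> < 1" if "s \<notin> \<int>" using that by (simp add: frac_lt_1 frac_gt_0_iff)
  have "\<forall>\<nu>\<in>I. \<exists>C>0. \<forall>u v. weak_derivs_family \<Omega> ?k u v \<longrightarrow>
    (\<exists>w\<in>weak_derivs \<Omega> \<nu> (\<lambda>x. \<theta> x * u x). borel_supported \<Omega> w \<and>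
       Lp_integral p w \<le> ennreal C * Lp_total ?k p v \<and>
       (0 < ?\<sigma> \<and> ?\<sigma> < 1 \<and> multi_order \<nu> = ?k \<longrightarrow>
         gagliardo_integral ?\<sigma> p \<Omega> w \<le> ennreal C * (Lp_total ?k p v + gagliardo_total ?k ?\<sigma> p \<Omega> v)))"
    (is "\<forall>\<nu>\<in>I. ?Q \<nu>")
  proof
    fix \<nu> assume "\<nu> \<in> I"
    then have "multi_order \<nu> \<le> ?k" by (simp add: I_def)
    then show "?Q \<nu>" by (rule weak_deriv_product_bound[OF \<Omega> \<theta> p])
  qed
  from bchoice[OF this] obtain c where cb: "\<forall>\<nu>\<in>I. c \<nu> > 0 \<and> (\<forall>u v. weak_derivs_family \<Omega> ?k u v \<longrightarrow>
    (\<exists>w\<in>weak_derivs \<Omega> \<nu> (\<lambda>x. \<theta> x * u x). borel_supported \<Omega> w \<and>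
       Lp_integral p w \<le> ennreal (c \<nu>) * Lp_total ?k p v \<and>
       (0 < ?\<sigma> \<and> ?\<sigma> < 1 \<and> multi_order \<nu> = ?k \<longrightarrow>
         gagliardo_integral ?\<sigma> p \<Omega> w \<le> ennreal (c \<nu>) * (Lp_total ?k p v + gagliardo_total ?k ?\<sigma> p \<Omega> v))))"
    by (elim exE)
  have c: "c \<nu> > 0" if "\<nu> \<in> I" for \<nu> using bspec[OF cb that] by (rule conjunct1)
  define d where "d = (\<lambda>\<nu>. c \<nu> powr (1 / p))"
  have d: "d \<nu> \<ge> 0" for \<nu> by (simp add: d_def)
  let ?C = "1 + (\<Sum>\<nu>\<in>I. d \<nu>) + (\<Sum>\<nu>\<in>I'. d \<nu>)"
  have C: "?C > 0" using d by (intro add_pos_nonneg) (auto simp: sum_nonneg)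
  have main: "sobolev_norm_fun s p \<Omega> (\<lambda>x. \<theta> x * u x) \<le> ennreal ?C * sobolev_norm_fun s p \<Omega> u"
    if u: "u \<in> Lp_space p \<Omega>" for u
  proof (cases "sobolev_norm_fun s p \<Omega> u < \<infinity>")
    case False
    then have "sobolev_norm_fun s p \<Omega> u = top" by (simp add: less_top[symmetric])
    then show ?thesis using C by (simp add: ennreal_mult_top)
  next
    case True
    let ?N = "sobolev_norm_fun s p \<Omega> u"
    obtain v where fam: "weak_derivs_family \<Omega> ?k u v"
      by (rule sobolev_norm_fun_finite_family[OF \<Omega> less_imp_le[OF p] u True])
    note N = sobolev_norm_fun_family[OF \<Omega> fam, of p, folded I_def I'_def]
    have "\<forall>\<nu>\<in>I. \<exists>w. w \<in> weak_derivs \<Omega> \<nu> (\<lambda>x. \<theta> x * u x) \<and> borel_supported \<Omega> w \<and>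
       Lp_integral p w \<le> ennreal (c \<nu>) * Lp_total ?k p v \<and>
       (0 < ?\<sigma> \<and> ?\<sigma> < 1 \<and> multi_order \<nu> = ?k \<longrightarrow>
         gagliardo_integral ?\<sigma> p \<Omega> w \<le> ennreal (c \<nu>) * (Lp_total ?k p v + gagliardo_total ?k ?\<sigma> p \<Omega> v))"
      using cb fam unfolding Bex_def by simp
    from bchoice[OF this] obtain w where w0: "\<forall>\<nu>\<in>I. w \<nu> \<in> weak_derivs \<Omega> \<nu> (\<lambda>x. \<theta> x * u x) \<and> borel_supported \<Omega> (w \<nu>) \<and>
       Lp_integral p (w \<nu>) \<le> ennreal (c \<nu>) * Lp_total ?k p v \<and>
       (0 < ?\<sigma> \<and> ?\<sigma> < 1 \<and> multi_order \<nu> = ?k \<longrightarrow>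
         gagliardo_integral ?\<sigma> p \<Omega> (w \<nu>) \<le> ennreal (c \<nu>) * (Lp_total ?k p v + gagliardo_total ?k ?\<sigma> p \<Omega> v))"
      by (elim exE)
    have w: "w \<nu> \<in> weak_derivs \<Omega> \<nu> (\<lambda>x. \<theta> x * u x)" "borel_supported \<Omega> (w \<nu>)"
        "Lp_integral p (w \<nu>) \<le> ennreal (c \<nu>) * Lp_total ?k p v"
        "0 < ?\<sigma> \<and> ?\<sigma> < 1 \<and> multi_order \<nu> = ?k \<Longrightarrow>
         gagliardo_integral ?\<sigma> p \<Omega> (w \<nu>) \<le> ennreal (c \<nu>) * (Lp_total ?k p v + gagliardo_total ?k ?\<sigma> p \<Omega> v)"
      if "\<nu> \<in> I" for \<nu>
      using bspec[OF w0 that] by (elim conjE; simp)+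
    have "locally_integrable_on \<Omega> (\<lambda>x. \<theta> x * u x)"
      by (rule Lp_space_locally_integrable[OF \<Omega> Lp_space_mult_test_function[OF \<Omega> \<theta> u]]) (use p in auto)
    then have fam': "weak_derivs_family \<Omega> ?k (\<lambda>x. \<theta> x * u x) w"
      using w(1,2) by (simp add: weak_derivs_family_def I_def)
    note N' = sobolev_norm_fun_family[OF \<Omega> fam', of p, folded I_def I'_def]
    have Lp_root: "ennreal_root p (Lp_total ?k p v) \<le> (\<Sum>\<nu>\<in>I. ennreal_root p (Lp_integral p (v \<nu>)))"
      unfolding Lp_total_def I_def[symmetric] using p by (intro ennreal_root_sum) simp
    have Lp: "ennreal_root p (Lp_integral p (w \<nu>)) \<le> ennreal (d \<nu>) * ?N" if \<nu>: "\<nu> \<in> I" for \<nu>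
    proof -
      have "ennreal_root p (Lp_integral p (w \<nu>)) \<le> ennreal_root p (ennreal (c \<nu>) * Lp_total ?k p v)"
        using p by (intro ennreal_root_mono w \<nu>) simp
      also have "\<dots> = ennreal (d \<nu>) * ennreal_root p (Lp_total ?k p v)"
        unfolding d_def using p c[OF \<nu>] by (intro ennreal_root_cmult) auto
      also have "\<dots> \<le> ennreal (d \<nu>) * ?N"
        by (intro mult_left_mono order_trans[OF Lp_root]) (auto simp: N)
      finally show ?thesis .
    qed
    have Gag: "ennreal_root p (gagliardo_integral ?\<sigma> p \<Omega> (w \<nu>)) \<le> ennreal (d \<nu>) * ?N"
      if s: "s \<notin> \<int>" and \<nu>: "\<nu> \<in> I'" for \<nu>
    proof -
      have \<nu>I: "\<nu> \<in> I" using \<nu> sub by blast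
      have root: "ennreal_root p (Lp_total ?k p v + gagliardo_total ?k ?\<sigma> p \<Omega> v) \<le> ?N"
      proof -
        have "ennreal_root p (Lp_total ?k p v + gagliardo_total ?k ?\<sigma> p \<Omega> v) \<le>
            ennreal_root p (Lp_total ?k p v) + ennreal_root p (gagliardo_total ?k ?\<sigma> p \<Omega> v)"
          using p by (intro ennreal_root_add) simp
        also have "\<dots> \<le> (\<Sum>\<nu>\<in>I. ennreal_root p (Lp_integral p (v \<nu>))) +
            (\<Sum>\<nu>\<in>I'. ennreal_root p (gagliardo_integral ?\<sigma> p \<Omega> (v \<nu>)))"
          unfolding gagliardo_total_def I'_def[symmetric]
          using p by (intro add_mono Lp_root ennreal_root_sum) simp
        finally show ?thesis using s by (simp add: N)
      qed
      have "ennreal_root p (gagliardo_integral ?\<sigma> p \<Omega> (w \<nu>)) \<le>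
          ennreal_root p (ennreal (c \<nu>) * (Lp_total ?k p v + gagliardo_total ?k ?\<sigma> p \<Omega> v))"
        using p \<sigma>[OF s] \<nu> by (intro ennreal_root_mono w(4) \<nu>I) (auto simp: I'_def)
      also have "\<dots> = ennreal (d \<nu>) * ennreal_root p (Lp_total ?k p v + gagliardo_total ?k ?\<sigma> p \<Omega> v)"
        unfolding d_def using p c[OF \<nu>I] by (intro ennreal_root_cmult) auto
      also have "\<dots> \<le> ennreal (d \<nu>) * ?N" by (intro mult_left_mono root) simp
      finally show ?thesis .
    qed
    have "sobolev_norm_fun s p \<Omega> (\<lambda>x. \<theta> x * u x) \<le>
      (\<Sum>\<nu>\<in>I. ennreal (d \<nu>) * ?N) + (\<Sum>\<nu>\<in>I'. ennreal (d \<nu>) * ?N)"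
      unfolding N'
    proof (rule add_mono)
      show "(\<Sum>\<nu>\<in>I. ennreal_root p (Lp_integral p (w \<nu>))) \<le> (\<Sum>\<nu>\<in>I. ennreal (d \<nu>) * ?N)"
        by (intro sum_mono Lp)
      show "(if s \<in> \<int> then 0 else \<Sum>\<nu>\<in>I'. ennreal_root p (gagliardo_integral ?\<sigma> p \<Omega> (w \<nu>))) \<le>
          (\<Sum>\<nu>\<in>I'. ennreal (d \<nu>) * ?N)"
        using Gag by (auto intro: sum_mono)
    qed
    also have "\<dots> = ennreal ((\<Sum>\<nu>\<in>I. d \<nu>) + (\<Sum>\<nu>\<in>I'. d \<nu>)) * ?N"
      using d by (simp add: sum_distrib_right[symmetric] sum_ennreal ennreal_plus sum_nonneg distrib_right)
    also have "\<dots> \<le> ennreal ?C * ?N" by (intro mult_right_mono ennreal_leI) auto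
    finally show ?thesis .
  qed
  show ?thesis by (rule that[OF C main])
qed

lemma weak_derivs_cmult:
  assumes "v \<in> weak_derivs \<Omega> \<nu> u"
  shows "(\<lambda>x. c * v x) \<in> weak_derivs \<Omega> \<nu> (\<lambda>x. c * u x)"
  using assms locally_integrable_mult_smooth[of \<Omega> v "\<lambda>_. c"]
  by (simp add: weak_derivs_def mult.assoc)

lemma ennreal_root_Lp_integral_cmult:
  assumes "1 \<le> p" "0 < c" "v \<in> borel_measurable borel"
  shows "ennreal_root p (Lp_integral p (\<lambda>x. c * v x)) = ennreal c * ennreal_root p (Lp_integral p v)"
proof -
  have "Lp_integral p (\<lambda>x. c * v x) = (\<integral>\<^sup>+ x. ennreal (c powr p) * ennreal (\<bar>v x\<bar> powr p) \<partial>lborel)"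
    unfolding Lp_integral_def using assms by (simp add: abs_mult powr_mult ennreal_mult)
  also have "\<dots> = ennreal (c powr p) * Lp_integral p v"
    unfolding Lp_integral_def using assms by (intro nn_integral_cmult) simp
  finally show ?thesis using assms by (simp add: ennreal_root_cmult powr_powr)
qed

lemma ennreal_root_gagliardo_integral_cmult:
  fixes \<Omega> :: "(real ^ 'n::finite) set"
  assumes "1 \<le> p" "0 < c" "v \<in> borel_measurable borel" "open \<Omega>"
  shows "ennreal_root p (gagliardo_integral \<sigma> p \<Omega> (\<lambda>x. c * v x)) = ennreal c * ennreal_root p (gagliardo_integral \<sigma> p \<Omega> v)"
proof -
  have [measurable]: "\<Omega> \<in> sets borel" "v \<in> borel_measurable borel" using assms by auto
  let ?F = "\<lambda>x y. ennreal (indicator \<Omega> x * indicator \<Omega> y *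
     (\<bar>v x - v y\<bar> powr p / norm (x - y) powr (real CARD('n) + \<sigma> * p)))"
  have "\<bar>c * v x - c * v y\<bar> powr p = c powr p * \<bar>v x - v y\<bar> powr p" for x y
    using assms by (simp add: right_diff_distrib[symmetric] abs_mult powr_mult)
  then have "gagliardo_integral \<sigma> p \<Omega> (\<lambda>x. c * v x) = (\<integral>\<^sup>+ x. \<integral>\<^sup>+ y. ennreal (c powr p) * ?F x y \<partial>lborel \<partial>lborel)"
    unfolding gagliardo_integral_def by (simp add: ennreal_mult[symmetric] mult_ac)
  also have "\<dots> = ennreal (c powr p) * gagliardo_integral \<sigma> p \<Omega> v"
    unfolding gagliardo_integral_def by (simp add: nn_integral_cmult)
  finally show ?thesis using assms by (simp add: ennreal_root_cmult powr_powr)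
qed

lemma sobolev_norm_fun_cmult:
  fixes \<Omega> :: "(real ^ 'n::finite) set"
  assumes \<Omega>: "open \<Omega>" and p: "1 \<le> p" and c: "0 < c" and u: "u \<in> Lp_space p \<Omega>"
  shows "sobolev_norm_fun s p \<Omega> (\<lambda>x. c * u x) \<le> ennreal c * sobolev_norm_fun s p \<Omega> u"
proof (cases "sobolev_norm_fun s p \<Omega> u < \<infinity>")
  case False
  then have "sobolev_norm_fun s p \<Omega> u = top" by (simp add: less_top[symmetric])
  then show ?thesis using c by (simp add: ennreal_mult_top)
next
  case True
  obtain v where fam: "weak_derivs_family \<Omega> (nat \<lfloor>s\<rfloor>) u v"
    by (rule sobolev_norm_fun_finite_family[OF \<Omega> p u True])
  have fam': "weak_derivs_family \<Omega> (nat \<lfloor>s\<rfloor>) (\<lambda>x. c * u x) (\<lambda>\<mu> x. c * v \<mu> x)"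
    using fam locally_integrable_mult_smooth[of \<Omega> u "\<lambda>_. c"]
    by (auto simp: weak_derivs_family_def borel_supported_def intro: weak_derivs_cmult)
  have m: "v \<nu> \<in> borel_measurable borel" if "multi_order \<nu> \<le> nat \<lfloor>s\<rfloor>" for \<nu>
    by (rule weak_derivs_family_measurable[OF fam that])
  have "(\<Sum>\<nu> | multi_order \<nu> \<le> nat \<lfloor>s\<rfloor>. ennreal_root p (Lp_integral p (\<lambda>x. c * v \<nu> x))) =
      (\<Sum>\<nu> | multi_order \<nu> \<le> nat \<lfloor>s\<rfloor>. ennreal c * ennreal_root p (Lp_integral p (v \<nu>)))"
    by (intro sum.cong refl ennreal_root_Lp_integral_cmult p c m) simp
  moreover have "(\<Sum>\<nu> | multi_order \<nu> = nat \<lfloor>s\<rfloor>. ennreal_root p (gagliardo_integral (frac s) p \<Omega> (\<lambda>x. c * v \<nu> x))) =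
      (\<Sum>\<nu> | multi_order \<nu> = nat \<lfloor>s\<rfloor>. ennreal c * ennreal_root p (gagliardo_integral (frac s) p \<Omega> (v \<nu>)))"
    by (intro sum.cong refl ennreal_root_gagliardo_integral_cmult p c m \<Omega>) simp
  ultimately show ?thesis
    unfolding sobolev_norm_fun_family[OF \<Omega> fam] sobolev_norm_fun_family[OF \<Omega> fam']
    by (simp add: distrib_left sum_distrib_left)
qed

section \<open>Multiplication by a test function on distributions of any order\<close>

lemma Lp_space_diff:
  assumes "u \<in> Lp_space p \<Omega>" "v \<in> Lp_space p \<Omega>" "0 < p"
  shows "(\<lambda>x. u x - v x) \<in> Lp_space p \<Omega>"
proof -
  have um: "u \<in> borel_measurable (lebesgue_on \<Omega>)" and vm: "v \<in> borel_measurable (lebesgue_on \<Omega>)"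
    using assms by (auto simp: Lp_space_def)
  have "(\<integral>\<^sup>+ x. ennreal (\<bar>u x - v x\<bar> powr p) \<partial>lebesgue_on \<Omega>) \<le>
      (\<integral>\<^sup>+ x. ennreal (2 powr p) * (ennreal (\<bar>u x\<bar> powr p) + ennreal (\<bar>v x\<bar> powr p)) \<partial>lebesgue_on \<Omega>)"
  proof (rule nn_integral_mono)
    fix x
    have "\<bar>u x - v x\<bar> powr p \<le> 2 powr p * (\<bar>u x\<bar> powr p + \<bar>v x\<bar> powr p)"
      using abs_add_powr_le[of p "u x" "- v x"] assms(3) by simp
    then show "ennreal (\<bar>u x - v x\<bar> powr p) \<le> ennreal (2 powr p) * (ennreal (\<bar>u x\<bar> powr p) + ennreal (\<bar>v x\<bar> powr p))"
      by (simp add: ennreal_plus[symmetric] ennreal_mult[symmetric] del: ennreal_plus)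
  qed
  also have "\<dots> = ennreal (2 powr p) * ((\<integral>\<^sup>+ x. ennreal (\<bar>u x\<bar> powr p) \<partial>lebesgue_on \<Omega>) +
      (\<integral>\<^sup>+ x. ennreal (\<bar>v x\<bar> powr p) \<partial>lebesgue_on \<Omega>))"
    using um vm by (subst nn_integral_cmult) (auto simp: nn_integral_add)
  also have "\<dots> < \<infinity>"
  proof -
    have "(\<integral>\<^sup>+ x. ennreal (\<bar>u x\<bar> powr p) \<partial>lebesgue_on \<Omega>) < \<infinity>" "(\<integral>\<^sup>+ x. ennreal (\<bar>v x\<bar> powr p) \<partial>lebesgue_on \<Omega>) < \<infinity>"
      using assms unfolding Lp_space_def Lp_norm_def ennreal_root_finite by blast+
    then show ?thesis by (simp add: ennreal_mult_less_top ennreal_add_less_top)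
  qed
  finally have "Lp_norm p \<Omega> (\<lambda>x. u x - v x) < \<infinity>" unfolding Lp_norm_def ennreal_root_finite .
  then show ?thesis using um vm by (simp add: Lp_space_def)
qed

lemma test_functions_Lp_space:
  fixes \<xi> :: "'a::euclidean_space \<Rightarrow> real"
  assumes \<Omega>: "open \<Omega>" and \<xi>: "\<xi> \<in> test_functions \<Omega>'" and p: "0 < p"
  shows "\<xi> \<in> Lp_space p \<Omega>"
proof -
  obtain M where M: "M \<ge> 0" "\<And>x. \<bar>\<xi> x\<bar> \<le> M" using test_functions_bounded[OF \<xi>] by auto
  let ?K = "closure {x. \<xi> x \<noteq> 0}"
  have K: "?K \<in> lmeasurable" by (rule lmeasurable_compact) (rule test_functionsD[OF \<xi>])
  have "(\<integral>\<^sup>+ x. ennreal (\<bar>\<xi> x\<bar> powr p) \<partial>lebesgue_on \<Omega>) =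
      (\<integral>\<^sup>+ x. ennreal (\<bar>\<xi> x\<bar> powr p) * indicator \<Omega> x \<partial>lebesgue)"
    using \<Omega> by (intro nn_integral_restrict_space) simp
  also have "\<dots> \<le> (\<integral>\<^sup>+ x. ennreal (M powr p) * indicator ?K x \<partial>lebesgue)"
  proof (rule nn_integral_mono)
    fix x
    show "ennreal (\<bar>\<xi> x\<bar> powr p) * indicator \<Omega> x \<le> ennreal (M powr p) * indicator ?K x"
    proof (cases "\<xi> x = 0")
      case False
      then have "x \<in> ?K" using closure_subset[of "{x. \<xi> x \<noteq> 0}"] by blast
      moreover have "ennreal (\<bar>\<xi> x\<bar> powr p) \<le> ennreal (M powr p)"
        using M p by (intro ennreal_leI powr_mono2) auto
      ultimately show ?thesis by (simp add: indicator_def)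
    qed (use p in simp)
  qed
  also have "\<dots> = ennreal (M powr p) * emeasure lebesgue ?K"
    using K by (intro nn_integral_cmult_indicator) (rule fmeasurableD)
  also have "\<dots> < \<infinity>"
  proof -
    have "emeasure lebesgue ?K < top" using fmeasurableD2[OF K] unfolding less_top .
    then show ?thesis by (simp add: ennreal_mult_less_top del: emeasure_completion)
  qed
  finally have "Lp_norm p \<Omega> \<xi> < \<infinity>" unfolding Lp_norm_def ennreal_root_finite .
  moreover have "\<xi> \<in> borel_measurable (lebesgue_on \<Omega>)"
    by (intro measurable_restrict_space1 lebesgue_measurable_continuous test_functions_continuous_on[OF \<xi>])
  ultimately show ?thesis by (simp add: Lp_space_def)
qed

text \<open>
  If test functions \<open>\<xi>\<close> approximate \<open>w\<close>, then the test functions \<open>\<theta> \<xi>\<close> approximate \<open>\<theta> w\<close>, by boundedness of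
  the multiplication.
\<close>

lemma sobolev_space0_fun_mult_test_function:
  fixes \<Omega> :: "(real ^ 'n::finite) set"
  assumes \<Omega>: "open \<Omega>" and \<theta>: "\<theta> \<in> test_functions \<Omega>" and p: "1 < p"
    and w: "w \<in> sobolev_space0_fun s p \<Omega>"
  shows "(\<lambda>x. \<theta> x * w x) \<in> sobolev_space0_fun s p \<Omega>"
proof -
  obtain C where C: "C > 0" "\<And>u. u \<in> Lp_space p \<Omega> \<Longrightarrow>
    sobolev_norm_fun s p \<Omega> (\<lambda>x. \<theta> x * u x) \<le> ennreal C * sobolev_norm_fun s p \<Omega> u"
  proof (rule sobolev_norm_fun_mult_test_function[OF \<Omega> \<theta> p, of s], goal_cases)
    case (1 C)
    show ?case by (rule 1(1)[OF 1(2) 1(3)])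
  qed
  have p0: "0 < p" using p by simp
  have wL: "w \<in> Lp_space p \<Omega>" and fin: "sobolev_norm_fun s p \<Omega> w < \<infinity>"
    and approx: "\<And>\<epsilon>. \<epsilon> > 0 \<Longrightarrow> \<exists>\<xi>\<in>test_functions \<Omega>. sobolev_norm_fun s p \<Omega> (\<lambda>x. w x - \<xi> x) < ennreal \<epsilon>"
    using w by (auto simp: sobolev_space0_fun_def sobolev_space_fun_def)
  have "sobolev_norm_fun s p \<Omega> (\<lambda>x. \<theta> x * w x) \<le> ennreal C * sobolev_norm_fun s p \<Omega> w"
    by (rule C(2)[OF wL])
  also have "\<dots> < \<infinity>" using fin by (simp add: ennreal_mult_less_top)
  finally have 1: "sobolev_norm_fun s p \<Omega> (\<lambda>x. \<theta> x * w x) < \<infinity>" .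
  have "\<exists>\<xi>\<in>test_functions \<Omega>. sobolev_norm_fun s p \<Omega> (\<lambda>x. \<theta> x * w x - \<xi> x) < ennreal \<epsilon>" if \<epsilon>: "\<epsilon> > 0" for \<epsilon>
  proof -
    obtain \<xi> where \<xi>: "\<xi> \<in> test_functions \<Omega>" "sobolev_norm_fun s p \<Omega> (\<lambda>x. w x - \<xi> x) < ennreal (\<epsilon> / C)"
      using approx[of "\<epsilon> / C"] \<epsilon> C(1) by auto
    obtain r where r: "0 \<le> r" "sobolev_norm_fun s p \<Omega> (\<lambda>x. w x - \<xi> x) = ennreal r"
      using \<xi>(2) by (cases "sobolev_norm_fun s p \<Omega> (\<lambda>x. w x - \<xi> x)") auto
    have r\<epsilon>: "C * r < \<epsilon>"
      using \<xi>(2) r C(1) \<epsilon> by (simp add: ennreal_less_iff field_simps)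
    have "sobolev_norm_fun s p \<Omega> (\<lambda>x. \<theta> x * (w x - \<xi> x)) \<le> ennreal C * ennreal r"
      using C(2)[OF Lp_space_diff[OF wL test_functions_Lp_space[OF \<Omega> \<xi>(1) p0] p0]] r(2) by simp
    also have "\<dots> < ennreal \<epsilon>"
      using r\<epsilon> C(1) r(1) by (simp add: ennreal_mult[symmetric] ennreal_less_iff)
    finally have "sobolev_norm_fun s p \<Omega> (\<lambda>x. \<theta> x * w x - \<theta> x * \<xi> x) < ennreal \<epsilon>"
      by (simp add: right_diff_distrib)
    then show ?thesis
      using test_functions_mult[OF \<theta> test_functionsD(1)[OF \<xi>(1)]] by (intro bexI)
  qed
  then show ?thesis
    using 1 Lp_space_mult_test_function[OF \<Omega> \<theta> wL p0]
    by (simp add: sobolev_space0_fun_def sobolev_space_fun_def)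
qed

lemma INF_ennreal_cmult_le:
  fixes f :: "'a \<Rightarrow> ennreal"
  assumes C: "C > 0" and le: "\<And>u. u \<in> S \<Longrightarrow> X \<le> ennreal C * f u"
  shows "X \<le> ennreal C * (INF u\<in>S. f u)"
proof -
  have "ennreal (1 / C) * X \<le> f u" if "u \<in> S" for u
  proof -
    have "ennreal (1 / C) * X \<le> ennreal (1 / C) * (ennreal C * f u)"
      by (intro mult_left_mono le that) simp
    also have "\<dots> = f u" using C by (simp add: mult.assoc[symmetric] ennreal_mult[symmetric])
    finally show ?thesis .
  qed
  then have "ennreal (1 / C) * X \<le> (INF u\<in>S. f u)" by (rule INF_greatest)
  then have "ennreal C * (ennreal (1 / C) * X) \<le> ennreal C * (INF u\<in>S. f u)" by (rule mult_left_mono) simp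
  then show ?thesis using C by (simp add: mult.assoc[symmetric] ennreal_mult[symmetric])
qed

text \<open>
  The transpose of a bounded operator is bounded with the same constant.
\<close>

lemma dual_space0_mult_test_function:
  fixes \<Omega> :: "(real ^ 'n::finite) set"
  assumes \<Omega>: "open \<Omega>" and \<theta>: "\<theta> \<in> test_functions \<Omega>" and p: "1 < p"
    and C: "C > 0" "\<And>u. u \<in> Lp_space p \<Omega> \<Longrightarrow>
      sobolev_norm_fun s p \<Omega> (\<lambda>x. \<theta> x * u x) \<le> ennreal C * sobolev_norm_fun s p \<Omega> u"
    and F: "F \<in> dual_space0 s p \<Omega>"
  shows "(\<lambda>w. F (\<lambda>x. \<theta> x * w x)) \<in> dual_space0 s p \<Omega>"
    and "dual_norm0 s p \<Omega> (\<lambda>w. F (\<lambda>x. \<theta> x * w x)) \<le> ennreal C * dual_norm0 s p \<Omega> F"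
proof -
  let ?W = "sobolev_space0_fun s p \<Omega>" and ?N = "sobolev_norm_fun s p \<Omega>"
  have add: "F (\<lambda>x. v x + w x) = F v + F w" if "v \<in> ?W" "w \<in> ?W" for v w
    using F that by (simp add: dual_space0_def)
  have scale: "F (\<lambda>x. c * w x) = c * F w" if "w \<in> ?W" for c w
    using F that by (simp add: dual_space0_def)
  obtain B where B: "B \<ge> 0" "\<And>w. w \<in> ?W \<Longrightarrow> ennreal \<bar>F w\<bar> \<le> ennreal B * ?N w"
    using F by (auto simp: dual_space0_def)
  have mult: "(\<lambda>x. f x * w x) \<in> ?W" if "w \<in> ?W" "f \<in> test_functions \<Omega>" for w f
    by (rule sobolev_space0_fun_mult_test_function[OF \<Omega> that(2) p that(1)])
  have Lp: "w \<in> Lp_space p \<Omega>" if "w \<in> ?W" for w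
    using that by (simp add: sobolev_space0_fun_def sobolev_space_fun_def)
  show "(\<lambda>w. F (\<lambda>x. \<theta> x * w x)) \<in> dual_space0 s p \<Omega>"
    unfolding dual_space0_def
  proof (intro CollectI conjI ballI allI)
    show "F (\<lambda>x. \<theta> x * (v x + w x)) = F (\<lambda>x. \<theta> x * v x) + F (\<lambda>x. \<theta> x * w x)" if "v \<in> ?W" "w \<in> ?W" for v w
      using add[OF mult[OF that(1) \<theta>] mult[OF that(2) \<theta>]] by (simp add: distrib_left)
    show "F (\<lambda>x. \<theta> x * (c * w x)) = c * F (\<lambda>x. \<theta> x * w x)" if "w \<in> ?W" for c w
      using scale[OF mult[OF that \<theta>], of c] by (simp add: mult.left_commute)
    show "\<exists>K\<ge>0. \<forall>w\<in>?W. ennreal \<bar>F (\<lambda>x. \<theta> x * w x)\<bar> \<le> ennreal K * ?N w"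
    proof (intro exI[of _ "B * C"] conjI ballI)
      fix w assume w: "w \<in> ?W"
      have "ennreal \<bar>F (\<lambda>x. \<theta> x * w x)\<bar> \<le> ennreal B * ?N (\<lambda>x. \<theta> x * w x)" by (rule B(2)[OF mult[OF w \<theta>]])
      also have "\<dots> \<le> ennreal B * (ennreal C * ?N w)" by (intro mult_left_mono C(2) Lp w) simp
      finally show "ennreal \<bar>F (\<lambda>x. \<theta> x * w x)\<bar> \<le> ennreal (B * C) * ?N w"
        using B(1) C(1) by (simp add: ennreal_mult mult.assoc)
    qed (use B(1) C(1) in simp)
  qed
  show "dual_norm0 s p \<Omega> (\<lambda>w. F (\<lambda>x. \<theta> x * w x)) \<le> ennreal C * dual_norm0 s p \<Omega> F"
    unfolding dual_norm0_def[of s p \<Omega> "\<lambda>w. F (\<lambda>x. \<theta> x * w x)"]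
  proof (rule SUP_least)
    fix w assume "w \<in> {w \<in> ?W. ?N w \<le> 1}"
    then have w: "w \<in> ?W" "?N w \<le> 1" by auto
    \<comment> \<open>rescaled to the unit ball\<close>
    define z where "z = (\<lambda>x. (1 / C) * (\<theta> x * w x))"
    have "z = (\<lambda>x. ((1 / C) * \<theta> x) * w x)" by (simp add: z_def mult.assoc)
    then have z: "z \<in> ?W" using mult[OF w(1) test_functions_cmult[OF \<theta>, of "1 / C"]] by simp
    have "?N z \<le> ennreal (1 / C) * ?N (\<lambda>x. \<theta> x * w x)"
      unfolding z_def using p C(1) by (intro sobolev_norm_fun_cmult[OF \<Omega>] Lp mult w \<theta>) auto
    also have "\<dots> \<le> ennreal (1 / C) * (ennreal C * ?N w)" by (intro mult_left_mono C(2) Lp w) simp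
    also have "\<dots> = ?N w" using C(1) by (simp add: mult.assoc[symmetric] ennreal_mult[symmetric])
    finally have Nz: "?N z \<le> 1" using w(2) by simp
    have "(\<lambda>x. \<theta> x * w x) = (\<lambda>x. C * z x)" using C(1) by (simp add: z_def)
    then have "F (\<lambda>x. \<theta> x * w x) = C * F z" using scale[OF z, of C] by simp
    then have "ennreal \<bar>F (\<lambda>x. \<theta> x * w x)\<bar> = ennreal C * ennreal \<bar>F z\<bar>"
      using C(1) by (simp add: abs_mult ennreal_mult)
    also have "\<dots> \<le> ennreal C * dual_norm0 s p \<Omega> F"
      unfolding dual_norm0_def using z Nz by (intro mult_left_mono SUP_upper) auto
    finally show "ennreal \<bar>F (\<lambda>x. \<theta> x * w x)\<bar> \<le> ennreal C * dual_norm0 s p \<Omega> F" .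
  qed
qed

text \<open>
  For \<open>e \<ge> 0\<close> the product is represented by \<open>\<theta>\<close> times a representing function, for \<open>e < 0\<close> it is extended
  by the transpose of the multiplication.
\<close>

theorem sobolev_norm_mult_test_function:
  fixes \<Omega> :: "(real ^ 'n::finite) set"
  assumes \<Omega>: "open \<Omega>" and \<theta>: "\<theta> \<in> test_functions \<Omega>" and q: "1 < q"
  obtains C where "C > 0" "\<And>T. sobolev_norm e q \<Omega> (\<lambda>\<xi>. T (\<lambda>x. \<theta> x * \<xi> x)) \<le> ennreal C * sobolev_norm e q \<Omega> T"
proof (cases "0 \<le> e")
  case True
  obtain C where C: "C > 0" "\<And>u. u \<in> Lp_space q \<Omega> \<Longrightarrow>
    sobolev_norm_fun e q \<Omega> (\<lambda>x. \<theta> x * u x) \<le> ennreal C * sobolev_norm_fun e q \<Omega> u"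
  proof (rule sobolev_norm_fun_mult_test_function[OF \<Omega> \<theta> q, of e], goal_cases)
    case (1 C)
    show ?case by (rule 1(1)[OF 1(2) 1(3)])
  qed
  let ?R = "\<lambda>T. {u \<in> Lp_space q \<Omega>. \<forall>\<xi>\<in>test_functions \<Omega>. T \<xi> = (LINT x|lebesgue_on \<Omega>. u x * \<xi> x)}"
  have "sobolev_norm e q \<Omega> (\<lambda>\<xi>. T (\<lambda>x. \<theta> x * \<xi> x)) \<le> ennreal C * sobolev_norm e q \<Omega> T" for T
  proof -
    let ?T' = "\<lambda>\<xi>. T (\<lambda>x. \<theta> x * \<xi> x)"
    have "sobolev_norm e q \<Omega> ?T' \<le> ennreal C * sobolev_norm_fun e q \<Omega> u" if u: "u \<in> ?R T" for u
    proof -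
      have "?T' \<xi> = (LINT x|lebesgue_on \<Omega>. (\<theta> x * u x) * \<xi> x)" if \<xi>: "\<xi> \<in> test_functions \<Omega>" for \<xi>
        using u test_functions_mult[OF \<theta> test_functionsD(1)[OF \<xi>]] by (simp add: mult_ac)
      moreover have "(\<lambda>x. \<theta> x * u x) \<in> Lp_space q \<Omega>"
        using u q by (intro Lp_space_mult_test_function[OF \<Omega> \<theta>]) auto
      ultimately have "(\<lambda>x. \<theta> x * u x) \<in> ?R ?T'" by simp
      then have "sobolev_norm e q \<Omega> ?T' \<le> sobolev_norm_fun e q \<Omega> (\<lambda>x. \<theta> x * u x)"
        using True by (simp add: sobolev_norm_def INF_lower)
      also have "\<dots> \<le> ennreal C * sobolev_norm_fun e q \<Omega> u" using u by (intro C(2)) simp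
      finally show ?thesis .
    qed
    from INF_ennreal_cmult_le[OF C(1), of "?R T", OF this] show ?thesis
      using True by (simp add: sobolev_norm_def)
  qed
  then show ?thesis by (rule that[OF C(1)])
next
  case False
  define p where "p = q / (q - 1)"
  have p: "1 < p" using q by (simp add: p_def field_simps)
  obtain C where C: "C > 0" "\<And>u. u \<in> Lp_space p \<Omega> \<Longrightarrow>
    sobolev_norm_fun (- e) p \<Omega> (\<lambda>x. \<theta> x * u x) \<le> ennreal C * sobolev_norm_fun (- e) p \<Omega> u"
  proof (rule sobolev_norm_fun_mult_test_function[OF \<Omega> \<theta> p, of "- e"], goal_cases)
    case (1 C)
    show ?case by (rule 1(1)[OF 1(2) 1(3)])
  qed
  let ?R = "\<lambda>T. {F \<in> dual_space0 (- e) p \<Omega>. \<forall>\<xi>\<in>test_functions \<Omega>. T \<xi> = F \<xi>}"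
  have norm_eq: "sobolev_norm e q \<Omega> T = (INF F\<in>?R T. dual_norm0 (- e) p \<Omega> F)" for T
    using False by (simp add: sobolev_norm_def p_def)
  have "sobolev_norm e q \<Omega> (\<lambda>\<xi>. T (\<lambda>x. \<theta> x * \<xi> x)) \<le> ennreal C * sobolev_norm e q \<Omega> T" for T
  proof -
    let ?T' = "\<lambda>\<xi>. T (\<lambda>x. \<theta> x * \<xi> x)"
    have "sobolev_norm e q \<Omega> ?T' \<le> ennreal C * dual_norm0 (- e) p \<Omega> F" if F: "F \<in> ?R T" for F
    proof -
      let ?F' = "\<lambda>w. F (\<lambda>x. \<theta> x * w x)"
      have Fd: "F \<in> dual_space0 (- e) p \<Omega>" using F by simp
      note F' = dual_space0_mult_test_function[OF \<Omega> \<theta> p C Fd]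
      have "?T' \<xi> = ?F' \<xi>" if \<xi>: "\<xi> \<in> test_functions \<Omega>" for \<xi>
        using F test_functions_mult[OF \<theta> test_functionsD(1)[OF \<xi>]] by simp
      then have "?F' \<in> ?R ?T'" using F'(1) by simp
      then have "sobolev_norm e q \<Omega> ?T' \<le> dual_norm0 (- e) p \<Omega> ?F'"
        unfolding norm_eq by (rule INF_lower)
      also have "\<dots> \<le> ennreal C * dual_norm0 (- e) p \<Omega> F" by (rule F'(2))
      finally show ?thesis .
    qed
    from INF_ennreal_cmult_le[OF C(1), of "?R T", OF this] show ?thesis unfolding norm_eq by simp
  qed
  then show ?thesis by (rule that[OF C(1)])
qed

section \<open>Smooth functions in charts\<close>

lemma smooth_chartsD:
  assumes "(U, \<phi>) \<in> smooth_charts A"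
  shows "open U" "open (\<phi> ` U)" "inj_on \<phi> U" "continuous_on U \<phi>"
    and "\<And>W. open W \<Longrightarrow> W \<subseteq> U \<Longrightarrow> open (\<phi> ` W)"
proof -
  have c: "is_chart (U, \<phi>)" using assms by (simp add: smooth_charts_def)
  then show U: "open U" "open (\<phi> ` U)" by (auto simp: is_chart_def)
  have h: "homeomorphism U (\<phi> ` U) \<phi> (inv_into U \<phi>)" using c by (simp add: is_chart_def)
  then show "continuous_on U \<phi>" by (simp add: homeomorphism_def)
  show "inj_on \<phi> U" using h by (intro inj_on_inverseI[where g = "inv_into U \<phi>"]) (simp add: homeomorphism_def)
  show "open (\<phi> ` W)" if "open W" "W \<subseteq> U" for W
  proof -
    have "openin (top_of_set U) W" using that U by (simp add: openin_open_eq)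
    then have "openin (top_of_set (\<phi> ` U)) (\<phi> ` W)" by (rule homeomorphism_imp_open_map[OF h])
    then show ?thesis using U by (simp add: openin_open_eq)
  qed
qed

text \<open>
  Smoothness of \<open>\<eta>\<close> only provides some chart around each point.  Locally \<open>\<eta> \<circ> \<phi>\<^sup>-\<^sup>1\<close> is the composition of two chart
  transitions, the coordinate expression of \<open>\<eta>\<close> in that chart, and the inverse of a chart of \<open>\<real>\<close>.
\<close>

lemma smooth_function_in_chart:
  fixes A :: "('m::topological_space, 'a::euclidean_space) chart set"
  assumes A: "smooth_atlas A" and \<eta>: "smooth_function A \<eta>" and c: "(U, \<phi>) \<in> smooth_charts A"
  shows "smooth_on (\<phi> ` U) (\<lambda>y. \<eta> (inv_into U \<phi> y))"
proof (rule smooth_on_local)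
  fix y assume "y \<in> \<phi> ` U"
  then obtain x where x: "x \<in> U" "y = \<phi> x" by auto
  obtain U1 \<phi>1 V \<psi> where c1: "(U1, \<phi>1) \<in> smooth_charts A" and V: "(V, \<psi>) \<in> smooth_charts euclidean_atlas"
    and x1: "x \<in> U1" and "U1 \<subseteq> UNIV" and \<eta>V: "\<eta> ` U1 \<subseteq> V"
    and sm: "smooth_on (\<phi>1 ` U1) (\<psi> \<circ> \<eta> \<circ> inv_into U1 \<phi>1)"
    using bspec[OF \<eta>[unfolded smooth_function_def smooth_map_on_def] UNIV_I, of x] by (elim exE conjE)
  \<comment> \<open>two charts of the maximal atlas are compared through a chart of the generating one\<close>
  have "x \<in> (\<Union>c\<in>A. fst c)" using A by (simp add: smooth_atlas_def)
  then obtain U2 \<phi>2 where c2: "(U2, \<phi>2) \<in> A" and x2: "x \<in> U2" by auto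
  have c2': "(U2, \<phi>2) \<in> smooth_charts A" using A c2 by (auto simp: smooth_atlas_def)
  note C = smooth_chartsD[OF c] and C1 = smooth_chartsD[OF c1] and C2 = smooth_chartsD[OF c2']
    and CV = smooth_chartsD[OF V]
  let ?W = "U \<inter> U1 \<inter> U2"
  have W: "open ?W" using C(1) C1(1) C2(1) by blast
  have oT: "open (\<phi> ` ?W)" "open (\<phi>2 ` ?W)" "open (\<phi>1 ` ?W)"
    by (rule C(5)[OF W] C2(5)[OF W] C1(5)[OF W]; blast)+
  have s1: "smooth_on (\<phi> ` ?W) (\<phi>2 \<circ> inv_into U \<phi>)"
    using c c2 by (auto simp: smooth_charts_def smoothly_compatible_def intro: smooth_on_subset[where S = "\<phi> ` (U \<inter> U2)"])
  have s2: "smooth_on (\<phi>2 ` ?W) (\<phi>1 \<circ> inv_into U2 \<phi>2)"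
    using c1 c2 by (auto simp: smooth_charts_def smoothly_compatible_def intro: smooth_on_subset[where S = "\<phi>2 ` (U1 \<inter> U2)"])
  have s3: "smooth_on (\<phi>1 ` ?W) (\<psi> \<circ> \<eta> \<circ> inv_into U1 \<phi>1)"
    by (rule smooth_on_subset[OF sm]) auto
  have s4: "smooth_on (\<psi> ` V) (inv_into V \<psi>)"
    using V by (auto simp: smooth_charts_def smoothly_compatible_def euclidean_atlas_def)
  have i: "inv_into U \<phi> (\<phi> z) = z" "inv_into U1 \<phi>1 (\<phi>1 z) = z" "inv_into U2 \<phi>2 (\<phi>2 z) = z" if "z \<in> ?W" for z
    using that C(3) C1(3) C2(3) by auto
  have iV: "inv_into V \<psi> (\<psi> (\<eta> z)) = \<eta> z" if "z \<in> ?W" for z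
    using that \<eta>V CV(3) by (intro inv_into_f_f) auto
  have s12: "smooth_on (\<phi> ` ?W) (\<lambda>y. (\<phi>1 \<circ> inv_into U2 \<phi>2) ((\<phi>2 \<circ> inv_into U \<phi>) y))"
    by (rule smooth_on_compose[OF oT(1) oT(2) _ s1 s2]) (auto simp: C(3))
  have s123: "smooth_on (\<phi> ` ?W) (\<lambda>y. (\<psi> \<circ> \<eta> \<circ> inv_into U1 \<phi>1) ((\<phi>1 \<circ> inv_into U2 \<phi>2) ((\<phi>2 \<circ> inv_into U \<phi>) y)))"
    by (rule smooth_on_compose[OF oT(1) oT(3) _ s12 s3]) (auto simp: C(3) C2(3))
  have "smooth_on (\<phi> ` ?W) (\<lambda>y. inv_into V \<psi>
      ((\<psi> \<circ> \<eta> \<circ> inv_into U1 \<phi>1) ((\<phi>1 \<circ> inv_into U2 \<phi>2) ((\<phi>2 \<circ> inv_into U \<phi>) y))))"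
    by (rule smooth_on_compose[OF oT(1) CV(2) _ s123 s4]) (use \<eta>V in \<open>auto simp: C(3) C1(3) C2(3)\<close>)
  also have "?this \<longleftrightarrow> smooth_on (\<phi> ` ?W) (\<lambda>y. \<eta> (inv_into U \<phi> y))"
  proof (rule smooth_on_cong[OF oT(1)])
    fix y assume "y \<in> \<phi> ` ?W"
    then obtain z where z: "z \<in> ?W" "y = \<phi> z" by blast
    show "inv_into V \<psi> ((\<psi> \<circ> \<eta> \<circ> inv_into U1 \<phi>1) ((\<phi>1 \<circ> inv_into U2 \<phi>2) ((\<phi>2 \<circ> inv_into U \<phi>) y))) =
      \<eta> (inv_into U \<phi> y)"
      unfolding z(2) comp_def i[OF z(1)] by (rule iV[OF z(1)])
  qed
  finally show "\<exists>T. open T \<and> y \<in> T \<and> smooth_on T (\<lambda>y. \<eta> (inv_into U \<phi> y))"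
    using oT(1) x x1 x2 by blast
qed

text \<open>
  The derivatives of \<open>\<eta> \<circ> \<phi>\<^sup>-\<^sup>1\<close> may be unbounded near the boundary of the coordinate domain.  A cutoff that is \<open>1\<close> on the
  compact image of the support of \<open>\<psi>\<close> turns the function into a test function, and after multiplication by \<open>\<psi>\<close> the cutoff
  is invisible.
\<close>

lemma coordinate_multiplier:
  fixes A :: "('m::topological_space, 'a::euclidean_space) chart set"
  assumes cpt: "compact (UNIV :: 'm set)" and A: "smooth_atlas A" and \<eta>: "smooth_function A \<eta>"
    and c: "(U, \<phi>) \<in> smooth_charts A" and supp: "closure {x. \<psi> x \<noteq> (0 :: real)} \<subseteq> U"
  obtains \<theta> where "\<theta> \<in> test_functions (\<phi> ` U)" "\<And>x. x \<in> U \<Longrightarrow> \<psi> x \<noteq> 0 \<Longrightarrow> \<theta> (\<phi> x) = \<eta> x"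
proof -
  note C = smooth_chartsD[OF c]
  let ?S = "closure {x. \<psi> x \<noteq> 0}" and ?\<Omega> = "\<phi> ` U"
  have "compact (UNIV \<inter> ?S)" by (rule compact_Int_closed[OF cpt closed_closure])
  then have cS: "compact (\<phi> ` ?S)"
    using continuous_on_subset[OF C(4) supp] by (intro compact_continuous_image) simp_all
  have sS: "\<phi> ` ?S \<subseteq> ?\<Omega>" using supp by blast
  obtain \<kappa> where \<kappa>: "\<kappa> \<in> test_functions ?\<Omega>" "\<And>y. y \<in> \<phi> ` ?S \<Longrightarrow> \<kappa> y = 1"
  proof (rule smooth_cutoff[OF cS C(2) sS], goal_cases)
    case (1 C)
    show ?case by (rule 1(1)[OF 1(2) 1(3)])
  qed
  let ?K = "closure {y. \<kappa> y \<noteq> 0}"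
  define \<theta> where "\<theta> = (\<lambda>y. \<kappa> y * (if y \<in> ?\<Omega> then \<eta> (inv_into U \<phi> y) else 0))"
  have "smooth_on UNIV \<theta>"
  proof (rule smooth_on_local)
    fix y
    show "\<exists>T. open T \<and> y \<in> T \<and> smooth_on T \<theta>"
    proof (cases "y \<in> ?\<Omega>")
      case True
      have "smooth_on ?\<Omega> (\<lambda>y. \<kappa> y * \<eta> (inv_into U \<phi> y))"
        by (intro smooth_on_mult C smooth_function_in_chart[OF A \<eta> c] smooth_on_subset[OF test_functionsD(1)[OF \<kappa>(1)]]) simp
      also have "?this \<longleftrightarrow> smooth_on ?\<Omega> \<theta>"
        by (rule smooth_on_cong[OF C(2)]) (simp add: \<theta>_def)
      finally show ?thesis using C(2) True by blast
    next
      case False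
      then have y: "y \<in> - ?K" using test_functionsD(3)[OF \<kappa>(1)] by blast
      have 0: "\<theta> z = 0" if "z \<in> - ?K" for z
      proof -
        have "\<kappa> z = 0" using that closure_subset[of "{y. \<kappa> y \<noteq> 0}"] by blast
        then show ?thesis by (simp add: \<theta>_def)
      qed
      have "smooth_on (- ?K) \<theta>"
        by (rule smooth_on_cong[OF open_Compl[OF closed_closure], THEN iffD2, OF 0 smooth_on_const])
      then show ?thesis using y open_Compl[OF closed_closure] by blast
    qed
  qed
  then have "\<theta> \<in> test_functions ?\<Omega>"
  proof (rule test_functionsI)
    show "{y. \<theta> y \<noteq> 0} \<subseteq> ?K"
      using closure_subset[of "{y. \<kappa> y \<noteq> 0}"] by (auto simp: \<theta>_def)
  qed (use test_functionsD[OF \<kappa>(1)] in auto)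
  moreover have "\<theta> (\<phi> x) = \<eta> x" if "x \<in> U" "\<psi> x \<noteq> 0" for x
  proof -
    have "x \<in> ?S" using that closure_subset[of "{x. \<psi> x \<noteq> 0}"] by blast
    then have "\<kappa> (\<phi> x) = 1" by (intro \<kappa>(2)) blast
    then show ?thesis using that C(3) by (simp add: \<theta>_def)
  qed
  ultimately show ?thesis by (rule that)
qed

section \<open>Multiplication of test sections and distributions\<close>

text \<open>
  The operator on test sections of which \<open>mult_distribution\<close> is the transpose.
\<close>

definition mult_section ::
  "('m, 'e, 'a, 'f) vector_bundle \<Rightarrow> ('m \<Rightarrow> real) \<Rightarrow>
   ('m, 'e, 'a, 'n) dual_section \<Rightarrow> ('m, 'e, 'a, 'n) dual_section" where
  "mult_section E \<eta> \<zeta> = (\<lambda>a V. \<eta> (bproj E a) * \<zeta> a V)"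

lemma mult_distribution_eq: "mult_distribution E \<eta> u \<zeta> = u (mult_section E \<eta> \<zeta>)"
  by (simp add: mult_distribution_def mult_section_def)

lemma density_space_cmult:
  "\<mu> \<in> density_space A x \<Longrightarrow> (\<lambda>V. c * \<mu> V) \<in> density_space A x"
  by (auto simp: density_space_def)

lemma bproj_fibre_operations:
  assumes "smooth_vector_bundle E"
  shows "bproj E (fscale E s a) = bproj E a"
    and "bproj E a = bproj E b \<Longrightarrow> bproj E (fadd E a b) = bproj E a"
proof -
  have v: "is_real_vector_space (fibre E x) (fadd E) (fscale E)" for x
    using assms by (simp add: smooth_vector_bundle_def)
  have "a \<in> fibre E (bproj E a)" by (simp add: fibre_def)
  then have "fscale E s a \<in> fibre E (bproj E a)"
    using v[of "bproj E a"] unfolding is_real_vector_space_def by blast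
  then show "bproj E (fscale E s a) = bproj E a" by (simp add: fibre_def)
  assume "bproj E a = bproj E b"
  then have "a \<in> fibre E (bproj E a)" "b \<in> fibre E (bproj E a)" by (simp_all add: fibre_def)
  then have "fadd E a b \<in> fibre E (bproj E a)"
    using v[of "bproj E a"] unfolding is_real_vector_space_def by blast
  then show "bproj E (fadd E a b) = bproj E a" by (simp add: fibre_def)
qed

lemma dual_sections_mult:
  assumes E: "smooth_vector_bundle E" and \<zeta>: "\<zeta> \<in> dual_sections E"
  shows "mult_section E \<eta> \<zeta> \<in> dual_sections E"
proof -
  have "mult_section E \<eta> \<zeta> a \<in> density_space (base_atlas E) (bproj E a)" for a
    using \<zeta> by (auto simp: mult_section_def dual_sections_def intro: density_space_cmult)
  moreover have "mult_section E \<eta> \<zeta> (fadd E a b) = (\<lambda>V. mult_section E \<eta> \<zeta> a V + mult_section E \<eta> \<zeta> b V)"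
    if ab: "bproj E a = bproj E b" for a b
  proof -
    have "\<zeta> (fadd E a b) = (\<lambda>V. \<zeta> a V + \<zeta> b V)" using \<zeta> ab by (simp add: dual_sections_def)
    then show ?thesis
      using ab bproj_fibre_operations(2)[OF E ab] by (simp add: mult_section_def distrib_left)
  qed
  moreover have "mult_section E \<eta> \<zeta> (fscale E s a) = (\<lambda>V. s * mult_section E \<eta> \<zeta> a V)" for s a
  proof -
    have "\<zeta> (fscale E s a) = (\<lambda>V. s * \<zeta> a V)" using \<zeta> by (simp add: dual_sections_def)
    then show ?thesis using bproj_fibre_operations(1)[OF E] by (simp add: mult_section_def mult.left_commute)
  qed
  ultimately show ?thesis by (simp add: dual_sections_def)
qed

lemma bproj_frame:
  assumes "fibrewise_linear_iso E U \<rho>" "x \<in> U"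
  shows "bproj E (frame E \<rho> l x) = x"
proof -
  have b: "bij_betw \<rho> (fibre E x) UNIV" using assms by (simp add: fibrewise_linear_iso_def)
  then have "axis l 1 \<in> \<rho> ` fibre E x" by (simp add: bij_betw_imp_surj_on)
  then obtain a where a: "a \<in> fibre E x" "\<rho> a = axis l 1" by (metis imageE)
  have "\<exists>!a. bproj E a = x \<and> \<rho> a = axis l 1"
  proof (rule ex1I[of _ a])
    show "bproj E a = x \<and> \<rho> a = axis l 1" using a by (simp add: fibre_def)
    fix a' assume "bproj E a' = x \<and> \<rho> a' = axis l 1"
    then have "a' \<in> fibre E x" "\<rho> a' = \<rho> a" using a by (simp_all add: fibre_def)
    then show "a' = a" using a(1) inj_onD[OF bij_betw_imp_inj_on[OF b]] by blast
  qed
  from theI'[OF this] show ?thesis by (simp add: frame_def)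
qed

lemma dual_component_mult_section:
  assumes "total_triv_triple E U \<phi> \<rho>" "y \<in> \<phi> ` U"
  shows "dual_component E U \<phi> \<rho> l (mult_section E \<eta> \<zeta>) y = \<eta> (inv_into U \<phi> y) * dual_component E U \<phi> \<rho> l \<zeta> y"
proof -
  have "fibrewise_linear_iso E U \<rho>" using assms(1) by (simp add: total_triv_triple_def local_trivialization_def)
  from bproj_frame[OF this inv_into_into[OF assms(2)]] show ?thesis
    by (simp add: dual_component_def mult_section_def Let_def)
qed

lemma total_triv_triple_chart: "total_triv_triple E U \<phi> \<rho> \<Longrightarrow> (U, \<phi>) \<in> smooth_charts (base_atlas E)"
  by (simp add: total_triv_triple_def)

lemma test_sections_mult:
  assumes E: "smooth_vector_bundle E" and \<eta>: "smooth_function (base_atlas E) \<eta>" and \<zeta>: "\<zeta> \<in> test_sections E"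
  shows "mult_section E \<eta> \<zeta> \<in> test_sections E"
  unfolding test_sections_def
proof (intro CollectI conjI allI impI)
  show "mult_section E \<eta> \<zeta> \<in> dual_sections E"
    using \<zeta> by (intro dual_sections_mult[OF E]) (simp add: test_sections_def)
  fix U \<phi> \<rho> l assume t: "total_triv_triple E U \<phi> \<rho>"
  note c = total_triv_triple_chart[OF t]
  have A: "smooth_atlas (base_atlas E)" using E by (simp add: smooth_vector_bundle_def)
  have "smooth_on (\<phi> ` U) (dual_component E U \<phi> \<rho> l \<zeta>)"
    using \<zeta> t by (simp add: test_sections_def)
  then have "smooth_on (\<phi> ` U) (\<lambda>y. \<eta> (inv_into U \<phi> y) * dual_component E U \<phi> \<rho> l \<zeta> y)"
    by (intro smooth_on_mult smooth_chartsD(2)[OF c] smooth_function_in_chart[OF A \<eta> c])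
  then show "smooth_on (\<phi> ` U) (dual_component E U \<phi> \<rho> l (mult_section E \<eta> \<zeta>))"
    by (subst smooth_on_cong[OF smooth_chartsD(2)[OF c] dual_component_mult_section[OF t]])
qed

lemma partials_add:
  assumes S: "open S" and f: "smooth_on S f" and g: "smooth_on S g" and x: "x \<in> S"
  shows "partials L (\<lambda>y. f y + g y) x = partials L f x + partials L g x"
  using x
proof (induction L arbitrary: x)
  case (Cons i L)
  have "partials (i # L) (\<lambda>y. f y + g y) x = partial_deriv i (\<lambda>y. partials L f y + partials L g y) x"
    unfolding partials_simps(2) by (rule partial_deriv_cong_open[OF S Cons.prems Cons.IH])
  also have "\<dots> = partials (i # L) f x + partials (i # L) g x"
    using smooth_on_differentiable[OF smooth_on_partials[OF f] Cons.prems]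
      smooth_on_differentiable[OF smooth_on_partials[OF g] Cons.prems]
    by (simp add: partial_deriv_add)
  finally show ?case .
qed simp

lemma partials_zero: "partials L (\<lambda>_. 0) = (\<lambda>_. 0)"
  by (induction L) (auto simp: partial_deriv_def)

text \<open>
  The subbasic sets of \<open>test_topology\<close>.
\<close>

definition seminorm_ball ::
  "('m::topological_space, 'e::topological_space, real ^ 'n::finite, real ^ 'r::finite) vector_bundle \<Rightarrow>
   'm set \<Rightarrow> ('m \<Rightarrow> real ^ 'n) \<Rightarrow> ('e \<Rightarrow> real ^ 'r) \<Rightarrow> 'r \<Rightarrow> (real ^ 'n) set \<Rightarrow> ('n \<Rightarrow> nat) \<Rightarrow>
   ('m, 'e, real ^ 'n, 'n) dual_section \<Rightarrow> real \<Rightarrow> ('m, 'e, real ^ 'n, 'n) dual_section set" where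
  "seminorm_ball E U \<phi> \<rho> l K \<nu> \<zeta>0 \<epsilon> = {\<zeta> \<in> test_sections E. \<forall>y\<in>K.
     \<bar>multi_deriv \<nu> (\<lambda>y. dual_component E U \<phi> \<rho> l \<zeta> y - dual_component E U \<phi> \<rho> l \<zeta>0 y) y\<bar> < \<epsilon>}"

definition seminorm_balls ::
  "('m::topological_space, 'e::topological_space, real ^ 'n::finite, real ^ 'r::finite) vector_bundle \<Rightarrow>
   ('m, 'e, real ^ 'n, 'n) dual_section set set" where
  "seminorm_balls E = {seminorm_ball E U \<phi> \<rho> l K \<nu> \<zeta>0 \<epsilon> | \<zeta>0 U \<phi> \<rho> l K \<nu> \<epsilon>.
     \<zeta>0 \<in> test_sections E \<and> total_triv_triple E U \<phi> \<rho> \<and> compact K \<and> K \<subseteq> \<phi> ` U \<and> 0 < \<epsilon>}"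

lemma test_topology_eq: "test_topology E = topology_generated_by (seminorm_balls E)"
  by (simp add: test_topology_def seminorm_balls_def seminorm_ball_def)

lemma seminorm_ball_center:
  assumes "\<zeta> \<in> test_sections E" "0 < \<epsilon>"
  shows "\<zeta> \<in> seminorm_ball E U \<phi> \<rho> l K \<nu> \<zeta> \<epsilon>"
  using assms by (simp add: seminorm_ball_def multi_deriv_eq_partials partials_zero)

lemma compact_bounded_finite_family:
  fixes f :: "'i \<Rightarrow> 'a::topological_space \<Rightarrow> real"
  assumes "compact K" "finite I" "\<And>i. i \<in> I \<Longrightarrow> continuous_on K (f i)"
  obtains R where "R > 0" "\<And>i x. i \<in> I \<Longrightarrow> x \<in> K \<Longrightarrow> \<bar>f i x\<bar> \<le> R"
proof -
  have "\<forall>i\<in>I. \<exists>R. \<forall>x\<in>K. \<bar>f i x\<bar> \<le> R"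
  proof
    fix i assume "i \<in> I"
    then have "bounded (f i ` K)" by (intro compact_imp_bounded compact_continuous_image assms)
    then show "\<exists>R. \<forall>x\<in>K. \<bar>f i x\<bar> \<le> R" unfolding bounded_iff by auto
  qed
  from bchoice[OF this] obtain R where R: "\<forall>i\<in>I. \<forall>x\<in>K. \<bar>f i x\<bar> \<le> R i" by (elim exE)
  have le: "\<bar>f i x\<bar> \<le> 1 + (\<Sum>i\<in>I. \<bar>R i\<bar>)" if "i \<in> I" "x \<in> K" for i x
  proof -
    have "\<bar>R i\<bar> \<le> (\<Sum>i\<in>I. \<bar>R i\<bar>)"
      using assms(2) that(1) by (intro member_le_sum[of i I "\<lambda>i. \<bar>R i\<bar>"]) auto
    moreover have "\<bar>f i x\<bar> \<le> R i" using R that by blast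
    ultimately show ?thesis by linarith
  qed
  have "1 + (\<Sum>i\<in>I. \<bar>R i\<bar>) > 0" by (intro add_pos_nonneg sum_nonneg) auto
  then show ?thesis using le by (rule that)
qed

text \<open>
  By the Leibniz rule, each seminorm of a product is dominated on a compact set by finitely many
  seminorms of the section.
\<close>

lemma continuous_map_mult_section:
  fixes E :: "('m::{t2_space, second_countable_topology}, 'e::{t2_space, second_countable_topology},
     real ^ 'n::finite, real ^ 'r::finite) vector_bundle"
  assumes E: "smooth_vector_bundle E" and \<eta>: "smooth_function (base_atlas E) \<eta>"
  shows "continuous_map (test_topology E) (test_topology E) (mult_section E \<eta>)"
proof -
  let ?T = "test_topology E"
  have A: "smooth_atlas (base_atlas E)" using E by (simp add: smooth_vector_bundle_def)
  have top: "topspace ?T = \<Union>(seminorm_balls E)"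
    unfolding test_topology_eq by (rule topology_generated_by_topspace)
  have basic: "openin ?T X" if "X \<in> seminorm_balls E" for X
    unfolding test_topology_eq by (rule topology_generated_by_Basis[OF that])
  have test: "\<zeta> \<in> test_sections E" if "\<zeta> \<in> topspace ?T" for \<zeta>
    using that unfolding top seminorm_balls_def by (auto simp: seminorm_ball_def)
  have "openin ?T (mult_section E \<eta> -` X \<inter> topspace ?T)" if X: "X \<in> seminorm_balls E" for X
  proof -
    obtain \<zeta>0 U \<phi> \<rho> l K \<nu> \<epsilon> where Xeq: "X = seminorm_ball E U \<phi> \<rho> l K \<nu> \<zeta>0 \<epsilon>"
      and \<zeta>0: "\<zeta>0 \<in> test_sections E" and t: "total_triv_triple E U \<phi> \<rho>" and K: "compact K" "K \<subseteq> \<phi> ` U" and \<epsilon>: "0 < \<epsilon>"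
      using X unfolding seminorm_balls_def by blast
    note c = total_triv_triple_chart[OF t]
    let ?\<Omega> = "\<phi> ` U" and ?L = "multi_list \<nu>" and ?\<eta> = "\<lambda>y. \<eta> (inv_into U \<phi> y)"
    let ?c = "\<lambda>\<zeta>. dual_component E U \<phi> \<rho> l \<zeta>"
    have \<Omega>: "open ?\<Omega>" by (rule smooth_chartsD(2)[OF c])
    have s\<eta>: "smooth_on ?\<Omega> ?\<eta>" by (rule smooth_function_in_chart[OF A \<eta> c])
    have sc: "smooth_on ?\<Omega> (?c \<zeta>)" if "\<zeta> \<in> test_sections E" for \<zeta>
      using that t by (simp add: test_sections_def)
    have diff: "smooth_on ?\<Omega> (\<lambda>y. f y - g y)" if "smooth_on ?\<Omega> f" "smooth_on ?\<Omega> g" for f g :: "real ^ 'n \<Rightarrow> real"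
      using smooth_on_add[OF \<Omega> that(1) smooth_on_mult[OF \<Omega> smooth_on_const[of _ "-1"] that(2)]] by simp
    show ?thesis
    proof (subst openin_subopen, intro ballI)
      fix \<zeta>1 assume \<zeta>1: "\<zeta>1 \<in> mult_section E \<eta> -` X \<inter> topspace ?T"
      then have t1: "\<zeta>1 \<in> test_sections E" and m1: "mult_section E \<eta> \<zeta>1 \<in> X" and top1: "\<zeta>1 \<in> topspace ?T"
        using test by auto
      define r where "r = (\<lambda>y. ?\<eta> y * ?c \<zeta>1 y - ?c \<zeta>0 y)"
      have sr: "smooth_on ?\<Omega> r" unfolding r_def by (intro diff smooth_on_mult \<Omega> s\<eta> sc t1 \<zeta>0)
      have dec: "multi_deriv \<nu> (\<lambda>y. ?c (mult_section E \<eta> \<zeta>) y - ?c \<zeta>0 y) y =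
          (\<Sum>p\<leftarrow>splits ?L. partials (fst p) ?\<eta> y * partials (snd p) (\<lambda>y. ?c \<zeta> y - ?c \<zeta>1 y) y) + partials ?L r y"
        if y: "y \<in> ?\<Omega>" and \<zeta>: "\<zeta> \<in> test_sections E" for y \<zeta>
      proof -
        have sd: "smooth_on ?\<Omega> (\<lambda>y. ?c \<zeta> y - ?c \<zeta>1 y)" by (intro diff sc t1 \<zeta>)
        have "multi_deriv \<nu> (\<lambda>y. ?c (mult_section E \<eta> \<zeta>) y - ?c \<zeta>0 y) y =
            partials ?L (\<lambda>y. ?\<eta> y * (?c \<zeta> y - ?c \<zeta>1 y) + r y) y"
          unfolding multi_deriv_eq_partials
          by (rule partials_cong_open[OF \<Omega> y])
            (simp add: dual_component_mult_section[OF t] r_def algebra_simps)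
        also have "\<dots> = partials ?L (\<lambda>y. ?\<eta> y * (?c \<zeta> y - ?c \<zeta>1 y)) y + partials ?L r y"
          by (rule partials_add[OF \<Omega> smooth_on_mult[OF \<Omega> s\<eta> sd] sr y])
        also have "partials ?L (\<lambda>y. ?\<eta> y * (?c \<zeta> y - ?c \<zeta>1 y)) y =
            (\<Sum>p\<leftarrow>splits ?L. partials (fst p) ?\<eta> y * partials (snd p) (\<lambda>y. ?c \<zeta> y - ?c \<zeta>1 y) y)"
          using partials_mult[OF \<Omega> s\<eta> sd y, of ?L] by (simp add: case_prod_unfold)
        finally show ?thesis .
      qed
      have r\<epsilon>: "\<bar>partials ?L r y\<bar> < \<epsilon>" if y: "y \<in> K" for y
      proof -
        have "partials ?L r y = multi_deriv \<nu> (\<lambda>y. ?c (mult_section E \<eta> \<zeta>1) y - ?c \<zeta>0 y) y"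
          unfolding multi_deriv_eq_partials
          by (rule partials_cong_open[OF \<Omega> subsetD[OF K(2) y]])
            (simp add: dual_component_mult_section[OF t] r_def)
        then show ?thesis using m1 y unfolding Xeq seminorm_ball_def by simp
      qed
      show "\<exists>Y. openin ?T Y \<and> \<zeta>1 \<in> Y \<and> Y \<subseteq> mult_section E \<eta> -` X \<inter> topspace ?T"
      proof (cases "K = {}")
        case True
        have "\<zeta> \<in> mult_section E \<eta> -` X" if "\<zeta> \<in> topspace ?T" for \<zeta>
          using test_sections_mult[OF E \<eta> test[OF that]] True by (simp add: Xeq seminorm_ball_def)
        then show ?thesis using top1 by (intro exI[of _ "topspace ?T"]) auto
      next
        case False
        have cont: "continuous_on K (partials L f)" if "smooth_on ?\<Omega> f" for L and f :: "real ^ 'n \<Rightarrow> real"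
          by (rule continuous_on_subset[OF smooth_on_imp_continuous_on[OF smooth_on_partials[OF that]] K(2)])
        obtain y0 where y0: "y0 \<in> K" "\<And>y. y \<in> K \<Longrightarrow> \<bar>partials ?L r y\<bar> \<le> \<bar>partials ?L r y0\<bar>"
          using continuous_attains_sup[OF K(1) False continuous_on_rabs[OF cont[OF sr, of ?L]]] by blast
        define \<gamma> where "\<gamma> = \<epsilon> - \<bar>partials ?L r y0\<bar>"
        have \<gamma>: "\<gamma> > 0" using r\<epsilon>[OF y0(1)] by (simp add: \<gamma>_def)
        let ?P = "set (splits ?L)" and ?n = "real (length (splits ?L))"
        obtain R where R: "R > 0" "\<And>p y. p \<in> ?P \<Longrightarrow> y \<in> K \<Longrightarrow> \<bar>partials (fst p) ?\<eta> y\<bar> \<le> R"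
          using compact_bounded_finite_family[OF K(1), of ?P "\<lambda>p. partials (fst p) ?\<eta>"] cont[OF s\<eta>] by auto
        \<comment> \<open>the added \<open>1\<close> makes the bound on the Leibniz sum strict\<close>
        define \<delta> where "\<delta> = \<gamma> / (R * (?n + 1))"
        have \<delta>: "\<delta> > 0" using \<gamma> R(1) by (simp add: \<delta>_def)
        have "\<forall>p\<in>?P. \<exists>\<mu>. snd p = multi_list \<mu>"
        proof
          fix p assume "p \<in> ?P"
          then have "subseq (snd p) ?L" using splits_subseq[of "fst p" "snd p" ?L] by simp
          then show "\<exists>\<mu>. snd p = multi_list \<mu>" by (rule subseq_multi_list) (rule exI)
        qed
        from bchoice[OF this] obtain \<mu> where \<mu>0: "\<forall>p\<in>?P. snd p = multi_list (\<mu> p)" by (elim exE)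
        have \<mu>: "snd p = multi_list (\<mu> p)" if "p \<in> ?P" for p by (rule bspec[OF \<mu>0 that])
        let ?B = "\<lambda>p. seminorm_ball E U \<phi> \<rho> l K (\<mu> p) \<zeta>1 \<delta>"
        have B: "?B p \<in> seminorm_balls E" for p
          unfolding seminorm_balls_def using t1 t K \<delta> by blast
        have "splits L \<noteq> []" for L :: "'n list" by (induction L) auto
        then have ne: "?P \<noteq> {}" by simp
        show ?thesis
        proof (intro exI[of _ "\<Inter>(?B ` ?P)"] conjI subsetI)
          show "openin ?T (\<Inter>(?B ` ?P))"
            using ne basic[OF B] by (intro openin_Inter) auto
          show "\<zeta>1 \<in> \<Inter>(?B ` ?P)" using seminorm_ball_center[OF t1 \<delta>] by blast
          fix \<zeta> assume \<zeta>: "\<zeta> \<in> \<Inter>(?B ` ?P)"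
          obtain p0 where p0: "p0 \<in> ?P" using ne unfolding ex_in_conv[symmetric] by (elim exE)
          have \<zeta>B: "\<zeta> \<in> ?B p0" using \<zeta> p0 by blast
          then have t\<zeta>: "\<zeta> \<in> test_sections E" by (simp add: seminorm_ball_def)
          have top\<zeta>: "\<zeta> \<in> topspace ?T" unfolding top using \<zeta>B B by blast
          have "\<bar>multi_deriv \<nu> (\<lambda>y. ?c (mult_section E \<eta> \<zeta>) y - ?c \<zeta>0 y) y\<bar> < \<epsilon>" if y: "y \<in> K" for y
          proof -
            have small: "\<bar>partials (snd p) (\<lambda>y. ?c \<zeta> y - ?c \<zeta>1 y) y\<bar> \<le> \<delta>" if p: "p \<in> ?P" for p
            proof -
              have "\<zeta> \<in> ?B p" using \<zeta> p by blast
              then show ?thesis using y \<mu>[OF p] by (simp add: seminorm_ball_def multi_deriv_eq_partials less_imp_le)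
            qed
            have "\<bar>\<Sum>p\<leftarrow>splits ?L. partials (fst p) ?\<eta> y * partials (snd p) (\<lambda>y. ?c \<zeta> y - ?c \<zeta>1 y) y\<bar> \<le>
                (\<Sum>p\<leftarrow>splits ?L. \<bar>partials (fst p) ?\<eta> y * partials (snd p) (\<lambda>y. ?c \<zeta> y - ?c \<zeta>1 y) y\<bar>)"
              using sum_list_abs[of "map (\<lambda>p. partials (fst p) ?\<eta> y * partials (snd p) (\<lambda>y. ?c \<zeta> y - ?c \<zeta>1 y) y) (splits ?L)"]
              by (simp add: comp_def)
            also have "\<dots> \<le> (\<Sum>p\<leftarrow>splits ?L. R * \<delta>)"
              by (rule sum_list_mono, unfold abs_mult, rule mult_mono) (use R y small in auto)
            also have "\<dots> = ?n * (R * \<delta>)" by (simp add: sum_list_triv)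
            also have "\<dots> < \<gamma>"
            proof -
              have "?n * (R * \<delta>) < (?n + 1) * (R * \<delta>)" using R(1) \<delta> by simp
              also have "\<dots> = (R * (?n + 1)) * \<delta>" by (simp only: mult_ac)
              also have "\<dots> = \<gamma>"
              proof -
                have "?n + 1 > 0" by (rule add_nonneg_pos) simp_all
                then have "R * (?n + 1) \<noteq> 0" using R(1) by simp
                then show ?thesis unfolding \<delta>_def by (rule nonzero_mult_div_cancel_left[THEN trans[OF times_divide_eq_right]])
              qed
              finally show ?thesis .
            qed
            finally have "\<bar>\<Sum>p\<leftarrow>splits ?L. partials (fst p) ?\<eta> y * partials (snd p) (\<lambda>y. ?c \<zeta> y - ?c \<zeta>1 y) y\<bar> < \<gamma>" .
            then show ?thesis
              using y0(2)[OF y] unfolding dec[OF subsetD[OF K(2) y] t\<zeta>] \<gamma>_def by linarith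
          qed
          then have "mult_section E \<eta> \<zeta> \<in> X"
            using test_sections_mult[OF E \<eta> t\<zeta>] by (simp add: Xeq seminorm_ball_def)
          then show "\<zeta> \<in> mult_section E \<eta> -` X \<inter> topspace ?T" using top\<zeta> by simp
        qed
      qed
    qed
  qed
  moreover have "mult_section E \<eta> ` topspace ?T \<subseteq> \<Union>(seminorm_balls E)"
  proof
    fix \<zeta>' assume "\<zeta>' \<in> mult_section E \<eta> ` topspace ?T"
    then obtain \<zeta> where \<zeta>: "\<zeta>' = mult_section E \<eta> \<zeta>" "\<zeta> \<in> topspace ?T" by blast
    then obtain X where "X \<in> seminorm_balls E" unfolding top by blast
    then obtain \<zeta>0 :: "('m, 'e, real ^ 'n, 'n) dual_section" and U \<phi> \<rho> and l :: 'r and K \<nu> \<epsilon>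
      where t: "total_triv_triple E U \<phi> \<rho>" "compact K" "K \<subseteq> \<phi> ` U" "(0::real) < \<epsilon>"
      unfolding seminorm_balls_def by blast
    have t': "\<zeta>' \<in> test_sections E" unfolding \<zeta>(1) by (rule test_sections_mult[OF E \<eta> test[OF \<zeta>(2)]])
    have "seminorm_ball E U \<phi> \<rho> l K (\<lambda>_. 0) \<zeta>' \<epsilon> \<in> seminorm_balls E"
      unfolding seminorm_balls_def using t t' by blast
    then show "\<zeta>' \<in> \<Union>(seminorm_balls E)" using seminorm_ball_center[OF t' t(4)] by blast
  qed
  ultimately show ?thesis
    unfolding test_topology_eq continuous_on_generated_topo_iff by simp
qed

lemma distributions_mult:
  fixes E :: "('m::{t2_space, second_countable_topology}, 'e::{t2_space, second_countable_topology},
     real ^ 'n::finite, real ^ 'r::finite) vector_bundle"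
  assumes E: "smooth_vector_bundle E" and \<eta>: "smooth_function (base_atlas E) \<eta>" and u: "u \<in> distributions E"
  shows "mult_distribution E \<eta> u \<in> distributions E"
  unfolding distributions_def
proof (intro CollectI conjI ballI allI)
  show "mult_distribution E \<eta> u (\<lambda>a V. \<zeta> a V + \<zeta>' a V) = mult_distribution E \<eta> u \<zeta> + mult_distribution E \<eta> u \<zeta>'"
    if "\<zeta> \<in> test_sections E" "\<zeta>' \<in> test_sections E" for \<zeta> \<zeta>'
  proof -
    have "mult_section E \<eta> (\<lambda>a V. \<zeta> a V + \<zeta>' a V) = (\<lambda>a V. mult_section E \<eta> \<zeta> a V + mult_section E \<eta> \<zeta>' a V)"
      by (simp add: mult_section_def distrib_left)
    then show ?thesis
      using u test_sections_mult[OF E \<eta> that(1)] test_sections_mult[OF E \<eta> that(2)]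
      by (simp add: mult_distribution_eq distributions_def)
  qed
  show "mult_distribution E \<eta> u (\<lambda>a V. c * \<zeta> a V) = c * mult_distribution E \<eta> u \<zeta>"
    if "\<zeta> \<in> test_sections E" for \<zeta> c
  proof -
    have "mult_section E \<eta> (\<lambda>a V. c * \<zeta> a V) = (\<lambda>a V. c * mult_section E \<eta> \<zeta> a V)"
      by (simp add: mult_section_def mult.left_commute)
    then show ?thesis
      using u test_sections_mult[OF E \<eta> that] by (simp add: mult_distribution_eq distributions_def)
  qed
  have "continuous_map (test_topology E) euclideanreal u" using u by (simp add: distributions_def)
  from continuous_map_compose[OF continuous_map_mult_section[OF E \<eta>] this]
  show "continuous_map (test_topology E) euclideanreal (mult_distribution E \<eta> u)"
    by (simp add: comp_def mult_distribution_eq[abs_def])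
qed

section \<open>Boundedness on the Sobolev space of sections\<close>

text \<open>
  Where \<open>\<psi>\<close> does not vanish the factors \<open>\<eta>\<close> and \<open>\<theta> \<circ> \<phi>\<close> agree, so the two functionals evaluate \<open>u\<close> at the same
  section, for every \<open>\<xi>\<close>.
\<close>

lemma local_rep_mult:
  assumes "\<And>x. x \<in> dom_of P \<Longrightarrow> \<psi> x \<noteq> 0 \<Longrightarrow> \<theta> (coord_of P x) = \<eta> x"
  shows "local_rep E P (mult_distribution E \<psi> (mult_distribution E \<eta> u)) l =
    (\<lambda>\<xi>. local_rep E P (mult_distribution E \<psi> u) l (\<lambda>y. \<theta> y * \<xi> y))"
proof
  fix \<xi>
  have "mult_section E \<eta> (mult_section E \<psi> (local_test_section E P l \<xi>)) =
      mult_section E \<psi> (local_test_section E P l (\<lambda>y. \<theta> y * \<xi> y))"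
  proof (intro ext)
    fix a V
    show "mult_section E \<eta> (mult_section E \<psi> (local_test_section E P l \<xi>)) a V =
      mult_section E \<psi> (local_test_section E P l (\<lambda>y. \<theta> y * \<xi> y)) a V"
      using assms[of "bproj E a"]
      by (cases "\<psi> (bproj E a) = 0") (simp_all add: mult_section_def local_test_section_def Let_def)
  qed
  then show "local_rep E P (mult_distribution E \<psi> (mult_distribution E \<eta> u)) l \<xi> =
    local_rep E P (mult_distribution E \<psi> u) l (\<lambda>y. \<theta> y * \<xi> y)"
    by (simp add: local_rep_def mult_distribution_eq)
qed

lemma sobolev_norm_bundle_mult:
  fixes E :: "('m::{t2_space, second_countable_topology}, 'e::{t2_space, second_countable_topology},
               real ^ 'n::finite, real ^ 'r::finite) vector_bundle"
  assumes cpt: "compact (UNIV :: 'm set)" and E: "smooth_vector_bundle E"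
    and \<Lambda>: "augmented_total_triv_atlas E N \<Lambda>" and q: "1 < q" and \<eta>: "smooth_function (base_atlas E) \<eta>"
  obtains C where "C \<ge> 0" "\<And>u. sobolev_norm_bundle E N \<Lambda> e q (mult_distribution E \<eta> u)
                    \<le> ennreal C * sobolev_norm_bundle E N \<Lambda> e q u"
proof -
  have A: "smooth_atlas (base_atlas E)" using E by (simp add: smooth_vector_bundle_def)
  let ?S = "\<lambda>\<alpha> u l. sobolev_norm e q (coord_of (\<Lambda> \<alpha>) ` dom_of (\<Lambda> \<alpha>))
        (local_rep E (\<Lambda> \<alpha>) (mult_distribution E (weight_of (\<Lambda> \<alpha>)) u) l)"
  have "\<exists>C>0. \<forall>u l. ?S \<alpha> (mult_distribution E \<eta> u) l \<le> ennreal C * ?S \<alpha> u l" if \<alpha>: "\<alpha> \<in> {1..N}" for \<alpha>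
  proof -
    let ?P = "\<Lambda> \<alpha>"
    have c: "(dom_of ?P, coord_of ?P) \<in> smooth_charts (base_atlas E)"
      and supp: "closure {x. weight_of ?P x \<noteq> 0} \<subseteq> dom_of ?P"
      using \<Lambda> \<alpha> by (auto simp: augmented_total_triv_atlas_def total_triv_triple_def)
    obtain \<theta> where \<theta>: "\<theta> \<in> test_functions (coord_of ?P ` dom_of ?P)"
      "\<And>x. x \<in> dom_of ?P \<Longrightarrow> weight_of ?P x \<noteq> 0 \<Longrightarrow> \<theta> (coord_of ?P x) = \<eta> x"
  proof (rule coordinate_multiplier[OF cpt A \<eta> c supp], goal_cases)
    case (1 C)
    show ?case by (rule 1(1)[OF 1(2) 1(3)])
  qed
    obtain C where C: "C > 0" "\<And>T. sobolev_norm e q (coord_of ?P ` dom_of ?P) (\<lambda>\<xi>. T (\<lambda>x. \<theta> x * \<xi> x)) \<le>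
        ennreal C * sobolev_norm e q (coord_of ?P ` dom_of ?P) T"
  proof (rule sobolev_norm_mult_test_function[OF smooth_chartsD(2)[OF c] \<theta>(1) q, of e], goal_cases)
    case (1 C)
    show ?case by (rule 1(1)[OF 1(2) 1(3)])
  qed
    have "?S \<alpha> (mult_distribution E \<eta> u) l \<le> ennreal C * ?S \<alpha> u l" for u l
    proof -
      have eq: "local_rep E ?P (mult_distribution E (weight_of ?P) (mult_distribution E \<eta> u)) l =
        (\<lambda>\<xi>. local_rep E ?P (mult_distribution E (weight_of ?P) u) l (\<lambda>y. \<theta> y * \<xi> y))"
        by (rule local_rep_mult) (rule \<theta>(2))
      show ?thesis unfolding eq by (rule C(2))
    qed
    then show ?thesis using C(1) by blast
  qed
  then obtain C where C: "\<And>\<alpha>. \<alpha> \<in> {1..N} \<Longrightarrow> C \<alpha> > 0"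
    "\<And>\<alpha> u l. \<alpha> \<in> {1..N} \<Longrightarrow> ?S \<alpha> (mult_distribution E \<eta> u) l \<le> ennreal (C \<alpha>) * ?S \<alpha> u l"
    by metis
  show ?thesis
  proof (rule that[of "\<Sum>\<alpha>=1..N. C \<alpha>"])
    show "(\<Sum>\<alpha>=1..N. C \<alpha>) \<ge> 0" using C(1) by (intro sum_nonneg) (auto intro: less_imp_le)
    fix u
    have "?S \<alpha> (mult_distribution E \<eta> u) l \<le> ennreal (\<Sum>\<alpha>=1..N. C \<alpha>) * ?S \<alpha> u l" if \<alpha>: "\<alpha> \<in> {1..N}" for \<alpha> l
    proof -
      have "C \<alpha> \<le> (\<Sum>\<alpha>=1..N. C \<alpha>)" using \<alpha> C(1) by (intro member_le_sum) (auto intro: less_imp_le)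
      then have "ennreal (C \<alpha>) * ?S \<alpha> u l \<le> ennreal (\<Sum>\<alpha>=1..N. C \<alpha>) * ?S \<alpha> u l"
        by (intro mult_right_mono ennreal_leI) auto
      then show ?thesis using C(2)[OF \<alpha>] order_trans by blast
    qed
    then show "sobolev_norm_bundle E N \<Lambda> e q (mult_distribution E \<eta> u) \<le>
        ennreal (\<Sum>\<alpha>=1..N. C \<alpha>) * sobolev_norm_bundle E N \<Lambda> e q u"
      unfolding sobolev_norm_bundle_def sum_distrib_left by (intro sum_mono) blast
  qed
qed

theorem theorem9p9:
  fixes E :: "('m::{t2_space, second_countable_topology}, 'e::{t2_space, second_countable_topology},
               real ^ 'n::finite, real ^ 'r::finite) vector_bundle"
    and N :: nat
    and \<Lambda> :: "nat \<Rightarrow> ('m, 'e, real ^ 'n, real ^ 'r) triv_piece"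
    and e q :: real
    and \<eta> :: "'m \<Rightarrow> real"
  assumes "compact (UNIV :: 'm set)"
    and "smooth_vector_bundle E"
    and "augmented_total_triv_atlas E N \<Lambda>"
    and "1 < q"
    and "smooth_function (base_atlas E) \<eta>"
    and "e < - 1 \<and> e \<notin> \<int> \<longrightarrow> GGL N \<Lambda>"
  defines "W \<equiv> sobolev_space_bundle E N \<Lambda> e q"
    and "m \<equiv> mult_distribution E \<eta>"
  shows "m ` W \<subseteq> W \<and>
    (\<forall>u\<in>W. \<forall>v\<in>W. m (\<lambda>\<zeta>. u \<zeta> + v \<zeta>) = (\<lambda>\<zeta>. m u \<zeta> + m v \<zeta>)) \<and>
    (\<forall>c. \<forall>u\<in>W. m (\<lambda>\<zeta>. c * u \<zeta>) = (\<lambda>\<zeta>. c * m u \<zeta>)) \<and>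
    (\<exists>C\<ge>0. \<forall>u\<in>W. sobolev_norm_bundle E N \<Lambda> e q (m u)
                    \<le> ennreal C * sobolev_norm_bundle E N \<Lambda> e q u)"
proof -
  obtain C where C: "C \<ge> 0" "\<And>u. sobolev_norm_bundle E N \<Lambda> e q (m u)
                    \<le> ennreal C * sobolev_norm_bundle E N \<Lambda> e q u"
    unfolding m_def
  proof (rule sobolev_norm_bundle_mult[OF assms(1-5), of e], goal_cases)
    case (1 C)
    show ?case by (rule 1(1)[OF 1(2) 1(3)])
  qed
  have "m u \<in> W" if u: "u \<in> W" for u
  proof -
    have "m u \<in> distributions E"
      using u unfolding W_def m_def sobolev_space_bundle_def
      by (intro distributions_mult[OF assms(2,5)]) simp
    moreover have "ennreal C * sobolev_norm_bundle E N \<Lambda> e q u < \<infinity>"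
      using u by (simp add: W_def sobolev_space_bundle_def ennreal_mult_less_top)
    ultimately show ?thesis
      using order_le_less_trans[OF C(2)] by (simp add: W_def sobolev_space_bundle_def)
  qed
  moreover have "\<exists>C\<ge>0. \<forall>u\<in>W. sobolev_norm_bundle E N \<Lambda> e q (m u)
                    \<le> ennreal C * sobolev_norm_bundle E N \<Lambda> e q u"
    using C by blast
  ultimately show ?thesis
    by (auto simp: m_def mult_distribution_def)
qed

end
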